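(* The Sierpinski space $\mathbb{S}$, regarded as a subset of $\Omega$, is a dominance: for every proposition $p \in \Omega$ and every $s \in \mathbb{S}$, if $s$ implies that $p \in \mathbb{S}$, then $s \land p \in \mathbb{S}$.
   Context: Foundations: constructive, predicative mathematics (sets in homotopy type theory): no excluded middle, no choice principles; function extensionality and unique choice hold. $\Omega$ denotes a set of (small) propositions, partially ordered by implication. A set $I$ is enumerable if there merely exists a surjection $\mathbb{N} \twoheadrightarrow I$ (so enumerable sets are inhabited). An $\omega$-cpo is a partial order with joins of all enumerable directed subsets; a map of $\omega$-cpos is $\omega$-continuous if it is monotone and preserves these joins. An $\omega$-cpo presentation is a preorder $P$ with a cover relation $p \triangleleft U$ ($p\in P$, $U$ an enumerable directed subset of $P$); a morphism of presentations is a monotone map $f$ with $f(p) \triangleleft f(U)$ whenever $p \triangleleft U$; an $\omega$-cpo $C$ is a presentation via $c \triangleleft U \iff c \le \bigvee U$. It is assumed that every presentation $P$ has a free $\omega$-cpo $\eta: P \to P_\omega$: $\eta$ is a morphism of presentations into an $\omega$-cpo such that every morphism $f : P \to C$ into an $\omega$-cpo factors uniquely as $f = \bar f \eta$ with $\bar f$ $\omega$-continuous. The Sierpinski space is $\mathbb{S} = \mathbb{B}_\omega$, the free $\omega$-cpo over the two-element partial order $\mathbb{B} = \{\bot \le \top\}$ (with no covers). It is a $\sigma$-frame, and the map $\mathbb{S} \to \Omega$, $s \mapsto (s = \top)$, embeds $\mathbb{S}$ as a suborder of $\Omega$ preserving $\bot,\top$, binary meets and enumerable joins; elements of $\mathbb{S}$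 are identified with their image propositions, and for $p\in\Omega$, "$p \in \mathbb{S}$" means $p$ lies in the image. *)

theory Defs
  imports Main
begin

text \<open>
  The theorem belongs to constructive mathematics. Read with the classical connectives of HOL it is
  empty: classically every proposition is \<^term>\<open>True\<close> or \<^term>\<open>False\<close>, so the Sierpinski space is
  all of \<^typ>\<open>bool\<close>. The mathematics is therefore carried out inside a constructive and predicative
  theory of sets, interpreted in an arbitrary first-order structure whose truth values lie in an
  arbitrary frame (complete Heyting algebra). Intuitionistic first-order logic is sound and complete
  for this semantics (the Lindenbaum algebra of a theory embeds into its MacNeille completion,
  preserving the connectives and the suprema and infima that interpret quantifiers), so
  validity in all such models of the axioms is the same as constructive provability from them.
\<close>

section \<open>Intuitionistic first-order logic with values in a frame\<close>

text \<open>The class \<^class>\<open>complete_distrib_lattice\<close> would not do: it asks for complete distributivity, and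
  its members validate the constructively invalid law
  \<open>(\<forall>x. A \<or> B x) \<longrightarrow> A \<or> (\<forall>x. B x)\<close>.\<close>

class frame = complete_lattice +
  assumes inf_Sup_le: "inf a (Sup B) \<le> Sup (inf a ` B)"

definition himp :: "'h::frame \<Rightarrow> 'h \<Rightarrow> 'h"
  where "himp a b = Sup {c. inf c a \<le> b}"

lemma himp_adjoint: "c \<le> himp a b \<longleftrightarrow> inf c (a::'h::frame) \<le> b"
proof
  assume "c \<le> himp a b"
  then have "inf c a \<le> inf a (himp a b)"
    by (simp add: le_infI1)
  also have "\<dots> \<le> Sup (inf a ` {c. inf c a \<le> b})"
    unfolding himp_def by (rule inf_Sup_le)
  also have "\<dots> \<le> b"
    by (rule Sup_least) (auto simp: inf.commute)
  finally show "inf c a \<le> b" .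
next
  assume "inf c a \<le> b"
  then show "c \<le> himp a b"
    unfolding himp_def by (intro Sup_upper) simp
qed

text \<open>A structure is a domain \<^typ>\<open>'u\<close> with a membership relation valued in \<^typ>\<open>'h\<close>; a (closed,
  possibly parametrised) formula is represented by its truth value in each structure.\<close>

type_synonym ('u, 'h) struct = "'u \<Rightarrow> 'u \<Rightarrow> 'h"
type_synonym ('u, 'h) fm = "('u, 'h) struct \<Rightarrow> 'h"

definition holds_in :: "('u, 'h::frame) struct \<Rightarrow> ('u, 'h) fm \<Rightarrow> bool"  (infix "\<Turnstile>" 50)
  where "M \<Turnstile> A \<longleftrightarrow> A M = top"

definition f_mem :: "'u \<Rightarrow> 'u \<Rightarrow> ('u, 'h::frame) fm"  (infix "\<^bold>\<in>" 50)
  where "(x \<^bold>\<in> y) = (\<lambda>M. M x y)"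

definition f_false :: "('u, 'h::frame) fm"  ("\<^bold>\<bottom>")
  where "\<^bold>\<bottom> = (\<lambda>M. bot)"

definition f_and :: "('u, 'h::frame) fm \<Rightarrow> ('u, 'h) fm \<Rightarrow> ('u, 'h) fm"  (infixr "\<^bold>\<and>" 35)
  where "(A \<^bold>\<and> B) = (\<lambda>M. inf (A M) (B M))"

definition f_or :: "('u, 'h::frame) fm \<Rightarrow> ('u, 'h) fm \<Rightarrow> ('u, 'h) fm"  (infixr "\<^bold>\<or>" 30)
  where "(A \<^bold>\<or> B) = (\<lambda>M. sup (A M) (B M))"

definition f_imp :: "('u, 'h::frame) fm \<Rightarrow> ('u, 'h) fm \<Rightarrow> ('u, 'h) fm"  (infixr "\<^bold>\<longrightarrow>" 25)
  where "(A \<^bold>\<longrightarrow> B) = (\<lambda>M. himp (A M) (B M))"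

definition f_all :: "('u \<Rightarrow> ('u, 'h::frame) fm) \<Rightarrow> ('u, 'h) fm"  (binder "\<^bold>\<forall>" 10)
  where "(\<^bold>\<forall>x. A x) = (\<lambda>M. INF x. A x M)"

definition f_ex :: "('u \<Rightarrow> ('u, 'h::frame) fm) \<Rightarrow> ('u, 'h) fm"  (binder "\<^bold>\<exists>" 10)
  where "(\<^bold>\<exists>x. A x) = (\<lambda>M. SUP x. A x M)"

definition f_not :: "('u, 'h::frame) fm \<Rightarrow> ('u, 'h) fm"  ("\<^bold>\<not> _" [40] 40)
  where "(\<^bold>\<not> A) = (A \<^bold>\<longrightarrow> \<^bold>\<bottom>)"

definition f_iff :: "('u, 'h::frame) fm \<Rightarrow> ('u, 'h) fm \<Rightarrow> ('u, 'h) fm"  (infixr "\<^bold>\<longleftrightarrow>" 25)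
  where "(A \<^bold>\<longleftrightarrow> B) = ((A \<^bold>\<longrightarrow> B) \<^bold>\<and> (B \<^bold>\<longrightarrow> A))"

text \<open>Equality is extensional equality; that it is a congruence for membership on both sides is
  the axiom of extensionality below.\<close>

definition f_eq :: "'u \<Rightarrow> 'u \<Rightarrow> ('u, 'h::frame) fm"  (infix "\<^bold>=" 50)
  where "(x \<^bold>= y) = (\<^bold>\<forall>z. z \<^bold>\<in> x \<^bold>\<longleftrightarrow> z \<^bold>\<in> y)"

definition f_ex1 :: "('u \<Rightarrow> ('u, 'h::frame) fm) \<Rightarrow> ('u, 'h) fm"  (binder "\<^bold>\<exists>\<^bold>!" 10)
  where "(\<^bold>\<exists>\<^bold>!x. A x) = (\<^bold>\<exists>x. A x \<^bold>\<and> (\<^bold>\<forall>y. A y \<^bold>\<longrightarrow> y \<^bold>= x))"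


section \<open>Elementary set theory\<close>

definition subset :: "'u \<Rightarrow> 'u \<Rightarrow> ('u, 'h::frame) fm"  (infix "\<^bold>\<subseteq>" 50)
  where "(a \<^bold>\<subseteq> b) = (\<^bold>\<forall>x. x \<^bold>\<in> a \<^bold>\<longrightarrow> x \<^bold>\<in> b)"

definition is_empty :: "'u \<Rightarrow> ('u, 'h::frame) fm"
  where "is_empty z = (\<^bold>\<forall>x. \<^bold>\<not> x \<^bold>\<in> z)"

definition is_upair :: "'u \<Rightarrow> 'u \<Rightarrow> 'u \<Rightarrow> ('u, 'h::frame) fm"
  where "is_upair c a b = (\<^bold>\<forall>x. x \<^bold>\<in> c \<^bold>\<longleftrightarrow> x \<^bold>= a \<^bold>\<or> x \<^bold>= b)"

definition is_pair :: "'u \<Rightarrow> 'u \<Rightarrow> 'u \<Rightarrow> ('u, 'h::frame) fm"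
  where "is_pair w a b = (\<^bold>\<forall>c. c \<^bold>\<in> w \<^bold>\<longleftrightarrow> is_upair c a a \<^bold>\<or> is_upair c a b)"

definition pair_in :: "'u \<Rightarrow> 'u \<Rightarrow> 'u \<Rightarrow> ('u, 'h::frame) fm"  ("\<langle>_,_\<rangle> \<^bold>\<in> _" [51, 51, 51] 50)
  where "\<langle>a,b\<rangle> \<^bold>\<in> r = (\<^bold>\<exists>w. is_pair w a b \<^bold>\<and> w \<^bold>\<in> r)"

definition is_union :: "'u \<Rightarrow> 'u \<Rightarrow> ('u, 'h::frame) fm"
  where "is_union u a = (\<^bold>\<forall>x. x \<^bold>\<in> u \<^bold>\<longleftrightarrow> (\<^bold>\<exists>y. y \<^bold>\<in> a \<^bold>\<and> x \<^bold>\<in> y))"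

definition is_inter2 :: "'u \<Rightarrow> 'u \<Rightarrow> 'u \<Rightarrow> ('u, 'h::frame) fm"
  where "is_inter2 c a b = (\<^bold>\<forall>x. x \<^bold>\<in> c \<^bold>\<longleftrightarrow> x \<^bold>\<in> a \<^bold>\<and> x \<^bold>\<in> b)"

definition is_succ :: "'u \<Rightarrow> 'u \<Rightarrow> ('u, 'h::frame) fm"
  where "is_succ m n = (\<^bold>\<forall>x. x \<^bold>\<in> m \<^bold>\<longleftrightarrow> x \<^bold>\<in> n \<^bold>\<or> x \<^bold>= n)"

definition is_inductive :: "'u \<Rightarrow> ('u, 'h::frame) fm"
  where "is_inductive I =
    ((\<^bold>\<forall>z. is_empty z \<^bold>\<longrightarrow> z \<^bold>\<in> I) \<^bold>\<and>
     (\<^bold>\<forall>n m. n \<^bold>\<in> I \<^bold>\<longrightarrow> is_succ m n \<^bold>\<longrightarrow> m \<^bold>\<in> I))"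

definition is_nats :: "'u \<Rightarrow> ('u, 'h::frame) fm"
  where "is_nats N = (is_inductive N \<^bold>\<and> (\<^bold>\<forall>I. is_inductive I \<^bold>\<longrightarrow> N \<^bold>\<subseteq> I))"

definition is_fun :: "'u \<Rightarrow> 'u \<Rightarrow> 'u \<Rightarrow> ('u, 'h::frame) fm"
  where "is_fun f A B =
    ((\<^bold>\<forall>w. w \<^bold>\<in> f \<^bold>\<longrightarrow> (\<^bold>\<exists>a b. a \<^bold>\<in> A \<^bold>\<and> b \<^bold>\<in> B \<^bold>\<and> is_pair w a b)) \<^bold>\<and>
     (\<^bold>\<forall>a. a \<^bold>\<in> A \<^bold>\<longrightarrow> (\<^bold>\<exists>\<^bold>!b. \<langle>a,b\<rangle> \<^bold>\<in> f)))"

definition is_image :: "'u \<Rightarrow> 'u \<Rightarrow> 'u \<Rightarrow> ('u, 'h::frame) fm"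
  where "is_image V f U = (\<^bold>\<forall>y. y \<^bold>\<in> V \<^bold>\<longleftrightarrow> (\<^bold>\<exists>x. x \<^bold>\<in> U \<^bold>\<and> \<langle>x,y\<rangle> \<^bold>\<in> f))"

definition enumerable :: "'u \<Rightarrow> ('u, 'h::frame) fm"
  where "enumerable U =
    (\<^bold>\<exists>N e. is_nats N \<^bold>\<and> is_fun e N U \<^bold>\<and> (\<^bold>\<forall>u. u \<^bold>\<in> U \<^bold>\<longrightarrow> (\<^bold>\<exists>n. n \<^bold>\<in> N \<^bold>\<and> \<langle>n,u\<rangle> \<^bold>\<in> e)))"


section \<open>The axioms of constructive predicative set theory\<close>

text \<open>First-order formulas with named variables, needed only for the axiom schemes. Equality is
  expressible through membership.\<close>

datatype form =
    Mem nat nat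
  | Falsity
  | And form form
  | Or form form
  | Imp form form
  | Forall nat form
  | Exists nat form

primrec eval :: "form \<Rightarrow> (nat \<Rightarrow> 'u) \<Rightarrow> ('u, 'h::frame) fm" where
  "eval (Mem i j) \<rho> = (\<rho> i \<^bold>\<in> \<rho> j)"
| "eval Falsity \<rho> = \<^bold>\<bottom>"
| "eval (And A B) \<rho> = (eval A \<rho> \<^bold>\<and> eval B \<rho>)"
| "eval (Or A B) \<rho> = (eval A \<rho> \<^bold>\<or> eval B \<rho>)"
| "eval (Imp A B) \<rho> = (eval A \<rho> \<^bold>\<longrightarrow> eval B \<rho>)"
| "eval (Forall i A) \<rho> = (\<^bold>\<forall>x. eval A (\<rho>(i := x)))"
| "eval (Exists i A) \<rho> = (\<^bold>\<exists>x. eval A (\<rho>(i := x)))"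

inductive bounded_form :: "form \<Rightarrow> bool" where
  "bounded_form (Mem i j)"
| "bounded_form Falsity"
| "bounded_form A \<Longrightarrow> bounded_form B \<Longrightarrow> bounded_form (And A B)"
| "bounded_form A \<Longrightarrow> bounded_form B \<Longrightarrow> bounded_form (Or A B)"
| "bounded_form A \<Longrightarrow> bounded_form B \<Longrightarrow> bounded_form (Imp A B)"
| "bounded_form A \<Longrightarrow> i \<noteq> j \<Longrightarrow> bounded_form (Forall i (Imp (Mem i j) A))"
| "bounded_form A \<Longrightarrow> i \<noteq> j \<Longrightarrow> bounded_form (Exists i (And (Mem i j) A))"

text \<open>
  The axioms are those that Theorem 10.5.8 of the HoTT Book verifies for the cumulative hierarchy in
  homotopy type theory (infinity in the form that provides the least inductive set): there
  is no excluded middle, no choice or collection principle, no power set, and separation is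
  restricted to bounded formulas. Unique choice and function extensionality hold because
  functions are graphs. The parameters of an instance of a scheme are supplied by the
  assignment \<open>\<rho>\<close>.
\<close>

definition ax_extensionality :: "('u, 'h::frame) fm"
  where "ax_extensionality = (\<^bold>\<forall>x y z. x \<^bold>= y \<^bold>\<longrightarrow> x \<^bold>\<in> z \<^bold>\<longrightarrow> y \<^bold>\<in> z)"

definition ax_empty :: "('u, 'h::frame) fm"
  where "ax_empty = (\<^bold>\<exists>z. is_empty z)"

definition ax_pairing :: "('u, 'h::frame) fm"
  where "ax_pairing = (\<^bold>\<forall>a b. \<^bold>\<exists>c. is_upair c a b)"

definition ax_union :: "('u, 'h::frame) fm"
  where "ax_union = (\<^bold>\<forall>a. \<^bold>\<exists>u. is_union u a)"

definition ax_infinity :: "('u, 'h::frame) fm"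
  where "ax_infinity = (\<^bold>\<exists>N. is_nats N)"

definition ax_exponentiation :: "('u, 'h::frame) fm"
  where "ax_exponentiation = (\<^bold>\<forall>a b. \<^bold>\<exists>c. \<^bold>\<forall>f. f \<^bold>\<in> c \<^bold>\<longleftrightarrow> is_fun f a b)"

definition ax_set_induction :: "form \<Rightarrow> (nat \<Rightarrow> 'u) \<Rightarrow> ('u, 'h::frame) fm"
  where "ax_set_induction \<phi> \<rho> =
    ((\<^bold>\<forall>x. (\<^bold>\<forall>y. y \<^bold>\<in> x \<^bold>\<longrightarrow> eval \<phi> (\<rho>(0 := y))) \<^bold>\<longrightarrow> eval \<phi> (\<rho>(0 := x))) \<^bold>\<longrightarrow>
     (\<^bold>\<forall>x. eval \<phi> (\<rho>(0 := x))))"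

definition ax_separation :: "form \<Rightarrow> (nat \<Rightarrow> 'u) \<Rightarrow> ('u, 'h::frame) fm"
  where "ax_separation \<phi> \<rho> =
    (\<^bold>\<forall>a. \<^bold>\<exists>b. \<^bold>\<forall>x. x \<^bold>\<in> b \<^bold>\<longleftrightarrow> x \<^bold>\<in> a \<^bold>\<and> eval \<phi> (\<rho>(0 := x)))"

definition ax_replacement :: "form \<Rightarrow> (nat \<Rightarrow> 'u) \<Rightarrow> ('u, 'h::frame) fm"
  where "ax_replacement \<phi> \<rho> =
    (\<^bold>\<forall>a. (\<^bold>\<forall>x. x \<^bold>\<in> a \<^bold>\<longrightarrow> (\<^bold>\<exists>\<^bold>!y. eval \<phi> (\<rho>(0 := x, 1 := y)))) \<^bold>\<longrightarrow>
      (\<^bold>\<exists>b. \<^bold>\<forall>y. y \<^bold>\<in> b \<^bold>\<longleftrightarrow> (\<^bold>\<exists>x. x \<^bold>\<in> a \<^bold>\<and> eval \<phi> (\<rho>(0 := x, 1 := y)))))"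

definition constructive_set_theory :: "('u, 'h::frame) fm set"
  where "constructive_set_theory =
    {ax_extensionality, ax_empty, ax_pairing, ax_union, ax_infinity, ax_exponentiation}
    \<union> {ax_set_induction \<phi> \<rho> | \<phi> \<rho>. True}
    \<union> {ax_separation \<phi> \<rho> | \<phi> \<rho>. bounded_form \<phi>}
    \<union> {ax_replacement \<phi> \<rho> | \<phi> \<rho>. True}"


section \<open>\<open>\<omega>\<close>-cpos and their presentations\<close>

text \<open>An order relation is a set \<open>R\<close> of pairs; only its pairs of elements of the carrier matter.\<close>

definition preorder :: "'u \<Rightarrow> 'u \<Rightarrow> ('u, 'h::frame) fm"
  where "preorder P L =
    ((\<^bold>\<forall>x. x \<^bold>\<in> P \<^bold>\<longrightarrow> \<langle>x,x\<rangle> \<^bold>\<in> L) \<^bold>\<and>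
     (\<^bold>\<forall>x y z. x \<^bold>\<in> P \<^bold>\<and> y \<^bold>\<in> P \<^bold>\<and> z \<^bold>\<in> P \<^bold>\<and> \<langle>x,y\<rangle> \<^bold>\<in> L \<^bold>\<and> \<langle>y,z\<rangle> \<^bold>\<in> L \<^bold>\<longrightarrow> \<langle>x,z\<rangle> \<^bold>\<in> L))"

definition partial_order :: "'u \<Rightarrow> 'u \<Rightarrow> ('u, 'h::frame) fm"
  where "partial_order C R =
    (preorder C R \<^bold>\<and>
     (\<^bold>\<forall>x y. x \<^bold>\<in> C \<^bold>\<and> y \<^bold>\<in> C \<^bold>\<and> \<langle>x,y\<rangle> \<^bold>\<in> R \<^bold>\<and> \<langle>y,x\<rangle> \<^bold>\<in> R \<^bold>\<longrightarrow> x \<^bold>= y))"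

definition directed :: "'u \<Rightarrow> 'u \<Rightarrow> ('u, 'h::frame) fm"
  where "directed U R =
    ((\<^bold>\<exists>u. u \<^bold>\<in> U) \<^bold>\<and>
     (\<^bold>\<forall>u v. u \<^bold>\<in> U \<^bold>\<and> v \<^bold>\<in> U \<^bold>\<longrightarrow> (\<^bold>\<exists>w. w \<^bold>\<in> U \<^bold>\<and> \<langle>u,w\<rangle> \<^bold>\<in> R \<^bold>\<and> \<langle>v,w\<rangle> \<^bold>\<in> R)))"

definition enumerable_directed_subset :: "'u \<Rightarrow> 'u \<Rightarrow> 'u \<Rightarrow> ('u, 'h::frame) fm"
  where "enumerable_directed_subset U P L = (U \<^bold>\<subseteq> P \<^bold>\<and> enumerable U \<^bold>\<and> directed U L)"

definition is_join :: "'u \<Rightarrow> 'u \<Rightarrow> 'u \<Rightarrow> 'u \<Rightarrow> ('u, 'h::frame) fm"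
  where "is_join j U C R =
    (j \<^bold>\<in> C \<^bold>\<and> (\<^bold>\<forall>u. u \<^bold>\<in> U \<^bold>\<longrightarrow> \<langle>u,j\<rangle> \<^bold>\<in> R) \<^bold>\<and>
     (\<^bold>\<forall>c. c \<^bold>\<in> C \<^bold>\<and> (\<^bold>\<forall>u. u \<^bold>\<in> U \<^bold>\<longrightarrow> \<langle>u,c\<rangle> \<^bold>\<in> R) \<^bold>\<longrightarrow> \<langle>j,c\<rangle> \<^bold>\<in> R))"

definition omega_cpo :: "'u \<Rightarrow> 'u \<Rightarrow> ('u, 'h::frame) fm"
  where "omega_cpo C R =
    (partial_order C R \<^bold>\<and>
     (\<^bold>\<forall>U. enumerable_directed_subset U C R \<^bold>\<longrightarrow> (\<^bold>\<exists>j. is_join j U C R)))"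

definition monotone_fun :: "'u \<Rightarrow> 'u \<Rightarrow> 'u \<Rightarrow> 'u \<Rightarrow> 'u \<Rightarrow> ('u, 'h::frame) fm"
  where "monotone_fun f P L C R =
    (is_fun f P C \<^bold>\<and>
     (\<^bold>\<forall>x y x' y'. x \<^bold>\<in> P \<^bold>\<and> y \<^bold>\<in> P \<^bold>\<and> \<langle>x,y\<rangle> \<^bold>\<in> L \<^bold>\<and> \<langle>x,x'\<rangle> \<^bold>\<in> f \<^bold>\<and> \<langle>y,y'\<rangle> \<^bold>\<in> f \<^bold>\<longrightarrow> \<langle>x',y'\<rangle> \<^bold>\<in> R))"

definition omega_continuous :: "'u \<Rightarrow> 'u \<Rightarrow> 'u \<Rightarrow> 'u \<Rightarrow> 'u \<Rightarrow> ('u, 'h::frame) fm"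
  where "omega_continuous g C R D Q =
    (monotone_fun g C R D Q \<^bold>\<and>
     (\<^bold>\<forall>U V j k. enumerable_directed_subset U C R \<^bold>\<and> is_join j U C R \<^bold>\<and>
        is_image V g U \<^bold>\<and> \<langle>j,k\<rangle> \<^bold>\<in> g \<^bold>\<longrightarrow> is_join k V D Q))"

text \<open>The cover relation is a set \<open>K\<close> of pairs \<open>\<langle>p,U\<rangle>\<close>.\<close>

definition presentation :: "'u \<Rightarrow> 'u \<Rightarrow> 'u \<Rightarrow> ('u, 'h::frame) fm"
  where "presentation P L K =
    (preorder P L \<^bold>\<and>
     (\<^bold>\<forall>w. w \<^bold>\<in> K \<^bold>\<longrightarrow>
        (\<^bold>\<exists>p U. is_pair w p U \<^bold>\<and> p \<^bold>\<in> P \<^bold>\<and> enumerable_directed_subset U P L)))"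

text \<open>A morphism from a presentation into an \<open>\<omega>\<close>-cpo, the cover relation \<open>c \<lhd> V \<longleftrightarrow> c \<le> \<Squnion>V\<close> of the
  latter being unfolded.\<close>

definition morphism_to_cpo :: "'u \<Rightarrow> 'u \<Rightarrow> 'u \<Rightarrow> 'u \<Rightarrow> 'u \<Rightarrow> 'u \<Rightarrow> ('u, 'h::frame) fm"
  where "morphism_to_cpo f P L K C R =
    (monotone_fun f P L C R \<^bold>\<and>
     (\<^bold>\<forall>p U c V j. \<langle>p,U\<rangle> \<^bold>\<in> K \<^bold>\<and> \<langle>p,c\<rangle> \<^bold>\<in> f \<^bold>\<and> is_image V f U \<^bold>\<and> is_join j V C R \<^bold>\<longrightarrow> \<langle>c,j\<rangle> \<^bold>\<in> R))"

definition factors :: "'u \<Rightarrow> 'u \<Rightarrow> 'u \<Rightarrow> ('u, 'h::frame) fm"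
  where "factors f g h =
    (\<^bold>\<forall>x z. \<langle>x,z\<rangle> \<^bold>\<in> f \<^bold>\<longleftrightarrow> (\<^bold>\<exists>y. \<langle>x,y\<rangle> \<^bold>\<in> h \<^bold>\<and> \<langle>y,z\<rangle> \<^bold>\<in> g))"

definition free_omega_cpo :: "'u \<Rightarrow> 'u \<Rightarrow> 'u \<Rightarrow> 'u \<Rightarrow> 'u \<Rightarrow> 'u \<Rightarrow> ('u, 'h::frame) fm"
  where "free_omega_cpo P L K S R \<eta> =
    (presentation P L K \<^bold>\<and> omega_cpo S R \<^bold>\<and> morphism_to_cpo \<eta> P L K S R \<^bold>\<and>
     (\<^bold>\<forall>C Q f. omega_cpo C Q \<^bold>\<and> morphism_to_cpo f P L K C Q \<^bold>\<longrightarrow>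
        (\<^bold>\<exists>\<^bold>!g. omega_continuous g S R C Q \<^bold>\<and> factors f g \<eta>)))"


section \<open>The Sierpinski space and propositions\<close>

text \<open>The chain \<open>\<bottom> \<le> \<top>\<close> is realised on the set \<open>{\<emptyset>, {\<emptyset>}}\<close>, with \<open>b = \<emptyset>\<close> and \<open>t = {\<emptyset>}\<close>.\<close>

definition two_chain :: "'u \<Rightarrow> 'u \<Rightarrow> 'u \<Rightarrow> 'u \<Rightarrow> ('u, 'h::frame) fm"
  where "two_chain B L b t =
    (is_empty b \<^bold>\<and> is_upair t b b \<^bold>\<and> is_upair B b t \<^bold>\<and>
     (\<^bold>\<forall>x y. \<langle>x,y\<rangle> \<^bold>\<in> L \<^bold>\<longleftrightarrow> (x \<^bold>= b \<^bold>\<and> y \<^bold>= b) \<^bold>\<or> (x \<^bold>= b \<^bold>\<and> y \<^bold>= t) \<^bold>\<or> (x \<^bold>= t \<^bold>\<and> y \<^bold>= t)))"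

definition sierpinski :: "'u \<Rightarrow> 'u \<Rightarrow> 'u \<Rightarrow> ('u, 'h::frame) fm"
  where "sierpinski S R tt =
    (\<^bold>\<exists>B L K b t \<eta>. two_chain B L b t \<^bold>\<and> is_empty K \<^bold>\<and> free_omega_cpo B L K S R \<eta> \<^bold>\<and> \<langle>t,tt\<rangle> \<^bold>\<in> \<eta>)"

text \<open>A proposition is represented, as usual, by a subset \<open>p\<close> of \<open>{\<emptyset>}\<close>, namely
  \<open>p = {x \<in> {\<emptyset>}. the proposition holds}\<close>. Implication is then inclusion, conjunction is
  intersection, and existential quantification is union. A set of such propositions qualifies
  as \<open>\<Omega>\<close> if it contains falsity and truth and is closed under conjunction and existential
  quantification over enumerable families. The set of propositions of a universe is one instance; no
  further closure is assumed.\<close>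

definition is_proposition :: "'u \<Rightarrow> ('u, 'h::frame) fm"
  where "is_proposition p = (\<^bold>\<forall>x. x \<^bold>\<in> p \<^bold>\<longrightarrow> is_empty x)"

definition proposition_true :: "'u \<Rightarrow> ('u, 'h::frame) fm"
  where "proposition_true p = (\<^bold>\<exists>x. x \<^bold>\<in> p)"

definition set_of_propositions :: "'u \<Rightarrow> ('u, 'h::frame) fm"
  where "set_of_propositions Om =
    ((\<^bold>\<forall>p. p \<^bold>\<in> Om \<^bold>\<longrightarrow> is_proposition p) \<^bold>\<and>
     (\<^bold>\<forall>b. is_empty b \<^bold>\<longrightarrow> b \<^bold>\<in> Om) \<^bold>\<and>
     (\<^bold>\<forall>t. is_proposition t \<^bold>\<and> proposition_true t \<^bold>\<longrightarrow> t \<^bold>\<in> Om) \<^bold>\<and>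
     (\<^bold>\<forall>p q r. p \<^bold>\<in> Om \<^bold>\<and> q \<^bold>\<in> Om \<^bold>\<and> is_inter2 r p q \<^bold>\<longrightarrow> r \<^bold>\<in> Om) \<^bold>\<and>
     (\<^bold>\<forall>U u. U \<^bold>\<subseteq> Om \<^bold>\<and> enumerable U \<^bold>\<and> is_union u U \<^bold>\<longrightarrow> u \<^bold>\<in> Om))"

text \<open>The map \<open>s \<mapsto> (s = \<top>)\<close> from the Sierpinski space to propositions, and its image in \<open>\<Omega>\<close>.\<close>

definition is_prop_of :: "'u \<Rightarrow> 'u \<Rightarrow> 'u \<Rightarrow> ('u, 'h::frame) fm"
  where "is_prop_of p s tt = (\<^bold>\<forall>x. x \<^bold>\<in> p \<^bold>\<longleftrightarrow> is_empty x \<^bold>\<and> s \<^bold>= tt)"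

definition in_sierpinski :: "'u \<Rightarrow> 'u \<Rightarrow> 'u \<Rightarrow> 'u \<Rightarrow> ('u, 'h::frame) fm"
  where "in_sierpinski p Om S tt = (p \<^bold>\<in> Om \<^bold>\<and> (\<^bold>\<exists>s. s \<^bold>\<in> S \<^bold>\<and> is_prop_of p s tt))"

definition dominance :: "'u \<Rightarrow> 'u \<Rightarrow> 'u \<Rightarrow> ('u, 'h::frame) fm"
  where "dominance Om S tt =
    (\<^bold>\<forall>p s \<sigma>. p \<^bold>\<in> Om \<^bold>\<and> s \<^bold>\<in> S \<^bold>\<and> is_prop_of \<sigma> s tt \<^bold>\<and>
       (proposition_true \<sigma> \<^bold>\<longrightarrow> in_sierpinski p Om S tt) \<^bold>\<longrightarrow>
       (\<^bold>\<exists>q. is_inter2 q \<sigma> p \<^bold>\<and> in_sierpinski q Om S tt))"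

end

theory Submission
  imports Defs
begin

text \<open>
  Validity in \<open>M\<close> is analysed by Kripke-Joyal forcing: a stage is an element \<open>p\<close> of the frame, and
  \<open>p \<tturnstile> A\<close> says that \<open>p\<close> lies below the truth value of \<open>A\<close>; existential quantifiers and disjunctions
  are eliminated by passing to smaller stages.

  The free \<open>\<omega>\<close>-cpo \<open>S\<close> has no proper sub-\<open>\<omega>\<close>-cpo containing \<open>\<bottom>\<close> and \<open>\<top>\<close>, which is an induction
  principle for \<open>S\<close>. Any set \<open>\<Omega>\<close> of propositions that is closed under enumerable unions is an \<open>\<omega>\<close>-cpo,
  so the inclusion of \<open>{\<bottom>, \<top>}\<close> extends to a continuous map \<open>S \<rightarrow> \<Omega>\<close>. By induction this map is
  \<open>s \<mapsto> (s = \<top>)\<close>; hence \<open>\<top>\<close> is compact, and a second induction shows that the map reflects the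
  order. Finally \<open>(s = \<top> \<longrightarrow> p \<in> S) \<longrightarrow> s \<and> p \<in> S\<close> is proved by induction on \<open>s\<close>: if \<open>s\<close> is the join of \<open>U\<close>,
  then \<open>s \<and> p\<close> is the join of the elements \<open>u \<and> p\<close>, and these form an enumerable directed set.
\<close>

section \<open>Forcing\<close>

text \<open>The obstacle is predicativity. Without power set, and with separation only for bounded
  formulas, \<open>S\<close> cannot be cut down by an arbitrary predicate, so induction over
  \<open>S\<close> is available only for predicates that a bounded formula with parameters
  expresses. Hence the syntactic work: pairing and membership of pairs are rewritten with bounded
  quantifiers, and each induction predicate keeps its quantifiers inside sets such as
  \<open>S\<close> and \<open>Om\<close>. Choice is absent as well. At a join an element for
  \<open>u \<and> p\<close> is wanted for all \<open>u\<close> in \<open>U\<close> at once. Unique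
  choice suffices, because reflection of the order makes any two elements of \<open>S\<close> that
  stand for the same proposition equal. The detour through \<open>Om\<close> has one purpose:
  membership in a union comes with a witness. The map into \<open>Om\<close> carries this back to
  \<open>S\<close>, where \<open>j = \<top>\<close> then produces some \<open>u\<close> in
  \<open>U\<close> with \<open>u = \<top>\<close>.\<close>

locale model =
  fixes M :: "('u, 'h::frame) struct"
  assumes axioms: "\<And>A. A \<in> constructive_set_theory \<Longrightarrow> M \<Turnstile> A"
begin

definition forces :: "'h \<Rightarrow> ('u, 'h) fm \<Rightarrow> bool"  (infix "\<tturnstile>" 49)
  where "(p \<tturnstile> A) = (p \<le> A M)"

lemma fmono: "q \<le> p \<Longrightarrow> p \<tturnstile> A \<Longrightarrow> q \<tturnstile> A"
  unfolding forces_def by (rule order_trans)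

lemma all_iff: "p \<tturnstile> (\<^bold>\<forall>x. A x) \<longleftrightarrow> (\<forall>x. p \<tturnstile> A x)"
  unfolding forces_def f_all_def by (simp add: le_INF_iff)

lemma and_iff: "p \<tturnstile> (A \<^bold>\<and> B) \<longleftrightarrow> p \<tturnstile> A \<and> p \<tturnstile> B"
  unfolding forces_def f_and_def by simp

text \<open>The largest stage below \<open>p\<close> that forces \<open>A\<close> is
  \<open>inf p (A M)\<close>; testing all stages below \<open>p\<close> amounts to testing that one,
  which is the adjunction for \<open>himp\<close>.\<close>

lemma imp_iff: "p \<tturnstile> (A \<^bold>\<longrightarrow> B) \<longleftrightarrow> (\<forall>q\<le>p. q \<tturnstile> A \<longrightarrow> q \<tturnstile> B)"
  unfolding forces_def f_imp_def himp_adjoint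
  by (meson inf.cobounded1 inf.cobounded2 inf.bounded_iff inf_le1 inf_le2 order_trans order_refl le_infI)

lemma fimpI: "(\<And>q. q \<le> p \<Longrightarrow> q \<tturnstile> A \<Longrightarrow> q \<tturnstile> B) \<Longrightarrow> p \<tturnstile> (A \<^bold>\<longrightarrow> B)"
  by (simp add: imp_iff)

lemma fmp: "p \<tturnstile> (A \<^bold>\<longrightarrow> B) \<Longrightarrow> p \<tturnstile> A \<Longrightarrow> p \<tturnstile> B"
  by (simp add: imp_iff)

lemma iff_iff: "p \<tturnstile> (A \<^bold>\<longleftrightarrow> B) \<longleftrightarrow> (\<forall>q\<le>p. q \<tturnstile> A \<longleftrightarrow> q \<tturnstile> B)"
  unfolding f_iff_def by (auto simp: and_iff imp_iff)

lemma fexI: "p \<tturnstile> A x \<Longrightarrow> p \<tturnstile> (\<^bold>\<exists>x. A x)"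
  unfolding forces_def f_ex_def by (meson SUP_upper UNIV_I order_trans)

text \<open>Forcing is local: by the frame law \<open>p\<close> is the supremum of the stages
  \<open>inf p (A x M)\<close>, each of which forces an instance \<open>A x\<close>, and whatever
  all of them force is forced at \<open>p\<close>. In general a witness exists only on such a
  cover.\<close>

lemma fexE:
  assumes "p \<tturnstile> (\<^bold>\<exists>x. A x)" and "\<And>q x. q \<le> p \<Longrightarrow> q \<tturnstile> A x \<Longrightarrow> q \<tturnstile> C"
  shows "p \<tturnstile> C"
proof -
  have "p = inf p (SUP x. A x M)"
    using assms(1) by (simp add: forces_def f_ex_def inf_absorb1)
  also have "\<dots> \<le> Sup (inf p ` range (\<lambda>x. A x M))"
    by (rule inf_Sup_le)
  also have "\<dots> \<le> C M"
    using assms(2)[of "inf p (A x M)" x for x] by (intro Sup_least) (auto simp: forces_def)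
  finally show ?thesis by (simp add: forces_def)
qed

lemma forI1: "p \<tturnstile> A \<Longrightarrow> p \<tturnstile> (A \<^bold>\<or> B)"
  and forI2: "p \<tturnstile> B \<Longrightarrow> p \<tturnstile> (A \<^bold>\<or> B)"
  unfolding forces_def f_or_def by (auto intro: le_supI1 le_supI2)

lemma forE:
  assumes "p \<tturnstile> (A \<^bold>\<or> B)" and "\<And>q. q \<le> p \<Longrightarrow> q \<tturnstile> A \<Longrightarrow> q \<tturnstile> C"
    and "\<And>q. q \<le> p \<Longrightarrow> q \<tturnstile> B \<Longrightarrow> q \<tturnstile> C"
  shows "p \<tturnstile> C"
proof -
  \<comment> \<open>The binary join is written as a \<open>Sup\<close> so that the frame law
    applies.\<close>
  have "(A \<^bold>\<or> B) M = Sup {A M, B M}"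
    by (simp add: f_or_def)
  then have "p = inf p (Sup {A M, B M})"
    using assms(1) by (simp add: forces_def inf_absorb1)
  also have "\<dots> \<le> Sup (inf p ` {A M, B M})"
    by (rule inf_Sup_le)
  also have "\<dots> \<le> C M"
    using assms(2)[of "inf p (A M)"] assms(3)[of "inf p (B M)"] by (auto simp: forces_def)
  finally show ?thesis by (simp add: forces_def)
qed

lemma ffalseE: "p \<tturnstile> \<^bold>\<bottom> \<Longrightarrow> p \<tturnstile> C"
  unfolding forces_def f_false_def by (simp add: bot_unique)

lemma not_iff: "p \<tturnstile> (\<^bold>\<not> A) \<longleftrightarrow> (\<forall>q\<le>p. q \<tturnstile> A \<longrightarrow> q \<tturnstile> \<^bold>\<bottom>)"
  unfolding f_not_def by (simp add: imp_iff)

lemma eq_iff: "p \<tturnstile> x \<^bold>= y \<longleftrightarrow> (\<forall>q\<le>p. \<forall>z. q \<tturnstile> z \<^bold>\<in> x \<longleftrightarrow> q \<tturnstile> z \<^bold>\<in> y)"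
  unfolding f_eq_def by (auto simp: all_iff iff_iff)

section \<open>Equality and pairs\<close>

lemma axiom: "A \<in> constructive_set_theory \<Longrightarrow> p \<tturnstile> A"
  using axioms[of A] by (simp add: holds_in_def forces_def)

lemmas kripke_joyal = all_iff and_iff imp_iff iff_iff not_iff

lemma eq_refl: "p \<tturnstile> x \<^bold>= x"
  by (simp add: eq_iff)

lemma eq_sym: "p \<tturnstile> x \<^bold>= y \<Longrightarrow> p \<tturnstile> y \<^bold>= x"
  by (simp add: eq_iff)

lemma eq_trans: "p \<tturnstile> x \<^bold>= y \<Longrightarrow> p \<tturnstile> y \<^bold>= z \<Longrightarrow> p \<tturnstile> x \<^bold>= z"
  by (simp add: eq_iff)

lemma eqI:
  assumes "\<And>q z. q \<le> p \<Longrightarrow> q \<tturnstile> z \<^bold>\<in> x \<Longrightarrow> q \<tturnstile> z \<^bold>\<in> y"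
    and "\<And>q z. q \<le> p \<Longrightarrow> q \<tturnstile> z \<^bold>\<in> y \<Longrightarrow> q \<tturnstile> z \<^bold>\<in> x"
  shows "p \<tturnstile> x \<^bold>= y"
  using assms by (auto simp: eq_iff)

text \<open>Equality is defined through the members of its two sides, so congruence on the right of
  membership is its definition, and congruence on the left is the axiom of extensionality.\<close>

lemma eq_mem_left: "p \<tturnstile> x \<^bold>= y \<Longrightarrow> p \<tturnstile> x \<^bold>\<in> z \<Longrightarrow> p \<tturnstile> y \<^bold>\<in> z"
proof -
  have "p \<tturnstile> ax_extensionality"
    by (rule axiom) (simp add: constructive_set_theory_def)
  then show "p \<tturnstile> x \<^bold>= y \<Longrightarrow> p \<tturnstile> x \<^bold>\<in> z \<Longrightarrow> p \<tturnstile> y \<^bold>\<in> z"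
    unfolding ax_extensionality_def kripke_joyal by blast
qed

lemma eq_mem_right: "p \<tturnstile> x \<^bold>= y \<Longrightarrow> p \<tturnstile> z \<^bold>\<in> x \<Longrightarrow> p \<tturnstile> z \<^bold>\<in> y"
  by (auto simp: eq_iff)

lemma or_mono:
  assumes "p \<tturnstile> (A \<^bold>\<or> B)" and "p \<tturnstile> (A \<^bold>\<longrightarrow> A')" and "p \<tturnstile> (B \<^bold>\<longrightarrow> B')"
  shows "p \<tturnstile> (A' \<^bold>\<or> B')"
  by (rule forE[OF assms(1)]) (use assms(2,3) in \<open>auto simp: imp_iff intro: forI1 forI2\<close>)

lemma or_same: "p \<tturnstile> (A \<^bold>\<or> A) \<longleftrightarrow> p \<tturnstile> A"
  by (auto intro: forI1 elim: forE fmono)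

lemma upair_ex: "p \<tturnstile> (\<^bold>\<exists>c. is_upair c a b)"
proof -
  have "p \<tturnstile> ax_pairing"
    by (rule axiom) (simp add: constructive_set_theory_def)
  then show ?thesis
    by (simp add: ax_pairing_def all_iff)
qed

lemma upair_iff: "p \<tturnstile> is_upair c a b \<longleftrightarrow> (\<forall>q\<le>p. \<forall>x. q \<tturnstile> x \<^bold>\<in> c \<longleftrightarrow> q \<tturnstile> (x \<^bold>= a \<^bold>\<or> x \<^bold>= b))"
  by (auto simp: is_upair_def kripke_joyal)

lemma upair_mem1: "p \<tturnstile> is_upair c a b \<Longrightarrow> p \<tturnstile> a \<^bold>\<in> c"
  and upair_mem2: "p \<tturnstile> is_upair c a b \<Longrightarrow> p \<tturnstile> b \<^bold>\<in> c"
  by (auto simp: upair_iff intro: forI1 forI2 eq_refl)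

lemma upair_unique: "p \<tturnstile> is_upair c a b \<Longrightarrow> p \<tturnstile> is_upair c' a b \<Longrightarrow> p \<tturnstile> c \<^bold>= c'"
  by (simp add: upair_iff eq_iff)

text \<open>Sets are described by relations and not by terms, so replacing equals by equals has to
  be proved for each such relation.\<close>

lemma upair_cong:
  assumes "p \<tturnstile> a \<^bold>= a'" "p \<tturnstile> b \<^bold>= b'" "p \<tturnstile> c \<^bold>= c'" "p \<tturnstile> is_upair c a b"
  shows "p \<tturnstile> is_upair c' a' b'"
proof -
  have "q \<tturnstile> (x \<^bold>= a \<^bold>\<or> x \<^bold>= b) \<longleftrightarrow> q \<tturnstile> (x \<^bold>= a' \<^bold>\<or> x \<^bold>= b')" if "q \<le> p" for q x
    using assms(1,2)[THEN fmono[OF that]]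
    by (auto elim!: or_mono intro!: fimpI dest: fmono intro: eq_trans eq_sym)
  with assms(3,4) show ?thesis
    by (simp add: upair_iff eq_iff)
qed

lemma pair_iff:
  "p \<tturnstile> is_pair w a b \<longleftrightarrow> (\<forall>q\<le>p. \<forall>c. q \<tturnstile> c \<^bold>\<in> w \<longleftrightarrow> q \<tturnstile> (is_upair c a a \<^bold>\<or> is_upair c a b))"
  by (auto simp: is_pair_def kripke_joyal)

lemma pair_unique: "p \<tturnstile> is_pair w a b \<Longrightarrow> p \<tturnstile> is_pair w' a b \<Longrightarrow> p \<tturnstile> w \<^bold>= w'"
  by (simp add: pair_iff eq_iff)

lemma pair_cong:
  assumes "p \<tturnstile> a \<^bold>= a'" "p \<tturnstile> b \<^bold>= b'" "p \<tturnstile> w \<^bold>= w'" "p \<tturnstile> is_pair w a b"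
  shows "p \<tturnstile> is_pair w' a' b'"
proof -
  have "q \<tturnstile> (is_upair c a a \<^bold>\<or> is_upair c a b) \<longleftrightarrow> q \<tturnstile> (is_upair c a' a' \<^bold>\<or> is_upair c a' b')"
    if "q \<le> p" for q c
    using assms(1,2)[THEN fmono[OF that]]
    by (auto elim!: or_mono intro!: fimpI dest: fmono intro: upair_cong eq_sym eq_refl)
  with assms(3,4) show ?thesis
    by (simp add: pair_iff eq_iff)
qed

lemma pair_ex: "p \<tturnstile> (\<^bold>\<exists>w. is_pair w a b)"
proof (rule fexE[OF upair_ex[of p a a]])
  fix q c assume q: "q \<le> p" and c: "q \<tturnstile> is_upair c a a"
  show "q \<tturnstile> (\<^bold>\<exists>w. is_pair w a b)"
  proof (rule fexE[OF upair_ex[of q a b]])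
    fix r d assume r: "r \<le> q" and d: "r \<tturnstile> is_upair d a b"
    note fs = d c[THEN fmono[OF r]]
    show "r \<tturnstile> (\<^bold>\<exists>w. is_pair w a b)"
    proof (rule fexE[OF upair_ex[of r c d]])
      \<comment> \<open>Kuratowski's pair: \<open>w = {c, d}\<close> with \<open>c = {a}\<close> and
        \<open>d = {a, b}\<close>.\<close>
      fix s w assume s: "s \<le> r" and w: "s \<tturnstile> is_upair w c d"
      note fs = fs[THEN fmono[OF s]]
      have "t \<tturnstile> (x \<^bold>= c \<^bold>\<or> x \<^bold>= d) \<longleftrightarrow> t \<tturnstile> (is_upair x a a \<^bold>\<or> is_upair x a b)" if "t \<le> s" for t x
        using fs[THEN fmono[OF that]]
        by (auto elim!: or_mono intro!: fimpI dest: fmono intro: upair_cong upair_unique eq_sym eq_refl)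
      with w have "s \<tturnstile> is_pair w a b"
        by (simp add: pair_iff upair_iff)
      then show "s \<tturnstile> (\<^bold>\<exists>w. is_pair w a b)"
        by (rule fexI)
    qed
  qed
qed

lemma pair_mem1: "p \<tturnstile> is_pair w a b \<Longrightarrow> p \<tturnstile> is_upair c a a \<Longrightarrow> p \<tturnstile> c \<^bold>\<in> w"
  and pair_mem2: "p \<tturnstile> is_pair w a b \<Longrightarrow> p \<tturnstile> is_upair c a b \<Longrightarrow> p \<tturnstile> c \<^bold>\<in> w"
  by (auto simp: pair_iff intro: forI1 forI2)

lemma pair_mem_cases: "p \<tturnstile> is_pair w a b \<Longrightarrow> p \<tturnstile> c \<^bold>\<in> w \<Longrightarrow> p \<tturnstile> (is_upair c a a \<^bold>\<or> is_upair c a b)"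
  by (simp add: pair_iff)

lemma upair_cases: "p \<tturnstile> is_upair c a b \<Longrightarrow> p \<tturnstile> x \<^bold>\<in> c \<Longrightarrow> p \<tturnstile> (x \<^bold>= a \<^bold>\<or> x \<^bold>= b)"
  by (simp add: upair_iff)

lemma singleton_eq: "p \<tturnstile> is_upair c a a \<Longrightarrow> p \<tturnstile> x \<^bold>\<in> c \<Longrightarrow> p \<tturnstile> x \<^bold>= a"
  by (simp add: upair_iff or_same)

text \<open>\<open>{a}\<close> is a member of \<open>w\<close>, hence is \<open>{a'}\<close> or
  \<open>{a', b'}\<close>; either way it contains \<open>a'\<close>.\<close>

lemma pair_inj1:
  assumes w: "p \<tturnstile> is_pair w a b" "p \<tturnstile> is_pair w a' b'"
  shows "p \<tturnstile> a \<^bold>= a'"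
proof (rule fexE[OF upair_ex[of p a a]])
  fix q c assume q: "q \<le> p" and c: "q \<tturnstile> is_upair c a a"
  note w = w[THEN fmono[OF q]]
  have "q \<tturnstile> (is_upair c a' a' \<^bold>\<or> is_upair c a' b')"
    using pair_mem_cases pair_mem1 w c by blast
  then have "q \<tturnstile> a' \<^bold>\<in> c"
    by (rule forE) (auto intro: upair_mem1)
  with c show "q \<tturnstile> a \<^bold>= a'"
    by (blast intro: singleton_eq eq_sym)
qed

text \<open>The classical argument decides whether \<open>a\<close> equals \<open>b\<close>, which
  is impossible here. Instead \<open>{a, b}\<close> is a member of \<open>w\<close>, which yields
  \<open>b = a'\<close> or \<open>b = b'\<close>. If \<open>b = a'\<close>, then
  \<open>b = a\<close> by \<open>pair_inj1\<close>, and membership of \<open>{a', b'}\<close> in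
  \<open>w\<close> yields \<open>b' = a\<close> or \<open>b' = b\<close>, both of which mean
  \<open>b' = b\<close>.\<close>

lemma pair_inj2:
  assumes w: "p \<tturnstile> is_pair w a b" "p \<tturnstile> is_pair w a' b'"
  shows "p \<tturnstile> b \<^bold>= b'"
proof (rule fexE[OF upair_ex[of p a b]])
  fix q c assume q: "q \<le> p" and c: "q \<tturnstile> is_upair c a b"
  note w = w[THEN fmono[OF q]]
  have ca: "q \<tturnstile> (is_upair c a' a' \<^bold>\<or> is_upair c a' b')"
    using pair_mem_cases pair_mem2 w c by blast
  have bc: "q \<tturnstile> b \<^bold>\<in> c"
    using c by (rule upair_mem2)
  have aa: "q \<tturnstile> a \<^bold>= a'"
    using w by (rule pair_inj1)
  have "q \<tturnstile> (b \<^bold>= a' \<^bold>\<or> b \<^bold>= b')"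
    using ca by (rule forE) (use bc in \<open>blast intro: fmono forI1 singleton_eq upair_cases\<close>)+
  then show "q \<tturnstile> b \<^bold>= b'"
  proof (rule forE)
    fix r assume r: "r \<le> q" and b: "r \<tturnstile> b \<^bold>= a'"
    note fs = w[THEN fmono[OF r]] b aa[THEN fmono[OF r]]
    show "r \<tturnstile> b \<^bold>= b'"
    proof (rule fexE[OF upair_ex[of r a' b']])
      fix s d assume s: "s \<le> r" and d: "s \<tturnstile> is_upair d a' b'"
      note fs = fs[THEN fmono[OF s]] d
      have "s \<tturnstile> (is_upair d a a \<^bold>\<or> is_upair d a b)"
        using pair_mem_cases pair_mem2 fs by blast
      then have "s \<tturnstile> (b' \<^bold>= a \<^bold>\<or> b' \<^bold>= b)"
        by (rule forE) (use fs upair_mem2 in \<open>blast intro: fmono forI1 singleton_eq upair_cases\<close>)+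
      then show "s \<tturnstile> b \<^bold>= b'"
        by (rule forE) (use fs in \<open>blast intro: eq_trans eq_sym dest: fmono\<close>)+
    qed
  qed simp
qed

lemma pair_inI: "p \<tturnstile> is_pair w a b \<Longrightarrow> p \<tturnstile> w \<^bold>\<in> r \<Longrightarrow> p \<tturnstile> \<langle>a,b\<rangle> \<^bold>\<in> r"
  unfolding pair_in_def by (rule fexI) (simp add: and_iff)

lemma pair_inE:
  assumes "p \<tturnstile> \<langle>a,b\<rangle> \<^bold>\<in> r"
    and "\<And>q w. q \<le> p \<Longrightarrow> q \<tturnstile> is_pair w a b \<Longrightarrow> q \<tturnstile> w \<^bold>\<in> r \<Longrightarrow> q \<tturnstile> C"
  shows "p \<tturnstile> C"
  using assms(1) unfolding pair_in_def by (rule fexE) (auto simp: and_iff intro: assms(2))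

lemma pair_in_cong:
  assumes "p \<tturnstile> a \<^bold>= a'" "p \<tturnstile> b \<^bold>= b'" "p \<tturnstile> \<langle>a,b\<rangle> \<^bold>\<in> r"
  shows "p \<tturnstile> \<langle>a',b'\<rangle> \<^bold>\<in> r"
  using assms(3) by (rule pair_inE) (use assms(1,2) in \<open>blast intro: pair_inI pair_cong eq_refl dest: fmono\<close>)

section \<open>Definability\<close>

text \<open>Antisymmetry of the frame. An equation of truth values, unlike an equivalence that is
  forced, can be used for rewriting below quantifiers.\<close>

lemma value_eqI: "(\<And>p. p \<tturnstile> A \<longleftrightarrow> p \<tturnstile> B) \<Longrightarrow> A M = B M"
  unfolding forces_def by (meson order.refl order.antisym)

text \<open>Only the right-to-left half of the equivalence in \<open>is_upair\<close> speaks of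
  arbitrary \<open>x\<close>. That half amounts to the two memberships, which leaves a quantifier
  bounded by \<open>c\<close>, as separation demands.\<close>

lemma upair_bounded:
  "is_upair c a b M = (a \<^bold>\<in> c \<^bold>\<and> b \<^bold>\<in> c \<^bold>\<and> (\<^bold>\<forall>x. x \<^bold>\<in> c \<^bold>\<longrightarrow> x \<^bold>= a \<^bold>\<or> x \<^bold>= b)) M"
proof (rule value_eqI)
  fix p
  have "q \<tturnstile> x \<^bold>\<in> c" if "p \<tturnstile> a \<^bold>\<in> c" "p \<tturnstile> b \<^bold>\<in> c" "q \<tturnstile> (x \<^bold>= a \<^bold>\<or> x \<^bold>= b)" "q \<le> p" for q x
    using that(3) by (rule forE) (use that(1,2,4) in \<open>blast intro: eq_mem_left eq_sym fmono order_trans\<close>)+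
  then show "p \<tturnstile> is_upair c a b \<longleftrightarrow> p \<tturnstile> (a \<^bold>\<in> c \<^bold>\<and> b \<^bold>\<in> c \<^bold>\<and> (\<^bold>\<forall>x. x \<^bold>\<in> c \<^bold>\<longrightarrow> x \<^bold>= a \<^bold>\<or> x \<^bold>= b))"
    unfolding kripke_joyal upair_iff by (metis eq_refl forI1 forI2 order_refl)
qed

text \<open>Bounding the quantifier by \<open>w\<close> rests on the existence of \<open>{a}\<close>
  and \<open>{a, b}\<close>; the converse rests on their uniqueness up to equality.\<close>

lemma pair_bounded:
  "is_pair w a b M =
    ((\<^bold>\<exists>c. c \<^bold>\<in> w \<^bold>\<and> is_upair c a a) \<^bold>\<and> (\<^bold>\<exists>c. c \<^bold>\<in> w \<^bold>\<and> is_upair c a b) \<^bold>\<and>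
     (\<^bold>\<forall>c. c \<^bold>\<in> w \<^bold>\<longrightarrow> is_upair c a a \<^bold>\<or> is_upair c a b)) M" (is "_ = ?B M")
proof (rule value_eqI)
  fix p
  have "p \<tturnstile> ?B" if w: "p \<tturnstile> is_pair w a b"
  proof -
    have "p \<tturnstile> (\<^bold>\<exists>c. c \<^bold>\<in> w \<^bold>\<and> is_upair c a a)"
      by (rule fexE[OF upair_ex[of p a a]], rule fexI) (use w in \<open>auto simp: and_iff intro: pair_mem1 fmono\<close>)
    moreover have "p \<tturnstile> (\<^bold>\<exists>c. c \<^bold>\<in> w \<^bold>\<and> is_upair c a b)"
      by (rule fexE[OF upair_ex[of p a b]], rule fexI) (use w in \<open>auto simp: and_iff intro: pair_mem2 fmono\<close>)
    ultimately show ?thesis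
      using w by (simp add: kripke_joyal pair_iff)
  qed
  moreover have "p \<tturnstile> is_pair w a b" if B: "p \<tturnstile> ?B"
  proof -
    have "q \<tturnstile> c \<^bold>\<in> w" if q: "q \<le> p" and c: "q \<tturnstile> (is_upair c a a \<^bold>\<or> is_upair c a b)" for q c
      using c
    proof (rule forE)
      fix r assume r: "r \<le> q" and c: "r \<tturnstile> is_upair c a a"
      have "r \<tturnstile> (\<^bold>\<exists>c. c \<^bold>\<in> w \<^bold>\<and> is_upair c a a)"
        using B q r by (simp add: and_iff) (blast intro: fmono)
      then show "r \<tturnstile> c \<^bold>\<in> w"
        by (rule fexE) (use c in \<open>auto simp: and_iff intro: eq_mem_left upair_unique dest: fmono\<close>)
    next
      fix r assume r: "r \<le> q" and c: "r \<tturnstile> is_upair c a b"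
      have "r \<tturnstile> (\<^bold>\<exists>c. c \<^bold>\<in> w \<^bold>\<and> is_upair c a b)"
        using B q r by (simp add: and_iff) (blast intro: fmono)
      then show "r \<tturnstile> c \<^bold>\<in> w"
        by (rule fexE) (use c in \<open>auto simp: and_iff intro: eq_mem_left upair_unique dest: fmono\<close>)
    qed
    with B show ?thesis
      by (auto simp: kripke_joyal pair_iff)
  qed
  ultimately show "p \<tturnstile> is_pair w a b \<longleftrightarrow> p \<tturnstile> ?B" ..
qed

end

text \<open>The bounded formulas that express inclusion, equality and pairing; each bound variable exceeds
  the free ones, so it captures none of them.\<close>

definition sub_form :: "nat \<Rightarrow> nat \<Rightarrow> form"
  where "sub_form i j = (let k = Suc (i + j) in Forall k (Imp (Mem k i) (Mem k j)))"

definition eq_form :: "nat \<Rightarrow> nat \<Rightarrow> form"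
  where "eq_form i j = And (sub_form i j) (sub_form j i)"

definition upair_form :: "nat \<Rightarrow> nat \<Rightarrow> nat \<Rightarrow> form"
  where "upair_form c a b =
    (let k = Suc (a + b + c) in And (Mem a c) (And (Mem b c) (Forall k (Imp (Mem k c) (Or (eq_form k a) (eq_form k b))))))"

definition pair_form :: "nat \<Rightarrow> nat \<Rightarrow> nat \<Rightarrow> form"
  where "pair_form w a b =
    (let k = Suc (a + b + w) in And (Exists k (And (Mem k w) (upair_form k a a)))
      (And (Exists k (And (Mem k w) (upair_form k a b)))
        (Forall k (Imp (Mem k w) (Or (upair_form k a a) (upair_form k a b))))))"

definition pair_in_form :: "nat \<Rightarrow> nat \<Rightarrow> nat \<Rightarrow> form"
  where "pair_in_form a b r = (let k = Suc (a + b + r) in Exists k (And (Mem k r) (pair_form k a b)))"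

definition iff_form :: "form \<Rightarrow> form \<Rightarrow> form"
  where "iff_form A B = And (Imp A B) (Imp B A)"

lemma bounded_sub_form: "bounded_form (sub_form i j)"
  by (auto simp: sub_form_def Let_def intro!: bounded_form.intros)

lemma bounded_eq_form: "bounded_form (eq_form i j)"
  by (auto simp: eq_form_def intro!: bounded_form.intros bounded_sub_form)

lemma bounded_upair_form: "bounded_form (upair_form c a b)"
  by (auto simp: upair_form_def Let_def intro!: bounded_form.intros bounded_eq_form)

lemma bounded_pair_form: "bounded_form (pair_form w a b)"
  by (auto simp: pair_form_def Let_def intro!: bounded_form.intros bounded_upair_form)

lemma bounded_pair_in_form: "bounded_form (pair_in_form a b r)"
  by (auto simp: pair_in_form_def Let_def intro!: bounded_form.intros bounded_pair_form)

lemma bounded_iff_form: "bounded_form A \<Longrightarrow> bounded_form B \<Longrightarrow> bounded_form (iff_form A B)"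
  by (auto simp: iff_form_def intro!: bounded_form.intros)

lemmas bounded_intros = bounded_form.intros bounded_sub_form bounded_eq_form bounded_upair_form
  bounded_pair_form bounded_pair_in_form bounded_iff_form

lemma eval_sub_form: "eval (sub_form i j) \<rho> = (\<rho> i \<^bold>\<subseteq> \<rho> j)"
  by (simp add: sub_form_def subset_def)

lemma eval_iff_form: "eval (iff_form A B) \<rho> = (eval A \<rho> \<^bold>\<longleftrightarrow> eval B \<rho>)"
  by (simp add: iff_form_def f_iff_def)

context model
begin

lemmas fm_value = f_and_def f_or_def f_imp_def f_all_def f_ex_def f_iff_def

lemma eval_eq_form: "eval (eq_form i j) \<rho> M = (\<rho> i \<^bold>= \<rho> j) M"
  by (rule value_eqI) (auto simp: eq_form_def eval_sub_form subset_def eq_iff kripke_joyal)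

text \<open>An equation of values in \<open>M\<close>, not of formulas: the bounded description of
  unordered pairs relies on the axioms that \<open>M\<close> satisfies.\<close>

lemma eval_upair_form: "eval (upair_form c a b) \<rho> M = is_upair (\<rho> c) (\<rho> a) (\<rho> b) M"
  unfolding upair_bounded by (simp add: upair_form_def Let_def eval_eq_form fm_value)

lemma eval_pair_form: "eval (pair_form w a b) \<rho> M = is_pair (\<rho> w) (\<rho> a) (\<rho> b) M"
  unfolding pair_bounded by (simp add: pair_form_def Let_def eval_upair_form fm_value)

lemma eval_pair_in_form: "eval (pair_in_form a b r) \<rho> M = (\<langle>\<rho> a,\<rho> b\<rangle> \<^bold>\<in> \<rho> r) M"
  unfolding pair_in_def by (simp add: pair_in_form_def Let_def eval_pair_form fm_value inf_commute)

lemmas eval_forms = eval_sub_form eval_iff_form eval_eq_form eval_upair_form eval_pair_form eval_pair_in_form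

section \<open>Substitution of equals, separation and replacement\<close>

lemma all_spec: "p \<tturnstile> (\<^bold>\<forall>x. A x) \<Longrightarrow> p \<tturnstile> A x"
  by (simp add: all_iff)

text \<open>Relations defined by formulas respect the internal equality, which is coarser than
  equality in HOL. The stage varies in the induction because implication, disjunction and
  existential quantification pass to smaller ones; the antecedent of an implication is transported
  backwards, along the symmetric equality.\<close>

lemma eval_cong:
  assumes "\<And>i. p \<tturnstile> \<rho> i \<^bold>= \<rho>' i" and "p \<tturnstile> eval \<phi> \<rho>"
  shows "p \<tturnstile> eval \<phi> \<rho>'"
  using assms
proof (induction \<phi> arbitrary: p \<rho> \<rho>')
  case (Mem i j)
  then show ?case by (auto intro: eq_mem_left eq_mem_right)
next
  case Falsity
  then show ?case by simp
next
  case (And A B)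
  have "p \<tturnstile> eval A \<rho>'" "p \<tturnstile> eval B \<rho>'"
    using And.prems(2) And.IH(1)[OF And.prems(1)] And.IH(2)[OF And.prems(1)] by (simp_all add: and_iff)
  then show ?case by (simp add: and_iff)
next
  case (Or A B)
  from Or.prems(2) show ?case unfolding eval.simps
  proof (rule or_mono)
    show "p \<tturnstile> (eval A \<rho> \<^bold>\<longrightarrow> eval A \<rho>')"
      by (rule fimpI) (rule Or.IH(1)[OF fmono[OF _ Or.prems(1)]])
    show "p \<tturnstile> (eval B \<rho> \<^bold>\<longrightarrow> eval B \<rho>')"
      by (rule fimpI) (rule Or.IH(2)[OF fmono[OF _ Or.prems(1)]])
  qed
next
  case (Imp A B)
  show ?case unfolding eval.simps
  proof (rule fimpI)
    fix q assume q: "q \<le> p" and A: "q \<tturnstile> eval A \<rho>'"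
    note eq = fmono[OF q Imp.prems(1)]
    have "q \<tturnstile> eval A \<rho>"
      by (rule Imp.IH(1)[OF eq_sym[OF eq] A])
    then have "q \<tturnstile> eval B \<rho>"
      using Imp.prems(2) q by (simp add: imp_iff)
    then show "q \<tturnstile> eval B \<rho>'"
      by (rule Imp.IH(2)[OF eq])
  qed
next
  case (Forall i A)
  have "p \<tturnstile> eval A (\<rho>'(i := x))" for x
  proof (rule Forall.IH)
    show "p \<tturnstile> (\<rho>(i := x)) j \<^bold>= (\<rho>'(i := x)) j" for j
      using Forall.prems(1) by (simp add: eq_refl)
    show "p \<tturnstile> eval A (\<rho>(i := x))"
      using Forall.prems(2) unfolding eval.simps by (rule all_spec)
  qed
  then show ?case by (simp add: all_iff)
next
  case (Exists i A)
  from Exists.prems(2) show ?case unfolding eval.simps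
  proof (rule fexE)
    fix q x assume q: "q \<le> p" and A: "q \<tturnstile> eval A (\<rho>(i := x))"
    have "q \<tturnstile> eval A (\<rho>'(i := x))"
    proof (rule Exists.IH[OF _ A])
      show "q \<tturnstile> (\<rho>(i := x)) j \<^bold>= (\<rho>'(i := x)) j" for j
        using Exists.prems(1) q by (simp add: eq_refl fmono)
    qed
    then show "q \<tturnstile> (\<^bold>\<exists>x. eval A (\<rho>'(i := x)))" by (rule fexI)
  qed
qed

text \<open>Agreement with a bounded formula is asked in \<open>M\<close> only, so that predicates
  defined by unbounded quantifiers, such as \<open>is_pair\<close>, can take part. Variable 0 is the
  element, all others carry parameters.\<close>

definition separable :: "('u \<Rightarrow> ('u, 'h) fm) \<Rightarrow> bool"
  where "separable F \<longleftrightarrow> (\<exists>\<phi> \<rho>. bounded_form \<phi> \<and> (\<forall>x. eval \<phi> (\<rho>(0 := x)) M = F x M))"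

text \<open>Variable 1 is kept free for the values of the function in instances of replacement.\<close>

definition definable :: "('u \<Rightarrow> 'u \<Rightarrow> ('u, 'h) fm) \<Rightarrow> bool"
  where "definable F \<longleftrightarrow> (\<exists>\<phi> \<rho>. \<forall>x y z. eval \<phi> (\<rho>(0 := x, 1 := z, 2 := y)) M = F x y M)"

lemma definable_cong:
  assumes "definable F" "p \<tturnstile> x \<^bold>= x'" "p \<tturnstile> y \<^bold>= y'" "p \<tturnstile> F x y"
  shows "p \<tturnstile> F x' y'"
proof -
  obtain \<phi> \<rho> where F: "\<And>x y z. eval \<phi> (\<rho>(0 := x, 1 := z, 2 := y)) M = F x y M"
    using assms(1) unfolding definable_def by blast
  \<comment> \<open>Variable 1 may hold anything; \<open>x\<close> is an arbitrary filler, the same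
    in both assignments.\<close>
  have "p \<tturnstile> eval \<phi> (\<rho>(0 := x', 1 := x, 2 := y'))"
    by (rule eval_cong[of _ "\<rho>(0 := x, 1 := x, 2 := y)"])
      (use assms(2-4) F in \<open>auto simp: forces_def eq_refl[unfolded forces_def]\<close>)
  then show ?thesis
    using F by (simp add: forces_def)
qed

lemma separation:
  assumes "separable F"
  shows "p \<tturnstile> (\<^bold>\<exists>b. \<^bold>\<forall>x. x \<^bold>\<in> b \<^bold>\<longleftrightarrow> x \<^bold>\<in> a \<^bold>\<and> F x)"
proof -
  obtain \<phi> \<rho> where b: "bounded_form \<phi>" and F: "\<And>x. eval \<phi> (\<rho>(0 := x)) M = F x M"
    using assms unfolding separable_def by blast
  have "p \<tturnstile> ax_separation \<phi> \<rho>"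
    by (rule axiom) (use b in \<open>auto simp: constructive_set_theory_def\<close>)
  then have "p \<tturnstile> (\<^bold>\<exists>b. \<^bold>\<forall>x. x \<^bold>\<in> b \<^bold>\<longleftrightarrow> x \<^bold>\<in> a \<^bold>\<and> eval \<phi> (\<rho>(0 := x)))"
    by (simp add: ax_separation_def all_iff)
  then show ?thesis
    by (simp add: forces_def fm_value F)
qed

lemma replacement_form:
  assumes F: "\<And>x y. eval \<phi> (\<rho>(0 := x, 1 := y)) M = F x y M"
    and "p \<tturnstile> (\<^bold>\<forall>x. x \<^bold>\<in> a \<^bold>\<longrightarrow> (\<^bold>\<exists>\<^bold>!y. F x y))"
  shows "p \<tturnstile> (\<^bold>\<exists>b. \<^bold>\<forall>y. y \<^bold>\<in> b \<^bold>\<longleftrightarrow> (\<^bold>\<exists>x. x \<^bold>\<in> a \<^bold>\<and> F x y))"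
proof -
  have "p \<tturnstile> ax_replacement \<phi> \<rho>"
    by (rule axiom) (auto simp: constructive_set_theory_def)
  then have "p \<tturnstile> ((\<^bold>\<forall>x. x \<^bold>\<in> a \<^bold>\<longrightarrow> (\<^bold>\<exists>\<^bold>!y. eval \<phi> (\<rho>(0 := x, 1 := y)))) \<^bold>\<longrightarrow>
      (\<^bold>\<exists>b. \<^bold>\<forall>y. y \<^bold>\<in> b \<^bold>\<longleftrightarrow> (\<^bold>\<exists>x. x \<^bold>\<in> a \<^bold>\<and> eval \<phi> (\<rho>(0 := x, 1 := y)))))"
    \<comment> \<open>Only the outermost quantifier is opened; the rest must remain a formula, in
      which the evaluation equation for \<open>F\<close> is then rewritten.\<close>
    unfolding ax_replacement_def by (subst (asm) all_iff) (rule spec)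
  then have "p \<tturnstile> (\<^bold>\<forall>x. x \<^bold>\<in> a \<^bold>\<longrightarrow> (\<^bold>\<exists>\<^bold>!y. eval \<phi> (\<rho>(0 := x, 1 := y)))) \<Longrightarrow>
      p \<tturnstile> (\<^bold>\<exists>b. \<^bold>\<forall>y. y \<^bold>\<in> b \<^bold>\<longleftrightarrow> (\<^bold>\<exists>x. x \<^bold>\<in> a \<^bold>\<and> eval \<phi> (\<rho>(0 := x, 1 := y))))"
    by (rule fmp)
  with assms(2) show ?thesis
    by (simp add: forces_def fm_value f_ex1_def F[simplified])
qed

lemma ex1I:
  assumes "p \<tturnstile> (\<^bold>\<exists>x. A x)" and "\<And>q x y. q \<le> p \<Longrightarrow> q \<tturnstile> A x \<Longrightarrow> q \<tturnstile> A y \<Longrightarrow> q \<tturnstile> y \<^bold>= x"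
  shows "p \<tturnstile> (\<^bold>\<exists>\<^bold>!x. A x)"
  using assms(1) unfolding f_ex1_def
  by (rule fexE, intro fexI) (auto simp: kripke_joyal intro: assms(2) fmono order_trans)

lemma ex1_ex: "p \<tturnstile> (\<^bold>\<exists>\<^bold>!x. A x) \<Longrightarrow> p \<tturnstile> (\<^bold>\<exists>x. A x)"
  unfolding f_ex1_def by (erule fexE) (auto simp: and_iff intro: fexI)

lemma ex1_unique:
  assumes "p \<tturnstile> (\<^bold>\<exists>\<^bold>!x. A x)" "p \<tturnstile> A x" "p \<tturnstile> A y"
  shows "p \<tturnstile> x \<^bold>= y"
  using assms(1) unfolding f_ex1_def
proof (rule fexE)
  fix q z assume q: "q \<le> p" and z: "q \<tturnstile> (A z \<^bold>\<and> (\<^bold>\<forall>y. A y \<^bold>\<longrightarrow> y \<^bold>= z))"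
  have "q \<tturnstile> x \<^bold>= z" "q \<tturnstile> y \<^bold>= z"
    using z assms(2,3)[THEN fmono[OF q]] by (auto simp: kripke_joyal)
  then show "q \<tturnstile> x \<^bold>= y" by (blast intro: eq_trans eq_sym)
qed

section \<open>Unions and products\<close>

lemma union_ex: "p \<tturnstile> (\<^bold>\<exists>u. is_union u a)"
proof -
  have "p \<tturnstile> ax_union"
    by (rule axiom) (simp add: constructive_set_theory_def)
  then show ?thesis
    by (simp add: ax_union_def all_iff)
qed

definition is_product :: "'u \<Rightarrow> 'u \<Rightarrow> 'u \<Rightarrow> ('u, 'h) fm"
  where "is_product c a b = (\<^bold>\<forall>w. w \<^bold>\<in> c \<^bold>\<longleftrightarrow> (\<^bold>\<exists>x. x \<^bold>\<in> a \<^bold>\<and> (\<^bold>\<exists>y. y \<^bold>\<in> b \<^bold>\<and> is_pair w x y)))"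

text \<open>Without power set the product cannot be separated from an iterated power set.
  Replacement forms the row \<open>{x} \<times> b\<close> for each \<open>x\<close>, replacement
  again collects the rows, and their union is the product.\<close>

lemma product_ex: "p \<tturnstile> (\<^bold>\<exists>c. is_product c a b)"
proof -
  define row :: "'u \<Rightarrow> 'u \<Rightarrow> ('u, 'h) fm" where "row r x = (\<^bold>\<forall>w. w \<^bold>\<in> r \<^bold>\<longleftrightarrow> (\<^bold>\<exists>y. y \<^bold>\<in> b \<^bold>\<and> is_pair w x y))" for r x
  have row_ex: "q \<tturnstile> (\<^bold>\<exists>r. row r x)" for q x
    unfolding row_def
  proof (rule replacement_form)
    \<comment> \<open>Variables 0 and 1 are the argument \<open>y\<close> and the value
      \<open>w\<close> of replacement; variable 2 is the parameter \<open>x\<close>.\<close>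
    show "eval (pair_form 1 2 0) ((\<lambda>_. x)(0 := y, 1 := w)) M = is_pair w x y M" for y w
      by (simp add: eval_forms)
    show "q \<tturnstile> (\<^bold>\<forall>y. y \<^bold>\<in> b \<^bold>\<longrightarrow> (\<^bold>\<exists>\<^bold>!w. is_pair w x y))"
      by (auto simp: kripke_joyal intro!: ex1I pair_ex intro: pair_unique)
  qed
  moreover have row_unique: "q \<tturnstile> r \<^bold>= r'" if "q \<tturnstile> row r' x" "q \<tturnstile> row r x" for q r r' x
    using that by (simp add: row_def eq_iff all_iff iff_iff)
  ultimately have "p \<tturnstile> (\<^bold>\<forall>x. x \<^bold>\<in> a \<^bold>\<longrightarrow> (\<^bold>\<exists>\<^bold>!r. row r x))"
    using row_unique by (simp add: all_iff imp_iff ex1I)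
  then have "p \<tturnstile> (\<^bold>\<exists>d. \<^bold>\<forall>r. r \<^bold>\<in> d \<^bold>\<longleftrightarrow> (\<^bold>\<exists>x. x \<^bold>\<in> a \<^bold>\<and> row r x))"
  proof (rule replacement_form[rotated])
    \<comment> \<open>\<open>Forall 3\<close> is an unbounded quantifier, which replacement permits;
      variable 2 holds \<open>b\<close>.\<close>
    show "eval (Forall 3 (iff_form (Mem 3 1) (Exists 4 (And (Mem 4 2) (pair_form 3 0 4)))))
      ((\<lambda>_. b)(0 := x, 1 := r)) M = row r x M" for x r
      by (simp add: row_def eval_forms fm_value)
  qed
  then show ?thesis
  proof (rule fexE)
    fix q d assume q: "q \<le> p" and d: "q \<tturnstile> (\<^bold>\<forall>r. r \<^bold>\<in> d \<^bold>\<longleftrightarrow> (\<^bold>\<exists>x. x \<^bold>\<in> a \<^bold>\<and> row r x))"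
    show "q \<tturnstile> (\<^bold>\<exists>c. is_product c a b)"
    proof (rule fexE[OF union_ex[of q d]])
      fix s c assume s: "s \<le> q" and c: "s \<tturnstile> is_union c d"
      note d = d[THEN fmono[OF s]]
      have "t \<tturnstile> (\<^bold>\<exists>r. r \<^bold>\<in> d \<^bold>\<and> w \<^bold>\<in> r) \<longleftrightarrow> t \<tturnstile> (\<^bold>\<exists>x. x \<^bold>\<in> a \<^bold>\<and> (\<^bold>\<exists>y. y \<^bold>\<in> b \<^bold>\<and> is_pair w x y))"
        if t: "t \<le> s" for t w
      proof
        assume "t \<tturnstile> (\<^bold>\<exists>r. r \<^bold>\<in> d \<^bold>\<and> w \<^bold>\<in> r)"
        then show "t \<tturnstile> (\<^bold>\<exists>x. x \<^bold>\<in> a \<^bold>\<and> (\<^bold>\<exists>y. y \<^bold>\<in> b \<^bold>\<and> is_pair w x y))"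
        proof (rule fexE)
          fix u r assume u: "u \<le> t" and r: "u \<tturnstile> (r \<^bold>\<in> d \<^bold>\<and> w \<^bold>\<in> r)"
          have "u \<tturnstile> (\<^bold>\<exists>x. x \<^bold>\<in> a \<^bold>\<and> row r x)"
            using r d order_trans[OF u t] by (simp add: all_iff iff_iff and_iff)
          then show "u \<tturnstile> (\<^bold>\<exists>x. x \<^bold>\<in> a \<^bold>\<and> (\<^bold>\<exists>y. y \<^bold>\<in> b \<^bold>\<and> is_pair w x y))"
            by (rule fexE, intro fexI) (use r in \<open>auto simp: kripke_joyal row_def dest: fmono\<close>)
        qed
      next
        assume "t \<tturnstile> (\<^bold>\<exists>x. x \<^bold>\<in> a \<^bold>\<and> (\<^bold>\<exists>y. y \<^bold>\<in> b \<^bold>\<and> is_pair w x y))"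
        then show "t \<tturnstile> (\<^bold>\<exists>r. r \<^bold>\<in> d \<^bold>\<and> w \<^bold>\<in> r)"
        proof (rule fexE)
          fix u x assume u: "u \<le> t" and x: "u \<tturnstile> (x \<^bold>\<in> a \<^bold>\<and> (\<^bold>\<exists>y. y \<^bold>\<in> b \<^bold>\<and> is_pair w x y))"
          show "u \<tturnstile> (\<^bold>\<exists>r. r \<^bold>\<in> d \<^bold>\<and> w \<^bold>\<in> r)"
          proof (rule fexE[OF row_ex[of u x]])
            fix v r assume v: "v \<le> u" and r: "v \<tturnstile> row r x"
            note x = x[THEN fmono[OF v]]
            have "v \<tturnstile> (\<^bold>\<exists>x. x \<^bold>\<in> a \<^bold>\<and> row r x)"
              by (rule fexI[of _ _ x]) (use x r in \<open>simp add: and_iff\<close>)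
            moreover have "v \<le> s" using v u t by simp
            ultimately have "v \<tturnstile> r \<^bold>\<in> d"
              using d by (simp add: all_iff iff_iff)
            moreover have "v \<tturnstile> w \<^bold>\<in> r"
              using x r by (simp add: row_def kripke_joyal)
            ultimately show "v \<tturnstile> (\<^bold>\<exists>r. r \<^bold>\<in> d \<^bold>\<and> w \<^bold>\<in> r)"
              by (intro fexI[of _ _ r]) (simp add: and_iff)
          qed
        qed
      qed
      with c have "s \<tturnstile> is_product c a b"
        unfolding is_product_def is_union_def kripke_joyal by simp
      then show "s \<tturnstile> (\<^bold>\<exists>c. is_product c a b)" by (rule fexI)
    qed
  qed
qed

lemma bexI: "p \<tturnstile> A x \<Longrightarrow> p \<tturnstile> B x \<Longrightarrow> p \<tturnstile> (\<^bold>\<exists>x. A x \<^bold>\<and> B x)"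
  by (rule fexI) (simp add: and_iff)

lemma bexE:
  assumes "p \<tturnstile> (\<^bold>\<exists>x. A x \<^bold>\<and> B x)"
    and "\<And>q x. q \<le> p \<Longrightarrow> q \<tturnstile> A x \<Longrightarrow> q \<tturnstile> B x \<Longrightarrow> q \<tturnstile> C"
  shows "p \<tturnstile> C"
  using assms(1) by (rule fexE) (auto simp: and_iff intro: assms(2))

lemma subset_iff: "p \<tturnstile> A \<^bold>\<subseteq> B \<longleftrightarrow> (\<forall>q\<le>p. \<forall>x. q \<tturnstile> x \<^bold>\<in> A \<longrightarrow> q \<tturnstile> x \<^bold>\<in> B)"
  by (auto simp: subset_def kripke_joyal)

lemma subsetD: "p \<tturnstile> A \<^bold>\<subseteq> B \<Longrightarrow> p \<tturnstile> x \<^bold>\<in> A \<Longrightarrow> p \<tturnstile> x \<^bold>\<in> B"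
  by (simp add: subset_iff)

section \<open>Functions\<close>

text \<open>A member of \<open>f\<close> is a pair of some elements of \<open>A\<close> and
  \<open>B\<close>; injectivity of pairing identifies them with the given components.\<close>

lemma fun_pair:
  assumes "p \<tturnstile> is_fun f A B" and "p \<tturnstile> \<langle>a,b\<rangle> \<^bold>\<in> f"
  shows "p \<tturnstile> (a \<^bold>\<in> A \<^bold>\<and> b \<^bold>\<in> B)"
  using assms(2)
proof (rule pair_inE)
  fix q w assume q: "q \<le> p" and w: "q \<tturnstile> is_pair w a b" "q \<tturnstile> w \<^bold>\<in> f"
  have "q \<tturnstile> (\<^bold>\<exists>a b. a \<^bold>\<in> A \<^bold>\<and> b \<^bold>\<in> B \<^bold>\<and> is_pair w a b)"
    using fmono[OF q assms(1)] w(2) by (simp add: is_fun_def kripke_joyal)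
  then show "q \<tturnstile> (a \<^bold>\<in> A \<^bold>\<and> b \<^bold>\<in> B)"
    by (elim fexE) (use w(1) in \<open>auto simp: and_iff intro: eq_mem_left pair_inj1 pair_inj2 dest: fmono\<close>)
qed

lemma fun_dom: "p \<tturnstile> is_fun f A B \<Longrightarrow> p \<tturnstile> \<langle>a,b\<rangle> \<^bold>\<in> f \<Longrightarrow> p \<tturnstile> a \<^bold>\<in> A"
  and fun_cod: "p \<tturnstile> is_fun f A B \<Longrightarrow> p \<tturnstile> \<langle>a,b\<rangle> \<^bold>\<in> f \<Longrightarrow> p \<tturnstile> b \<^bold>\<in> B"
  using fun_pair by (auto simp: and_iff)

lemma fun_total: "p \<tturnstile> is_fun f A B \<Longrightarrow> p \<tturnstile> a \<^bold>\<in> A \<Longrightarrow> p \<tturnstile> (\<^bold>\<exists>b. \<langle>a,b\<rangle> \<^bold>\<in> f)"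
  by (rule ex1_ex) (simp add: is_fun_def kripke_joyal)

lemma fun_unique:
  assumes "p \<tturnstile> is_fun f A B" "p \<tturnstile> \<langle>a,b\<rangle> \<^bold>\<in> f" "p \<tturnstile> \<langle>a,b'\<rangle> \<^bold>\<in> f"
  shows "p \<tturnstile> b \<^bold>= b'"
proof -
  have "p \<tturnstile> (\<^bold>\<exists>\<^bold>!b. \<langle>a,b\<rangle> \<^bold>\<in> f)"
    using assms(1) fun_dom[OF assms(1,2)] by (simp add: is_fun_def kripke_joyal)
  then show ?thesis using assms(2,3) by (rule ex1_unique)
qed

lemma funI:
  assumes "p \<tturnstile> (\<^bold>\<forall>w. w \<^bold>\<in> f \<^bold>\<longrightarrow> (\<^bold>\<exists>a b. a \<^bold>\<in> A \<^bold>\<and> b \<^bold>\<in> B \<^bold>\<and> is_pair w a b))"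
    and "\<And>q a. q \<le> p \<Longrightarrow> q \<tturnstile> a \<^bold>\<in> A \<Longrightarrow> q \<tturnstile> (\<^bold>\<exists>b. \<langle>a,b\<rangle> \<^bold>\<in> f)"
    and "\<And>q a b b'. q \<le> p \<Longrightarrow> q \<tturnstile> \<langle>a,b\<rangle> \<^bold>\<in> f \<Longrightarrow> q \<tturnstile> \<langle>a,b'\<rangle> \<^bold>\<in> f \<Longrightarrow> q \<tturnstile> b' \<^bold>= b"
  shows "p \<tturnstile> is_fun f A B"
proof -
  have "q \<tturnstile> (\<^bold>\<exists>\<^bold>!b. \<langle>a,b\<rangle> \<^bold>\<in> f)" if "q \<le> p" "q \<tturnstile> a \<^bold>\<in> A" for q a
    using assms(2)[OF that] by (rule ex1I) (use that(1) in \<open>blast intro: assms(3) order_trans\<close>)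
  with assms(1) show ?thesis
    by (simp add: is_fun_def and_iff) (simp add: all_iff imp_iff)
qed

text \<open>A function is a bare graph, so the same \<open>f\<close> serves for another codomain.
  This both corestricts \<open>\<eta>\<close> to a subset of \<open>S\<close> and enlarges the
  codomain of a factorisation.\<close>

lemma fun_change_cod:
  assumes f: "p \<tturnstile> is_fun f A B"
    and C: "\<And>q x y. q \<le> p \<Longrightarrow> q \<tturnstile> \<langle>x,y\<rangle> \<^bold>\<in> f \<Longrightarrow> q \<tturnstile> y \<^bold>\<in> C"
  shows "p \<tturnstile> is_fun f A C"
proof (rule funI)
  show "p \<tturnstile> (\<^bold>\<forall>w. w \<^bold>\<in> f \<^bold>\<longrightarrow> (\<^bold>\<exists>a b. a \<^bold>\<in> A \<^bold>\<and> b \<^bold>\<in> C \<^bold>\<and> is_pair w a b))"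
    unfolding all_iff
  proof (intro allI fimpI)
    fix w q assume q: "q \<le> p" and w: "q \<tturnstile> w \<^bold>\<in> f"
    have "q \<tturnstile> (\<^bold>\<exists>a b. a \<^bold>\<in> A \<^bold>\<and> b \<^bold>\<in> B \<^bold>\<and> is_pair w a b)"
      using fmono[OF q f] w by (simp add: is_fun_def kripke_joyal)
    then show "q \<tturnstile> (\<^bold>\<exists>a b. a \<^bold>\<in> A \<^bold>\<and> b \<^bold>\<in> C \<^bold>\<and> is_pair w a b)"
    proof (elim fexE)
      fix r a s b assume rs: "r \<le> q" "s \<le> r" and ab: "s \<tturnstile> (a \<^bold>\<in> A \<^bold>\<and> b \<^bold>\<in> B \<^bold>\<and> is_pair w a b)"
      have "s \<le> p" using q rs by simp
      moreover have "s \<tturnstile> \<langle>a,b\<rangle> \<^bold>\<in> f"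
        using ab w rs by (auto simp: and_iff intro: pair_inI fmono)
      ultimately have "s \<tturnstile> b \<^bold>\<in> C" by (rule C)
      with ab show "s \<tturnstile> (\<^bold>\<exists>a b. a \<^bold>\<in> A \<^bold>\<and> b \<^bold>\<in> C \<^bold>\<and> is_pair w a b)"
        by (intro fexI[of _ _ a] fexI[of _ _ b]) (simp add: and_iff)
    qed
  qed
qed (blast intro: fun_total fmono f, blast intro: fun_unique fmono f)

text \<open>Unique choice. The graph arises by replacement from the map that sends \<open>x\<close>
  to the pair of \<open>x\<close> and its value, rather than by separation from a product, so
  \<open>F\<close> may be given by an unbounded formula.\<close>

lemma function_ex:
  assumes F: "definable F"
    and tot: "\<And>q x. q \<le> p \<Longrightarrow> q \<tturnstile> x \<^bold>\<in> a \<Longrightarrow> q \<tturnstile> (\<^bold>\<exists>y. y \<^bold>\<in> b \<^bold>\<and> F x y)"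
    and uniq: "\<And>q x y y'. q \<le> p \<Longrightarrow> q \<tturnstile> x \<^bold>\<in> a \<Longrightarrow> q \<tturnstile> F x y \<Longrightarrow> q \<tturnstile> F x y' \<Longrightarrow> q \<tturnstile> y' \<^bold>= y"
  shows "p \<tturnstile> (\<^bold>\<exists>f. is_fun f a b \<^bold>\<and> (\<^bold>\<forall>x y. \<langle>x,y\<rangle> \<^bold>\<in> f \<^bold>\<longleftrightarrow> x \<^bold>\<in> a \<^bold>\<and> F x y))"
proof -
  define G where "G x w = (\<^bold>\<exists>y. F x y \<^bold>\<and> is_pair w x y)" for x w
  obtain \<phi> \<rho> where \<phi>: "\<And>x y z. eval \<phi> (\<rho>(0 := x, 1 := z, 2 := y)) M = F x y M"
    using F unfolding definable_def by blast
  have "p \<tturnstile> (\<^bold>\<exists>f. \<^bold>\<forall>w. w \<^bold>\<in> f \<^bold>\<longleftrightarrow> (\<^bold>\<exists>x. x \<^bold>\<in> a \<^bold>\<and> G x w))"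
  proof (rule replacement_form)
    show "eval (Exists 2 (And \<phi> (pair_form 1 0 2))) (\<rho>(0 := x, 1 := w)) M = G x w M" for x w
      using \<phi> by (simp add: G_def fm_value eval_forms)
    have "q \<tturnstile> (\<^bold>\<exists>w. G x w)" if q: "q \<le> p" and x: "q \<tturnstile> x \<^bold>\<in> a" for q x
      using tot[OF q x]
    proof (rule bexE)
      fix r y assume y: "r \<tturnstile> F x y"
      show "r \<tturnstile> (\<^bold>\<exists>w. G x w)"
        by (rule fexE[OF pair_ex[of r x y]], rule fexI) (auto simp: G_def intro: bexI fmono[OF _ y])
    qed
    moreover have "q \<tturnstile> w' \<^bold>= w" if q: "q \<le> p" and x: "q \<tturnstile> x \<^bold>\<in> a" and w: "q \<tturnstile> G x w" "q \<tturnstile> G x w'" for q x w w'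
      using w(1) unfolding G_def
    proof (rule bexE)
      fix r y assume r: "r \<le> q" and y: "r \<tturnstile> F x y" "r \<tturnstile> is_pair w x y"
      show "r \<tturnstile> w' \<^bold>= w"
        using fmono[OF r w(2)] unfolding G_def
      proof (rule bexE)
        fix s y' assume s: "s \<le> r" and y': "s \<tturnstile> F x y'" "s \<tturnstile> is_pair w' x y'"
        have sq: "s \<le> q" and sp: "s \<le> p" using s r q by auto
        note y = y[THEN fmono[OF s]]
        have "s \<tturnstile> y' \<^bold>= y" using sp fmono[OF sq x] y(1) y'(1) by (rule uniq)
        then show "s \<tturnstile> w' \<^bold>= w" using y(2) y'(2)
          by (blast intro: pair_unique pair_cong eq_refl)
      qed
    qed
    ultimately show "p \<tturnstile> (\<^bold>\<forall>x. x \<^bold>\<in> a \<^bold>\<longrightarrow> (\<^bold>\<exists>\<^bold>!w. G x w))"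
      unfolding all_iff by (intro allI fimpI ex1I) (meson fmono order_trans)+
  qed
  then show ?thesis
  proof (rule fexE)
    fix q f assume q: "q \<le> p" and f: "q \<tturnstile> (\<^bold>\<forall>w. w \<^bold>\<in> f \<^bold>\<longleftrightarrow> (\<^bold>\<exists>x. x \<^bold>\<in> a \<^bold>\<and> G x w))"
    have intro: "r \<tturnstile> \<langle>x,y\<rangle> \<^bold>\<in> f" if r: "r \<le> q" and x: "r \<tturnstile> x \<^bold>\<in> a" and y: "r \<tturnstile> F x y" for r x y
    proof (rule fexE[OF pair_ex[of r x y]])
      fix s w assume s: "s \<le> r" and w: "s \<tturnstile> is_pair w x y"
      have "s \<tturnstile> G x w"
        unfolding G_def using fmono[OF s y] w by (rule bexI)
      with fmono[OF s x] have "s \<tturnstile> (\<^bold>\<exists>x. x \<^bold>\<in> a \<^bold>\<and> G x w)"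
        by (rule bexI)
      with f order_trans[OF s r] have "s \<tturnstile> w \<^bold>\<in> f"
        by (simp add: all_iff iff_iff)
      with w show "s \<tturnstile> \<langle>x,y\<rangle> \<^bold>\<in> f" by (rule pair_inI)
    qed
    \<comment> \<open>A member \<open>w\<close> of \<open>f\<close> is a pair of some
      \<open>x'\<close> and \<open>y'\<close> that are only internally equal to \<open>x\<close> and
      \<open>y\<close>; this is why \<open>F\<close> has to respect that equality.\<close>
    have elim: "r \<tturnstile> (x \<^bold>\<in> a \<^bold>\<and> F x y)" if r: "r \<le> q" and xy: "r \<tturnstile> \<langle>x,y\<rangle> \<^bold>\<in> f" for r x y
      using xy
    proof (rule pair_inE)
      fix s w assume s: "s \<le> r" and w: "s \<tturnstile> is_pair w x y" "s \<tturnstile> w \<^bold>\<in> f"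
      then have "s \<tturnstile> (\<^bold>\<exists>x. x \<^bold>\<in> a \<^bold>\<and> G x w)"
        using f order_trans[OF s r] by (simp add: all_iff iff_iff)
      then show "s \<tturnstile> (x \<^bold>\<in> a \<^bold>\<and> F x y)"
      proof (rule bexE)
        fix t x' assume t: "t \<le> s" and x': "t \<tturnstile> x' \<^bold>\<in> a" and "t \<tturnstile> G x' w"
        from this(3) show "t \<tturnstile> (x \<^bold>\<in> a \<^bold>\<and> F x y)" unfolding G_def
        proof (rule bexE)
          fix u y' assume u: "u \<le> t" and y': "u \<tturnstile> F x' y'" "u \<tturnstile> is_pair w x' y'"
          have "u \<le> s" using t u by simp
          then have "u \<tturnstile> x' \<^bold>= x" "u \<tturnstile> y' \<^bold>= y"
            using y'(2) w(1) by (blast intro: pair_inj1 pair_inj2 fmono)+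
          with fmono[OF u x'] y'(1) show "u \<tturnstile> (x \<^bold>\<in> a \<^bold>\<and> F x y)"
            by (auto simp: and_iff intro: eq_mem_left definable_cong[OF F])
        qed
      qed
    qed
    have "q \<tturnstile> is_fun f a b"
    proof (rule funI)
      show "q \<tturnstile> (\<^bold>\<forall>w. w \<^bold>\<in> f \<^bold>\<longrightarrow> (\<^bold>\<exists>x y. x \<^bold>\<in> a \<^bold>\<and> y \<^bold>\<in> b \<^bold>\<and> is_pair w x y))"
        unfolding all_iff
      proof (intro allI fimpI)
        fix w r assume r: "r \<le> q" and "r \<tturnstile> w \<^bold>\<in> f"
        then have "r \<tturnstile> (\<^bold>\<exists>x. x \<^bold>\<in> a \<^bold>\<and> G x w)"
          using f by (simp add: all_iff iff_iff)
        then show "r \<tturnstile> (\<^bold>\<exists>x y. x \<^bold>\<in> a \<^bold>\<and> y \<^bold>\<in> b \<^bold>\<and> is_pair w x y)"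
        proof (rule bexE)
          fix s x assume s: "s \<le> r" and x: "s \<tturnstile> x \<^bold>\<in> a" and "s \<tturnstile> G x w"
          from this(3) show "s \<tturnstile> (\<^bold>\<exists>x y. x \<^bold>\<in> a \<^bold>\<and> y \<^bold>\<in> b \<^bold>\<and> is_pair w x y)" unfolding G_def
          proof (rule bexE)
            fix t y assume t: "t \<le> s" and y: "t \<tturnstile> F x y" "t \<tturnstile> is_pair w x y"
            have tp: "t \<le> p" using t s r q by simp
            note x = fmono[OF t x]
            \<comment> \<open>\<open>F x y\<close> alone does not place \<open>y\<close> in
              \<open>b\<close>; the value supplied by totality lies there, and it equals
              \<open>y\<close>.\<close>
            show "t \<tturnstile> (\<^bold>\<exists>x y. x \<^bold>\<in> a \<^bold>\<and> y \<^bold>\<in> b \<^bold>\<and> is_pair w x y)"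
              using tot[OF tp x]
            proof (rule bexE)
              fix u y' assume u: "u \<le> t" and y': "u \<tturnstile> y' \<^bold>\<in> b" "u \<tturnstile> F x y'"
              have up: "u \<le> p" using u tp by simp
              note xy = x[THEN fmono[OF u]] y[THEN fmono[OF u]]
              have "u \<tturnstile> y' \<^bold>= y" using up xy(1,2) y'(2) by (rule uniq)
              then have "u \<tturnstile> y \<^bold>\<in> b" using y'(1) by (rule eq_mem_left)
              with xy show "u \<tturnstile> (\<^bold>\<exists>x y. x \<^bold>\<in> a \<^bold>\<and> y \<^bold>\<in> b \<^bold>\<and> is_pair w x y)"
                by (intro fexI[of _ _ x] fexI[of _ _ y]) (simp add: and_iff)
            qed
          qed
        qed
      qed
    next
      fix r x assume r: "r \<le> q" and x: "r \<tturnstile> x \<^bold>\<in> a"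
      from tot[OF order_trans[OF r q] x] show "r \<tturnstile> (\<^bold>\<exists>y. \<langle>x,y\<rangle> \<^bold>\<in> f)"
        by (rule bexE) (blast intro: fexI intro fmono x r order_trans)
    next
      fix r x y y' assume r: "r \<le> q" and "r \<tturnstile> \<langle>x,y\<rangle> \<^bold>\<in> f" "r \<tturnstile> \<langle>x,y'\<rangle> \<^bold>\<in> f"
      then have "r \<tturnstile> (x \<^bold>\<in> a \<^bold>\<and> F x y)" "r \<tturnstile> (x \<^bold>\<in> a \<^bold>\<and> F x y')"
        using elim[OF r] by blast+
      then show "r \<tturnstile> y' \<^bold>= y"
        unfolding and_iff using uniq[OF order_trans[OF r q]] by blast
    qed
    moreover have "q \<tturnstile> (\<^bold>\<forall>x y. \<langle>x,y\<rangle> \<^bold>\<in> f \<^bold>\<longleftrightarrow> x \<^bold>\<in> a \<^bold>\<and> F x y)"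
      unfolding all_iff iff_iff using intro elim by (meson and_iff)
    ultimately show "q \<tturnstile> (\<^bold>\<exists>f. is_fun f a b \<^bold>\<and> (\<^bold>\<forall>x y. \<langle>x,y\<rangle> \<^bold>\<in> f \<^bold>\<longleftrightarrow> x \<^bold>\<in> a \<^bold>\<and> F x y))"
      by (rule bexI)
  qed
qed

lemma identity_ex: "p \<tturnstile> (\<^bold>\<exists>i. is_fun i A A \<^bold>\<and> (\<^bold>\<forall>x y. \<langle>x,y\<rangle> \<^bold>\<in> i \<^bold>\<longleftrightarrow> x \<^bold>\<in> A \<^bold>\<and> x \<^bold>= y))"
proof (rule function_ex)
  show "definable (\<^bold>=)"
    \<comment> \<open>Both variables of the formula are overwritten, so the assignment has no
      parameter to provide.\<close>
    unfolding definable_def by (intro HOL.exI[of _ "eq_form 0 2"] HOL.exI[of _ "\<lambda>_. undefined"]) (simp add: eval_forms)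
qed (auto intro: bexI eq_refl eq_sym eq_trans)

section \<open>Images under functions\<close>

lemma image_iff: "p \<tturnstile> is_image V f U \<longleftrightarrow> (\<forall>q\<le>p. \<forall>y. q \<tturnstile> y \<^bold>\<in> V \<longleftrightarrow> q \<tturnstile> (\<^bold>\<exists>x. x \<^bold>\<in> U \<^bold>\<and> \<langle>x,y\<rangle> \<^bold>\<in> f))"
  by (auto simp: is_image_def kripke_joyal)

lemma image_memI: "p \<tturnstile> is_image V f U \<Longrightarrow> p \<tturnstile> x \<^bold>\<in> U \<Longrightarrow> p \<tturnstile> \<langle>x,y\<rangle> \<^bold>\<in> f \<Longrightarrow> p \<tturnstile> y \<^bold>\<in> V"
  using bexI[of p "\<lambda>x. x \<^bold>\<in> U" x "\<lambda>x. \<langle>x,y\<rangle> \<^bold>\<in> f"] by (simp add: image_iff)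

lemma image_memD: "p \<tturnstile> is_image V f U \<Longrightarrow> p \<tturnstile> y \<^bold>\<in> V \<Longrightarrow> p \<tturnstile> (\<^bold>\<exists>x. x \<^bold>\<in> U \<^bold>\<and> \<langle>x,y\<rangle> \<^bold>\<in> f)"
  by (simp add: image_iff)

text \<open>The image is separated from the codomain \<open>B\<close>: the quantifier over
  \<open>x\<close> is bounded by \<open>U\<close>, and the one hidden in membership of a pair is
  bounded by \<open>f\<close>.\<close>

lemma image_ex:
  assumes f: "p \<tturnstile> is_fun f A B"
  shows "p \<tturnstile> (\<^bold>\<exists>V. is_image V f U)"
proof -
  have "separable (\<lambda>y. \<^bold>\<exists>x. x \<^bold>\<in> U \<^bold>\<and> \<langle>x,y\<rangle> \<^bold>\<in> f)"
    unfolding separable_def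
    by (rule HOL.exI[of _ "Exists 3 (And (Mem 3 1) (pair_in_form 3 0 2))"], rule HOL.exI[of _ "(\<lambda>_. f)(1 := U)"])
      (intro conjI allI bounded_intros; simp add: eval_forms fm_value)
  from separation[OF this, of p B] show ?thesis
  proof (rule fexE)
    fix q V assume q: "q \<le> p" and V: "q \<tturnstile> (\<^bold>\<forall>y. y \<^bold>\<in> V \<^bold>\<longleftrightarrow> y \<^bold>\<in> B \<^bold>\<and> (\<^bold>\<exists>x. x \<^bold>\<in> U \<^bold>\<and> \<langle>x,y\<rangle> \<^bold>\<in> f))"
    have cod: "r \<tturnstile> y \<^bold>\<in> B" if r: "r \<le> q" and y: "r \<tturnstile> (\<^bold>\<exists>x. x \<^bold>\<in> U \<^bold>\<and> \<langle>x,y\<rangle> \<^bold>\<in> f)" for r y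
      using y
    proof (rule bexE)
      fix s x assume s: "s \<le> r" and x: "s \<tturnstile> \<langle>x,y\<rangle> \<^bold>\<in> f"
      have "s \<le> p" using s r q by simp
      then show "s \<tturnstile> y \<^bold>\<in> B" using fun_cod[OF fmono[OF _ f] x] by blast
    qed
    have "r \<tturnstile> y \<^bold>\<in> V \<longleftrightarrow> r \<tturnstile> (\<^bold>\<exists>x. x \<^bold>\<in> U \<^bold>\<and> \<langle>x,y\<rangle> \<^bold>\<in> f)" if "r \<le> q" for r y
    proof -
      have "r \<tturnstile> y \<^bold>\<in> V \<longleftrightarrow> r \<tturnstile> (y \<^bold>\<in> B \<^bold>\<and> (\<^bold>\<exists>x. x \<^bold>\<in> U \<^bold>\<and> \<langle>x,y\<rangle> \<^bold>\<in> f))"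
        using V that by (simp add: all_iff iff_iff)
      then show ?thesis
        using cod[OF that] by (auto simp: and_iff)
    qed
    then have "q \<tturnstile> is_image V f U"
      by (simp add: image_iff)
    then show "q \<tturnstile> (\<^bold>\<exists>V. is_image V f U)" by (rule fexI)
  qed
qed

text \<open>The enumeration of \<open>V\<close> is the composite of one of \<open>U\<close> with
  \<open>f\<close>. It is total and single-valued, so its graph exists without choice.\<close>

lemma enumerable_image:
  assumes f: "p \<tturnstile> is_fun f A B" and UA: "p \<tturnstile> U \<^bold>\<subseteq> A" and V: "p \<tturnstile> is_image V f U"
    and enum: "p \<tturnstile> enumerable U"
  shows "p \<tturnstile> enumerable V"
  using enum unfolding enumerable_def
proof (elim fexE)
  fix q1 N q e assume "q1 \<le> p" "q \<le> q1" and e: "q \<tturnstile> (is_nats N \<^bold>\<and> is_fun e N U \<^bold>\<and> (\<^bold>\<forall>u. u \<^bold>\<in> U \<^bold>\<longrightarrow> (\<^bold>\<exists>n. n \<^bold>\<in> N \<^bold>\<and> \<langle>n,u\<rangle> \<^bold>\<in> e)))"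
  then have q: "q \<le> p" by simp
  note f = fmono[OF q f] and UA = fmono[OF q UA] and V = fmono[OF q V]
  define F :: "'u \<Rightarrow> 'u \<Rightarrow> ('u, 'h) fm" where "F n v = (\<^bold>\<exists>u. \<langle>n,u\<rangle> \<^bold>\<in> e \<^bold>\<and> \<langle>u,v\<rangle> \<^bold>\<in> f)" for n v
  have N: "q \<tturnstile> is_nats N" and fe: "q \<tturnstile> is_fun e N U"
    and surj: "\<And>r u. r \<le> q \<Longrightarrow> r \<tturnstile> u \<^bold>\<in> U \<Longrightarrow> r \<tturnstile> (\<^bold>\<exists>n. n \<^bold>\<in> N \<^bold>\<and> \<langle>n,u\<rangle> \<^bold>\<in> e)"
    using e by (auto simp: kripke_joyal)
  have "q \<tturnstile> (\<^bold>\<exists>h. is_fun h N V \<^bold>\<and> (\<^bold>\<forall>n v. \<langle>n,v\<rangle> \<^bold>\<in> h \<^bold>\<longleftrightarrow> n \<^bold>\<in> N \<^bold>\<and> F n v))"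
  proof (rule function_ex)
    show "definable F"
      unfolding definable_def
      \<comment> \<open>Variable 3 is the intermediate \<open>u\<close>; variables 4 and 5 hold
        \<open>e\<close> and \<open>f\<close>.\<close>
      by (rule HOL.exI[of _ "Exists 3 (And (pair_in_form 0 3 4) (pair_in_form 3 2 5))"], rule HOL.exI[of _ "(\<lambda>_. e)(5 := f)"])
        (simp add: F_def eval_forms fm_value)
  next
    fix r n assume r: "r \<le> q" and n: "r \<tturnstile> n \<^bold>\<in> N"
    show "r \<tturnstile> (\<^bold>\<exists>v. v \<^bold>\<in> V \<^bold>\<and> F n v)"
      using fun_total[OF fmono[OF r fe] n]
    proof (rule fexE)
      fix s u assume s: "s \<le> r" and u: "s \<tturnstile> \<langle>n,u\<rangle> \<^bold>\<in> e"
      have sq: "s \<le> q" using s r by simp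
      have uU: "s \<tturnstile> u \<^bold>\<in> U" using fmono[OF sq fe] u by (rule fun_cod)
      show "s \<tturnstile> (\<^bold>\<exists>v. v \<^bold>\<in> V \<^bold>\<and> F n v)"
        using fun_total[OF fmono[OF sq f] subsetD[OF fmono[OF sq UA] uU]]
      proof (rule fexE)
        fix t v assume t: "t \<le> s" and v: "t \<tturnstile> \<langle>u,v\<rangle> \<^bold>\<in> f"
        have "t \<tturnstile> v \<^bold>\<in> V"
          using fmono[OF order_trans[OF t sq] V] fmono[OF t uU] v by (rule image_memI)
        moreover have "t \<tturnstile> F n v"
          unfolding F_def using fmono[OF t u] v by (rule bexI)
        ultimately show "t \<tturnstile> (\<^bold>\<exists>v. v \<^bold>\<in> V \<^bold>\<and> F n v)" by (rule bexI)
      qed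
    qed
  next
    fix r n v v' assume r: "r \<le> q" and v: "r \<tturnstile> F n v" "r \<tturnstile> F n v'"
    show "r \<tturnstile> v' \<^bold>= v"
      using v(1) unfolding F_def
    proof (rule bexE)
      fix s u assume s: "s \<le> r" and u: "s \<tturnstile> \<langle>n,u\<rangle> \<^bold>\<in> e" "s \<tturnstile> \<langle>u,v\<rangle> \<^bold>\<in> f"
      show "s \<tturnstile> v' \<^bold>= v"
        using fmono[OF s v(2)] unfolding F_def
      proof (rule bexE)
        fix t u' assume t: "t \<le> s" and u': "t \<tturnstile> \<langle>n,u'\<rangle> \<^bold>\<in> e" "t \<tturnstile> \<langle>u',v'\<rangle> \<^bold>\<in> f"
        have tq: "t \<le> q" using t s r by simp
        note u = u[THEN fmono[OF t]]
        have "t \<tturnstile> u' \<^bold>= u" using fmono[OF tq fe] u'(1) u(1) by (rule fun_unique)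
        then have "t \<tturnstile> \<langle>u,v'\<rangle> \<^bold>\<in> f" using eq_refl u'(2) by (rule pair_in_cong)
        then show "t \<tturnstile> v' \<^bold>= v" using u(2) by (rule fun_unique[OF fmono[OF tq f]])
      qed
    qed
  qed
  then show "q \<tturnstile> (\<^bold>\<exists>N e. is_nats N \<^bold>\<and> is_fun e N V \<^bold>\<and> (\<^bold>\<forall>u. u \<^bold>\<in> V \<^bold>\<longrightarrow> (\<^bold>\<exists>n. n \<^bold>\<in> N \<^bold>\<and> \<langle>n,u\<rangle> \<^bold>\<in> e)))"
  proof (rule bexE)
    fix r h assume r: "r \<le> q" and h: "r \<tturnstile> is_fun h N V" and hF: "r \<tturnstile> (\<^bold>\<forall>n v. \<langle>n,v\<rangle> \<^bold>\<in> h \<^bold>\<longleftrightarrow> n \<^bold>\<in> N \<^bold>\<and> F n v)"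
    have "s \<tturnstile> (\<^bold>\<exists>n. n \<^bold>\<in> N \<^bold>\<and> \<langle>n,v\<rangle> \<^bold>\<in> h)" if s: "s \<le> r" and v: "s \<tturnstile> v \<^bold>\<in> V" for s v
      using image_memD[OF fmono[OF order_trans[OF s r] V] v]
    proof (rule bexE)
      fix t u assume t: "t \<le> s" and u: "t \<tturnstile> u \<^bold>\<in> U" "t \<tturnstile> \<langle>u,v\<rangle> \<^bold>\<in> f"
      have tq: "t \<le> q" using t s r by simp
      show "t \<tturnstile> (\<^bold>\<exists>n. n \<^bold>\<in> N \<^bold>\<and> \<langle>n,v\<rangle> \<^bold>\<in> h)"
        using surj[OF tq u(1)]
      proof (rule bexE)
        fix w n assume w: "w \<le> t" and n: "w \<tturnstile> n \<^bold>\<in> N" "w \<tturnstile> \<langle>n,u\<rangle> \<^bold>\<in> e"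
        have "w \<tturnstile> F n v" unfolding F_def using n(2) fmono[OF w u(2)] by (rule bexI)
        moreover have "w \<le> r" using w t s by simp
        ultimately have "w \<tturnstile> \<langle>n,v\<rangle> \<^bold>\<in> h" using n(1) hF by (simp add: kripke_joyal)
        with n(1) show "w \<tturnstile> (\<^bold>\<exists>n. n \<^bold>\<in> N \<^bold>\<and> \<langle>n,v\<rangle> \<^bold>\<in> h)" by (rule bexI)
      qed
    qed
    then have "r \<tturnstile> (\<^bold>\<forall>v. v \<^bold>\<in> V \<^bold>\<longrightarrow> (\<^bold>\<exists>n. n \<^bold>\<in> N \<^bold>\<and> \<langle>n,v\<rangle> \<^bold>\<in> h))"
      by (simp add: all_iff imp_iff)
    with h fmono[OF r N] show "r \<tturnstile> (\<^bold>\<exists>N e. is_nats N \<^bold>\<and> is_fun e N V \<^bold>\<and> (\<^bold>\<forall>u. u \<^bold>\<in> V \<^bold>\<longrightarrow> (\<^bold>\<exists>n. n \<^bold>\<in> N \<^bold>\<and> \<langle>n,u\<rangle> \<^bold>\<in> e)))"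
      by (intro fexI[of _ _ N] fexI[of _ _ h]) (simp add: and_iff)
  qed
qed

section \<open>\<open>\<omega>\<close>-cpos\<close>

lemma eds_iff: "p \<tturnstile> enumerable_directed_subset U P L \<longleftrightarrow> p \<tturnstile> U \<^bold>\<subseteq> P \<and> p \<tturnstile> enumerable U \<and> p \<tturnstile> directed U L"
  by (simp add: enumerable_directed_subset_def and_iff)

lemma joinI:
  assumes "p \<tturnstile> j \<^bold>\<in> C" and "\<And>q u. q \<le> p \<Longrightarrow> q \<tturnstile> u \<^bold>\<in> U \<Longrightarrow> q \<tturnstile> \<langle>u,j\<rangle> \<^bold>\<in> R"
    and "\<And>q c. q \<le> p \<Longrightarrow> q \<tturnstile> c \<^bold>\<in> C \<Longrightarrow> (\<And>r u. r \<le> q \<Longrightarrow> r \<tturnstile> u \<^bold>\<in> U \<Longrightarrow> r \<tturnstile> \<langle>u,c\<rangle> \<^bold>\<in> R) \<Longrightarrow> q \<tturnstile> \<langle>j,c\<rangle> \<^bold>\<in> R"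
  shows "p \<tturnstile> is_join j U C R"
  using assms by (simp add: is_join_def kripke_joyal)

lemma join_mem: "p \<tturnstile> is_join j U C R \<Longrightarrow> p \<tturnstile> j \<^bold>\<in> C"
  by (simp add: is_join_def and_iff)

lemma join_upper: "p \<tturnstile> is_join j U C R \<Longrightarrow> p \<tturnstile> u \<^bold>\<in> U \<Longrightarrow> p \<tturnstile> \<langle>u,j\<rangle> \<^bold>\<in> R"
  by (simp add: is_join_def kripke_joyal)

lemma join_least:
  "p \<tturnstile> is_join j U C R \<Longrightarrow> p \<tturnstile> c \<^bold>\<in> C \<Longrightarrow> (\<And>q u. q \<le> p \<Longrightarrow> q \<tturnstile> u \<^bold>\<in> U \<Longrightarrow> q \<tturnstile> \<langle>u,c\<rangle> \<^bold>\<in> R) \<Longrightarrow> p \<tturnstile> \<langle>j,c\<rangle> \<^bold>\<in> R"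
  by (simp add: is_join_def kripke_joyal)

lemma directed_nonempty: "p \<tturnstile> directed U R \<Longrightarrow> p \<tturnstile> (\<^bold>\<exists>u. u \<^bold>\<in> U)"
  by (simp add: directed_def and_iff)

lemma directed_bound:
  "p \<tturnstile> directed U R \<Longrightarrow> p \<tturnstile> u \<^bold>\<in> U \<Longrightarrow> p \<tturnstile> v \<^bold>\<in> U \<Longrightarrow> p \<tturnstile> (\<^bold>\<exists>w. w \<^bold>\<in> U \<^bold>\<and> \<langle>u,w\<rangle> \<^bold>\<in> R \<^bold>\<and> \<langle>v,w\<rangle> \<^bold>\<in> R)"
  by (simp add: directed_def kripke_joyal)

lemma directedI:
  assumes "p \<tturnstile> (\<^bold>\<exists>u. u \<^bold>\<in> U)"
    and "\<And>q u v. q \<le> p \<Longrightarrow> q \<tturnstile> u \<^bold>\<in> U \<Longrightarrow> q \<tturnstile> v \<^bold>\<in> U \<Longrightarrow> q \<tturnstile> (\<^bold>\<exists>w. w \<^bold>\<in> U \<^bold>\<and> \<langle>u,w\<rangle> \<^bold>\<in> R \<^bold>\<and> \<langle>v,w\<rangle> \<^bold>\<in> R)"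
  shows "p \<tturnstile> directed U R"
  using assms by (simp add: directed_def and_iff all_iff imp_iff)

lemma partial_order_refl: "p \<tturnstile> partial_order C R \<Longrightarrow> p \<tturnstile> x \<^bold>\<in> C \<Longrightarrow> p \<tturnstile> \<langle>x,x\<rangle> \<^bold>\<in> R"
  and partial_order_trans: "p \<tturnstile> partial_order C R \<Longrightarrow> p \<tturnstile> x \<^bold>\<in> C \<Longrightarrow> p \<tturnstile> y \<^bold>\<in> C \<Longrightarrow> p \<tturnstile> z \<^bold>\<in> C \<Longrightarrow>
    p \<tturnstile> \<langle>x,y\<rangle> \<^bold>\<in> R \<Longrightarrow> p \<tturnstile> \<langle>y,z\<rangle> \<^bold>\<in> R \<Longrightarrow> p \<tturnstile> \<langle>x,z\<rangle> \<^bold>\<in> R"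
  and partial_order_antisym: "p \<tturnstile> partial_order C R \<Longrightarrow> p \<tturnstile> x \<^bold>\<in> C \<Longrightarrow> p \<tturnstile> y \<^bold>\<in> C \<Longrightarrow>
    p \<tturnstile> \<langle>x,y\<rangle> \<^bold>\<in> R \<Longrightarrow> p \<tturnstile> \<langle>y,x\<rangle> \<^bold>\<in> R \<Longrightarrow> p \<tturnstile> x \<^bold>= y"
  unfolding partial_order_def preorder_def kripke_joyal by blast+

lemma partial_orderI:
  assumes "\<And>q x. q \<le> p \<Longrightarrow> q \<tturnstile> x \<^bold>\<in> C \<Longrightarrow> q \<tturnstile> \<langle>x,x\<rangle> \<^bold>\<in> R"
    and "\<And>q x y z. q \<le> p \<Longrightarrow> q \<tturnstile> x \<^bold>\<in> C \<Longrightarrow> q \<tturnstile> y \<^bold>\<in> C \<Longrightarrow> q \<tturnstile> z \<^bold>\<in> C \<Longrightarrow>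
      q \<tturnstile> \<langle>x,y\<rangle> \<^bold>\<in> R \<Longrightarrow> q \<tturnstile> \<langle>y,z\<rangle> \<^bold>\<in> R \<Longrightarrow> q \<tturnstile> \<langle>x,z\<rangle> \<^bold>\<in> R"
    and "\<And>q x y. q \<le> p \<Longrightarrow> q \<tturnstile> x \<^bold>\<in> C \<Longrightarrow> q \<tturnstile> y \<^bold>\<in> C \<Longrightarrow>
      q \<tturnstile> \<langle>x,y\<rangle> \<^bold>\<in> R \<Longrightarrow> q \<tturnstile> \<langle>y,x\<rangle> \<^bold>\<in> R \<Longrightarrow> q \<tturnstile> x \<^bold>= y"
  shows "p \<tturnstile> partial_order C R"
  unfolding partial_order_def preorder_def kripke_joyal using assms by blast

lemma omega_cpo_order: "p \<tturnstile> omega_cpo C R \<Longrightarrow> p \<tturnstile> partial_order C R"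
  by (simp add: omega_cpo_def and_iff)

lemma omega_cpo_join: "p \<tturnstile> omega_cpo C R \<Longrightarrow> p \<tturnstile> enumerable_directed_subset U C R \<Longrightarrow> p \<tturnstile> (\<^bold>\<exists>j. is_join j U C R)"
  by (simp add: omega_cpo_def kripke_joyal)

lemma omega_cpoI:
  assumes "p \<tturnstile> partial_order C R"
    and "\<And>q U. q \<le> p \<Longrightarrow> q \<tturnstile> enumerable_directed_subset U C R \<Longrightarrow> q \<tturnstile> (\<^bold>\<exists>j. is_join j U C R)"
  shows "p \<tturnstile> omega_cpo C R"
  using assms by (simp add: omega_cpo_def and_iff all_iff imp_iff)

lemma monotone_fun: "p \<tturnstile> monotone_fun f P L C R \<Longrightarrow> p \<tturnstile> is_fun f P C"
  by (simp add: monotone_fun_def and_iff)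

lemma monotoneD:
  assumes "p \<tturnstile> monotone_fun f P L C R" "p \<tturnstile> \<langle>x,y\<rangle> \<^bold>\<in> L" "p \<tturnstile> \<langle>x,x'\<rangle> \<^bold>\<in> f" "p \<tturnstile> \<langle>y,y'\<rangle> \<^bold>\<in> f"
  shows "p \<tturnstile> \<langle>x',y'\<rangle> \<^bold>\<in> R"
proof -
  have "p \<tturnstile> x \<^bold>\<in> P" "p \<tturnstile> y \<^bold>\<in> P"
    using monotone_fun[OF assms(1)] assms(3,4) by (blast intro: fun_dom)+
  with assms show ?thesis
    unfolding monotone_fun_def kripke_joyal by blast
qed

lemma monotoneI:
  assumes "p \<tturnstile> is_fun f P C"
    and "\<And>q x y x' y'. q \<le> p \<Longrightarrow> q \<tturnstile> x \<^bold>\<in> P \<Longrightarrow> q \<tturnstile> y \<^bold>\<in> P \<Longrightarrow> q \<tturnstile> \<langle>x,y\<rangle> \<^bold>\<in> L \<Longrightarrow> q \<tturnstile> \<langle>x,x'\<rangle> \<^bold>\<in> f \<Longrightarrow> q \<tturnstile> \<langle>y,y'\<rangle> \<^bold>\<in> f \<Longrightarrow>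
      q \<tturnstile> \<langle>x',y'\<rangle> \<^bold>\<in> R"
  shows "p \<tturnstile> monotone_fun f P L C R"
  using assms unfolding monotone_fun_def kripke_joyal by blast

lemma directed_image:
  assumes f: "p \<tturnstile> monotone_fun f P L C R" and UP: "p \<tturnstile> U \<^bold>\<subseteq> P" and V: "p \<tturnstile> is_image V f U"
    and U: "p \<tturnstile> directed U L"
  shows "p \<tturnstile> directed V R"
proof (rule directedI)
  note ff = monotone_fun[OF f]
  show "p \<tturnstile> (\<^bold>\<exists>v. v \<^bold>\<in> V)"
    using directed_nonempty[OF U]
  proof (rule fexE)
    fix q u assume q: "q \<le> p" and u: "q \<tturnstile> u \<^bold>\<in> U"
    show "q \<tturnstile> (\<^bold>\<exists>v. v \<^bold>\<in> V)"
      using fun_total[OF fmono[OF q ff] subsetD[OF fmono[OF q UP] u]]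
      by (rule fexE) (rule fexI, rule image_memI[OF fmono[OF order_trans[OF _ q] V] fmono[OF _ u]])
  qed
  fix q v1 v2 assume q: "q \<le> p" and v: "q \<tturnstile> v1 \<^bold>\<in> V" "q \<tturnstile> v2 \<^bold>\<in> V"
  show "q \<tturnstile> (\<^bold>\<exists>w. w \<^bold>\<in> V \<^bold>\<and> \<langle>v1,w\<rangle> \<^bold>\<in> R \<^bold>\<and> \<langle>v2,w\<rangle> \<^bold>\<in> R)"
    using image_memD[OF fmono[OF q V] v(1)]
  proof (rule bexE)
    fix r u1 assume r: "r \<le> q" and u1: "r \<tturnstile> u1 \<^bold>\<in> U" "r \<tturnstile> \<langle>u1,v1\<rangle> \<^bold>\<in> f"
    have rp: "r \<le> p" using r q by simp
    show "r \<tturnstile> (\<^bold>\<exists>w. w \<^bold>\<in> V \<^bold>\<and> \<langle>v1,w\<rangle> \<^bold>\<in> R \<^bold>\<and> \<langle>v2,w\<rangle> \<^bold>\<in> R)"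
      using image_memD[OF fmono[OF rp V] fmono[OF r v(2)]]
    proof (rule bexE)
      fix s u2 assume s: "s \<le> r" and u2: "s \<tturnstile> u2 \<^bold>\<in> U" "s \<tturnstile> \<langle>u2,v2\<rangle> \<^bold>\<in> f"
      have sp: "s \<le> p" using s rp by simp
      show "s \<tturnstile> (\<^bold>\<exists>w. w \<^bold>\<in> V \<^bold>\<and> \<langle>v1,w\<rangle> \<^bold>\<in> R \<^bold>\<and> \<langle>v2,w\<rangle> \<^bold>\<in> R)"
        using directed_bound[OF fmono[OF sp U] fmono[OF s u1(1)] u2(1)]
      proof (rule bexE)
        fix t u3 assume t: "t \<le> s" and u3: "t \<tturnstile> u3 \<^bold>\<in> U" "t \<tturnstile> (\<langle>u1,u3\<rangle> \<^bold>\<in> L \<^bold>\<and> \<langle>u2,u3\<rangle> \<^bold>\<in> L)"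
        have tp: "t \<le> p" and tr: "t \<le> r" using t s sp by auto
        show "t \<tturnstile> (\<^bold>\<exists>w. w \<^bold>\<in> V \<^bold>\<and> \<langle>v1,w\<rangle> \<^bold>\<in> R \<^bold>\<and> \<langle>v2,w\<rangle> \<^bold>\<in> R)"
          using fun_total[OF fmono[OF tp ff] subsetD[OF fmono[OF tp UP] u3(1)]]
        proof (rule fexE)
          fix w v3 assume w: "w \<le> t" and v3: "w \<tturnstile> \<langle>u3,v3\<rangle> \<^bold>\<in> f"
          have wp: "w \<le> p" and wr: "w \<le> r" and ws: "w \<le> s" using w tp tr t by auto
          have "w \<tturnstile> v3 \<^bold>\<in> V"
            using fmono[OF wp V] fmono[OF w u3(1)] v3 by (rule image_memI)
          moreover have "w \<tturnstile> \<langle>v1,v3\<rangle> \<^bold>\<in> R" "w \<tturnstile> \<langle>v2,v3\<rangle> \<^bold>\<in> R"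
            using monotoneD[OF fmono[OF wp f]] fmono[OF w u3(2)] v3 fmono[OF wr u1(2)] fmono[OF ws u2(2)]
            unfolding and_iff by blast+
          ultimately show "w \<tturnstile> (\<^bold>\<exists>w. w \<^bold>\<in> V \<^bold>\<and> \<langle>v1,w\<rangle> \<^bold>\<in> R \<^bold>\<and> \<langle>v2,w\<rangle> \<^bold>\<in> R)"
            by (intro bexI) (simp_all add: and_iff)
        qed
      qed
    qed
  qed
qed

lemma image_subset:
  assumes "p \<tturnstile> is_fun f A B" "p \<tturnstile> is_image V f U"
  shows "p \<tturnstile> V \<^bold>\<subseteq> B"
  unfolding subset_iff
proof (intro allI HOL.impI)
  fix q y assume q: "q \<le> p" and "q \<tturnstile> y \<^bold>\<in> V"
  from image_memD[OF fmono[OF q assms(2)] this(2)] show "q \<tturnstile> y \<^bold>\<in> B"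
  proof (rule bexE)
    fix r x assume r: "r \<le> q" and x: "r \<tturnstile> \<langle>x,y\<rangle> \<^bold>\<in> f"
    show "r \<tturnstile> y \<^bold>\<in> B"
      using fmono[OF order_trans[OF r q] assms(1)] x by (rule fun_cod)
  qed
qed

lemma eds_image:
  assumes "p \<tturnstile> monotone_fun f P L C R" "p \<tturnstile> enumerable_directed_subset U P L" "p \<tturnstile> is_image V f U"
  shows "p \<tturnstile> enumerable_directed_subset V C R"
  using assms(2) unfolding eds_iff
  by (meson assms(1,3) directed_image enumerable_image image_subset monotone_fun)

lemma continuous_monotone: "p \<tturnstile> omega_continuous g C R D Q \<Longrightarrow> p \<tturnstile> monotone_fun g C R D Q"
  by (simp add: omega_continuous_def and_iff)

lemma continuous_join:
  "p \<tturnstile> omega_continuous g C R D Q \<Longrightarrow> p \<tturnstile> enumerable_directed_subset U C R \<Longrightarrow> p \<tturnstile> is_join j U C R \<Longrightarrow>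
    p \<tturnstile> is_image V g U \<Longrightarrow> p \<tturnstile> \<langle>j,k\<rangle> \<^bold>\<in> g \<Longrightarrow> p \<tturnstile> is_join k V D Q"
  by (simp add: omega_continuous_def kripke_joyal)

lemma continuousI:
  assumes "p \<tturnstile> monotone_fun g C R D Q"
    and "\<And>q U V j k. q \<le> p \<Longrightarrow> q \<tturnstile> enumerable_directed_subset U C R \<Longrightarrow> q \<tturnstile> is_join j U C R \<Longrightarrow>
      q \<tturnstile> is_image V g U \<Longrightarrow> q \<tturnstile> \<langle>j,k\<rangle> \<^bold>\<in> g \<Longrightarrow> q \<tturnstile> is_join k V D Q"
  shows "p \<tturnstile> omega_continuous g C R D Q"
  unfolding omega_continuous_def kripke_joyal using assms by blast

text \<open>With an empty \<open>K\<close> the cover condition is vacuous; thus the universal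
  property of \<open>S\<close> extends all monotone maps.\<close>

lemma morphism_uncovered:
  assumes "p \<tturnstile> is_empty K" "p \<tturnstile> monotone_fun f P L C R"
  shows "p \<tturnstile> morphism_to_cpo f P L K C R"
proof -
  have "q \<tturnstile> A" if "q \<le> p" "q \<tturnstile> \<langle>x,U\<rangle> \<^bold>\<in> K" for q x U A
    using that(2) by (rule pair_inE)
      (use assms(1) that(1) in \<open>auto simp: is_empty_def kripke_joyal intro: ffalseE\<close>)
  with assms(2) show ?thesis
    unfolding morphism_to_cpo_def kripke_joyal by blast
qed

lemma free_universal:
  assumes "p \<tturnstile> free_omega_cpo P L K S R \<eta>" "p \<tturnstile> omega_cpo C Q" "p \<tturnstile> morphism_to_cpo f P L K C Q"
  shows "p \<tturnstile> (\<^bold>\<exists>\<^bold>!g. omega_continuous g S R C Q \<^bold>\<and> factors f g \<eta>)"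
  using assms by (simp add: free_omega_cpo_def kripke_joyal)

lemma factors_iff:
  "p \<tturnstile> factors f g h \<longleftrightarrow> (\<forall>q\<le>p. \<forall>x z. q \<tturnstile> \<langle>x,z\<rangle> \<^bold>\<in> f \<longleftrightarrow> q \<tturnstile> (\<^bold>\<exists>y. \<langle>x,y\<rangle> \<^bold>\<in> h \<^bold>\<and> \<langle>y,z\<rangle> \<^bold>\<in> g))"
  by (auto simp: factors_def all_iff iff_iff)

section \<open>Sub-\<omega>-cpos and minimality of the free \<omega>-cpo\<close>

lemma eds_mono: "p \<tturnstile> enumerable_directed_subset U A R \<Longrightarrow> p \<tturnstile> A \<^bold>\<subseteq> S \<Longrightarrow> p \<tturnstile> enumerable_directed_subset U S R"
  by (simp add: eds_iff subset_iff)

lemma partial_order_subset: "p \<tturnstile> partial_order C R \<Longrightarrow> p \<tturnstile> A \<^bold>\<subseteq> C \<Longrightarrow> p \<tturnstile> partial_order A R"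
  by (rule partial_orderI)
    (meson fmono subsetD partial_order_refl partial_order_trans partial_order_antisym)+

lemma join_subset:
  assumes "p \<tturnstile> is_join j U S R" "p \<tturnstile> A \<^bold>\<subseteq> S" "p \<tturnstile> j \<^bold>\<in> A"
  shows "p \<tturnstile> is_join j U A R"
proof (rule joinI)
  fix q c assume q: "q \<le> p" and c: "q \<tturnstile> c \<^bold>\<in> A" and ub: "\<And>r u. r \<le> q \<Longrightarrow> r \<tturnstile> u \<^bold>\<in> U \<Longrightarrow> r \<tturnstile> \<langle>u,c\<rangle> \<^bold>\<in> R"
  show "q \<tturnstile> \<langle>j,c\<rangle> \<^bold>\<in> R"
    using fmono[OF q assms(1)] subsetD[OF fmono[OF q assms(2)] c] ub by (rule join_least)
qed (use assms in \<open>auto intro: join_upper fmono\<close>)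

text \<open>The joins are those of \<open>S\<close>, so that a closed \<open>A\<close> inherits them
  and its inclusion into \<open>S\<close> is continuous.\<close>

definition join_closed :: "'u \<Rightarrow> 'u \<Rightarrow> 'u \<Rightarrow> ('u, 'h) fm"
  where "join_closed A S R =
    (\<^bold>\<forall>U j. enumerable_directed_subset U S R \<^bold>\<and> U \<^bold>\<subseteq> A \<^bold>\<and> is_join j U S R \<^bold>\<longrightarrow> j \<^bold>\<in> A)"

lemma join_closedD:
  "p \<tturnstile> join_closed A S R \<Longrightarrow> p \<tturnstile> enumerable_directed_subset U S R \<Longrightarrow> p \<tturnstile> U \<^bold>\<subseteq> A \<Longrightarrow> p \<tturnstile> is_join j U S R \<Longrightarrow> p \<tturnstile> j \<^bold>\<in> A"
  by (simp add: join_closed_def kripke_joyal)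

lemma sub_cpo:
  assumes S: "p \<tturnstile> omega_cpo S R" and A: "p \<tturnstile> A \<^bold>\<subseteq> S" and cl: "p \<tturnstile> join_closed A S R"
  shows "p \<tturnstile> omega_cpo A R"
proof (rule omega_cpoI)
  show "p \<tturnstile> partial_order A R"
    using omega_cpo_order[OF S] A by (rule partial_order_subset)
  fix q U assume q: "q \<le> p" and U: "q \<tturnstile> enumerable_directed_subset U A R"
  have US: "q \<tturnstile> enumerable_directed_subset U S R"
    using U fmono[OF q A] by (rule eds_mono)
  show "q \<tturnstile> (\<^bold>\<exists>j. is_join j U A R)"
    using omega_cpo_join[OF fmono[OF q S] US]
  proof (rule fexE)
    fix r j assume r: "r \<le> q" and j: "r \<tturnstile> is_join j U S R"
    have rp: "r \<le> p" using r q by simp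
    have "r \<tturnstile> U \<^bold>\<subseteq> A" using fmono[OF r U] by (simp add: eds_iff)
    then have "r \<tturnstile> j \<^bold>\<in> A"
      using join_closedD[OF fmono[OF rp cl] fmono[OF r US]] j by blast
    with join_subset[OF j fmono[OF rp A]] show "r \<tturnstile> (\<^bold>\<exists>j. is_join j U A R)"
      by (blast intro: fexI)
  qed
qed

text \<open>A join in \<open>A\<close> is least only among the bounds in \<open>A\<close>. The join
  \<open>j'\<close> of the same set in \<open>S\<close> lies in \<open>A\<close> by closure, so
  \<open>k\<close> is below \<open>j'\<close> and thereby below every bound in
  \<open>S\<close>.\<close>

lemma continuous_into_sub_cpo:
  assumes S: "p \<tturnstile> omega_cpo S R" and A: "p \<tturnstile> A \<^bold>\<subseteq> S" and cl: "p \<tturnstile> join_closed A S R"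
    and g: "p \<tturnstile> omega_continuous g C Q A R"
  shows "p \<tturnstile> omega_continuous g C Q S R"
proof (rule continuousI)
  have gA: "p \<tturnstile> monotone_fun g C Q A R" using g by (rule continuous_monotone)
  show "p \<tturnstile> monotone_fun g C Q S R"
  proof (rule monotoneI)
    show "p \<tturnstile> is_fun g C S"
      using monotone_fun[OF gA] by (rule fun_change_cod) (meson A fmono fun_cod gA monotone_fun subsetD)
  qed (meson fmono gA monotoneD)
  fix q U V j k
  assume q: "q \<le> p" and U: "q \<tturnstile> enumerable_directed_subset U C Q" and j: "q \<tturnstile> is_join j U C Q"
    and V: "q \<tturnstile> is_image V g U" and k: "q \<tturnstile> \<langle>j,k\<rangle> \<^bold>\<in> g"
  note A = fmono[OF q A] and S = fmono[OF q S] and cl = fmono[OF q cl]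
  have kA: "q \<tturnstile> is_join k V A R"
    using fmono[OF q g] U j V k by (rule continuous_join)
  have VA: "q \<tturnstile> enumerable_directed_subset V A R"
    using fmono[OF q gA] U V by (rule eds_image)
  then have VS: "q \<tturnstile> enumerable_directed_subset V S R" using A by (rule eds_mono)
  show "q \<tturnstile> is_join k V S R"
  proof (rule fexE[OF omega_cpo_join[OF S VS]])
    fix r j' assume r: "r \<le> q" and j': "r \<tturnstile> is_join j' V S R"
    note kA = fmono[OF r kA] and A = fmono[OF r A] and S = fmono[OF r S]
    have j'A: "r \<tturnstile> j' \<^bold>\<in> A"
      using join_closedD[OF fmono[OF r cl] fmono[OF r VS] _ j'] fmono[OF r VA] by (simp add: eds_iff)
    have kj': "r \<tturnstile> \<langle>k,j'\<rangle> \<^bold>\<in> R"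
      using kA j'A by (rule join_least) (blast intro: join_upper fmono[OF _ j'])
    show "r \<tturnstile> is_join k V S R"
    proof (rule joinI)
      show kS: "r \<tturnstile> k \<^bold>\<in> S" using A join_mem[OF kA] by (rule subsetD)
      fix s c assume s: "s \<le> r" and c: "s \<tturnstile> c \<^bold>\<in> S" and ub: "\<And>t u. t \<le> s \<Longrightarrow> t \<tturnstile> u \<^bold>\<in> V \<Longrightarrow> t \<tturnstile> \<langle>u,c\<rangle> \<^bold>\<in> R"
      have "s \<tturnstile> \<langle>j',c\<rangle> \<^bold>\<in> R" using fmono[OF s j'] c ub by (rule join_least)
      with c show "s \<tturnstile> \<langle>k,c\<rangle> \<^bold>\<in> R"
        using partial_order_trans[OF omega_cpo_order[OF fmono[OF s S]] fmono[OF s kS] fmono[OF s join_mem[OF j']] c fmono[OF s kj']]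
        by blast
    qed (blast intro: join_upper fmono[OF _ kA])
  qed
qed

text \<open>The universal property compares graphs, so the identity has to be a set \<open>i\<close>
  as well; images \<open>V\<close> under it have the same members as \<open>U\<close>.\<close>

lemma continuous_identity:
  assumes i: "p \<tturnstile> is_fun i S S" and ii: "p \<tturnstile> (\<^bold>\<forall>x y. \<langle>x,y\<rangle> \<^bold>\<in> i \<^bold>\<longleftrightarrow> x \<^bold>\<in> S \<^bold>\<and> x \<^bold>= y)"
  shows "p \<tturnstile> omega_continuous i S R S R"
proof -
  have iD: "q \<tturnstile> x \<^bold>= y" if "q \<le> p" "q \<tturnstile> \<langle>x,y\<rangle> \<^bold>\<in> i" for q x y
    using ii that by (simp add: all_iff iff_iff and_iff)
  have iI: "q \<tturnstile> \<langle>x,x\<rangle> \<^bold>\<in> i" if "q \<le> p" "q \<tturnstile> x \<^bold>\<in> S" for q x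
    using ii that by (simp add: all_iff iff_iff and_iff eq_refl)
  show ?thesis
  proof (rule continuousI)
    show "p \<tturnstile> monotone_fun i S R S R"
      using i by (rule monotoneI) (blast intro: pair_in_cong iD)
    fix q U V j k
    assume q: "q \<le> p" and U: "q \<tturnstile> enumerable_directed_subset U S R" and j: "q \<tturnstile> is_join j U S R"
      and V: "q \<tturnstile> is_image V i U" and k: "q \<tturnstile> \<langle>j,k\<rangle> \<^bold>\<in> i"
    have jk: "q \<tturnstile> j \<^bold>= k" using q k by (rule iD)
    have US: "q \<tturnstile> U \<^bold>\<subseteq> S" using U by (simp add: eds_iff)
    have VU: "r \<tturnstile> v \<^bold>\<in> U" if r: "r \<le> q" and v: "r \<tturnstile> v \<^bold>\<in> V" for r v
      using image_memD[OF fmono[OF r V] v]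
    proof (rule bexE)
      fix s u assume s: "s \<le> r" and u: "s \<tturnstile> u \<^bold>\<in> U" "s \<tturnstile> \<langle>u,v\<rangle> \<^bold>\<in> i"
      have "s \<le> p" using s r q by simp
      then have "s \<tturnstile> u \<^bold>= v" using u(2) by (rule iD)
      then show "s \<tturnstile> v \<^bold>\<in> U" using u(1) by (rule eq_mem_left)
    qed
    have UV: "r \<tturnstile> u \<^bold>\<in> V" if r: "r \<le> q" and u: "r \<tturnstile> u \<^bold>\<in> U" for r u
      using fmono[OF r V] u iI[OF order_trans[OF r q] subsetD[OF fmono[OF r US] u]] by (rule image_memI)
    show "q \<tturnstile> is_join k V S R"
    proof (rule joinI)
      show "q \<tturnstile> k \<^bold>\<in> S" using jk join_mem[OF j] by (rule eq_mem_left)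
    next
      fix r v assume r: "r \<le> q" and v: "r \<tturnstile> v \<^bold>\<in> V"
      show "r \<tturnstile> \<langle>v,k\<rangle> \<^bold>\<in> R"
        using eq_refl fmono[OF r jk] join_upper[OF fmono[OF r j] VU[OF r v]] by (rule pair_in_cong)
    next
      fix r c assume r: "r \<le> q" and c: "r \<tturnstile> c \<^bold>\<in> S" and ub: "\<And>s u. s \<le> r \<Longrightarrow> s \<tturnstile> u \<^bold>\<in> V \<Longrightarrow> s \<tturnstile> \<langle>u,c\<rangle> \<^bold>\<in> R"
      have "r \<tturnstile> \<langle>j,c\<rangle> \<^bold>\<in> R"
        using fmono[OF r j] c by (rule join_least) (use UV ub order_trans[OF _ r] in blast)
      with fmono[OF r jk] eq_refl show "r \<tturnstile> \<langle>k,c\<rangle> \<^bold>\<in> R" by (rule pair_in_cong)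
    qed
  qed
qed

lemma factors_identity:
  assumes f: "p \<tturnstile> is_fun f P S" and ii: "p \<tturnstile> (\<^bold>\<forall>x y. \<langle>x,y\<rangle> \<^bold>\<in> i \<^bold>\<longleftrightarrow> x \<^bold>\<in> S \<^bold>\<and> x \<^bold>= y)"
  shows "p \<tturnstile> factors f i f"
  unfolding factors_iff
proof (intro allI HOL.impI iffI)
  fix q x z assume q: "q \<le> p"
  {
    assume xz: "q \<tturnstile> \<langle>x,z\<rangle> \<^bold>\<in> f"
    then have "q \<tturnstile> z \<^bold>\<in> S" using fun_cod[OF fmono[OF q f]] by blast
    then have "q \<tturnstile> \<langle>z,z\<rangle> \<^bold>\<in> i"
      using ii q by (simp add: all_iff iff_iff and_iff eq_refl)
    with xz show "q \<tturnstile> (\<^bold>\<exists>y. \<langle>x,y\<rangle> \<^bold>\<in> f \<^bold>\<and> \<langle>y,z\<rangle> \<^bold>\<in> i)" by (rule bexI)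
  next
    assume "q \<tturnstile> (\<^bold>\<exists>y. \<langle>x,y\<rangle> \<^bold>\<in> f \<^bold>\<and> \<langle>y,z\<rangle> \<^bold>\<in> i)"
    then show "q \<tturnstile> \<langle>x,z\<rangle> \<^bold>\<in> f"
    proof (rule bexE)
      fix r y assume r: "r \<le> q" and y: "r \<tturnstile> \<langle>x,y\<rangle> \<^bold>\<in> f" "r \<tturnstile> \<langle>y,z\<rangle> \<^bold>\<in> i"
      have "r \<tturnstile> y \<^bold>= z"
        using ii order_trans[OF r q] y(2) by (simp add: all_iff iff_iff and_iff)
      then show "r \<tturnstile> \<langle>x,z\<rangle> \<^bold>\<in> f" using pair_in_cong[OF eq_refl _ y(1)] by blast
    qed
  }
qed

lemma pair_in_eq_set: "p \<tturnstile> r \<^bold>= r' \<Longrightarrow> p \<tturnstile> \<langle>a,b\<rangle> \<^bold>\<in> r \<Longrightarrow> p \<tturnstile> \<langle>a,b\<rangle> \<^bold>\<in> r'"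
  by (erule pair_inE) (blast intro: pair_inI eq_mem_right fmono)

text \<open>A free \<open>\<omega>\<close>-cpo has no proper sub-\<open>\<omega>\<close>-cpo that contains the generators: the factorisation of
  \<open>\<eta>\<close> through it is, by uniqueness, the identity.\<close>

lemma free_no_proper_sub_cpo:
  assumes free: "p \<tturnstile> free_omega_cpo P L K S R \<eta>" and K: "p \<tturnstile> is_empty K"
    and A: "p \<tturnstile> A \<^bold>\<subseteq> S" and cl: "p \<tturnstile> join_closed A S R"
    and gen: "p \<tturnstile> (\<^bold>\<forall>x y. \<langle>x,y\<rangle> \<^bold>\<in> \<eta> \<^bold>\<longrightarrow> y \<^bold>\<in> A)"
  shows "p \<tturnstile> S \<^bold>\<subseteq> A"
proof -
  have S: "p \<tturnstile> omega_cpo S R" and \<eta>: "p \<tturnstile> morphism_to_cpo \<eta> P L K S R"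
    using free by (auto simp: free_omega_cpo_def and_iff)
  have \<eta>m: "p \<tturnstile> monotone_fun \<eta> P L S R"
    using \<eta> by (simp add: morphism_to_cpo_def and_iff)
  have "p \<tturnstile> is_fun \<eta> P A"
    using monotone_fun[OF \<eta>m] by (rule fun_change_cod) (use gen in \<open>simp add: all_iff imp_iff\<close>)
  then have "p \<tturnstile> monotone_fun \<eta> P L A R"
    by (rule monotoneI) (meson \<eta>m fmono monotoneD)
  with K have \<eta>A: "p \<tturnstile> morphism_to_cpo \<eta> P L K A R"
    by (rule morphism_uncovered)
  show ?thesis
    using ex1_ex[OF free_universal[OF free sub_cpo[OF S A cl] \<eta>A]]
  proof (rule bexE)
    fix q g assume q: "q \<le> p" and g: "q \<tturnstile> omega_continuous g S R A R" and fg: "q \<tturnstile> factors \<eta> g \<eta>"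
    show "q \<tturnstile> S \<^bold>\<subseteq> A"
    proof (rule bexE[OF identity_ex[of q S]])
      fix r i assume r: "r \<le> q" and i: "r \<tturnstile> is_fun i S S"
        and ii: "r \<tturnstile> (\<^bold>\<forall>x y. \<langle>x,y\<rangle> \<^bold>\<in> i \<^bold>\<longleftrightarrow> x \<^bold>\<in> S \<^bold>\<and> x \<^bold>= y)"
      have rp: "r \<le> p" using r q by simp
      \<comment> \<open>\<open>g\<close> takes its values in \<open>A\<close>; read as a map into
        \<open>S\<close>, it meets the identity in the uniqueness clause for the extension of
        \<open>\<eta>\<close> itself.\<close>
      have "r \<tturnstile> omega_continuous g S R S R"
        using rp by (meson S A cl g r fmono continuous_into_sub_cpo)
      then have 1: "r \<tturnstile> (omega_continuous g S R S R \<^bold>\<and> factors \<eta> g \<eta>)"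
        using fmono[OF r fg] by (simp add: and_iff)
      have 2: "r \<tturnstile> (omega_continuous i S R S R \<^bold>\<and> factors \<eta> i \<eta>)"
        using continuous_identity[OF i ii] factors_identity[OF fmono[OF rp monotone_fun[OF \<eta>m]] ii]
        by (simp add: and_iff)
      have eq: "r \<tturnstile> i \<^bold>= g"
        using free_universal[OF free S \<eta>, THEN fmono[OF rp]] 2 1 by (rule ex1_unique)
      show "r \<tturnstile> S \<^bold>\<subseteq> A"
        unfolding subset_iff
      proof (intro allI HOL.impI)
        fix s x assume s: "s \<le> r" and x: "s \<tturnstile> x \<^bold>\<in> S"
        have "s \<tturnstile> \<langle>x,x\<rangle> \<^bold>\<in> i" using ii s x by (simp add: all_iff iff_iff and_iff eq_refl)
        with fmono[OF s eq] have "s \<tturnstile> \<langle>x,x\<rangle> \<^bold>\<in> g" by (rule pair_in_eq_set)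
        moreover have "s \<tturnstile> is_fun g S A"
          using fmono[OF order_trans[OF s r] g] by (blast intro: monotone_fun continuous_monotone)
        ultimately show "s \<tturnstile> x \<^bold>\<in> A" by (blast intro: fun_cod)
      qed
    qed
  qed
qed

lemma empty_elim: "p \<tturnstile> is_empty z \<Longrightarrow> p \<tturnstile> x \<^bold>\<in> z \<Longrightarrow> p \<tturnstile> A"
  by (rule ffalseE) (simp add: is_empty_def kripke_joyal)

lemma empty_unique: "p \<tturnstile> is_empty x \<Longrightarrow> p \<tturnstile> is_empty y \<Longrightarrow> p \<tturnstile> x \<^bold>= y"
  by (rule eqI) (blast intro: empty_elim fmono)+

lemma empty_cong: "p \<tturnstile> is_empty x \<Longrightarrow> p \<tturnstile> x \<^bold>= y \<Longrightarrow> p \<tturnstile> is_empty y"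
  by (simp add: is_empty_def kripke_joyal eq_iff)

section \<open>Sets of propositions\<close>

lemma props_empty: "p \<tturnstile> set_of_propositions Om \<Longrightarrow> p \<tturnstile> is_empty x \<Longrightarrow> p \<tturnstile> x \<^bold>\<in> Om"
  by (rule fmp[of _ "is_empty x"]) (simp_all add: set_of_propositions_def and_iff all_iff)

lemma props_true:
  assumes "p \<tturnstile> set_of_propositions Om" "p \<tturnstile> is_proposition x" "p \<tturnstile> proposition_true x"
  shows "p \<tturnstile> x \<^bold>\<in> Om"
  by (rule fmp[of _ "is_proposition x \<^bold>\<and> proposition_true x"])
    (use assms in \<open>simp_all add: set_of_propositions_def and_iff all_iff\<close>)

lemma props_inter:
  assumes "p \<tturnstile> set_of_propositions Om" "p \<tturnstile> x \<^bold>\<in> Om" "p \<tturnstile> y \<^bold>\<in> Om" "p \<tturnstile> is_inter2 z x y"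
  shows "p \<tturnstile> z \<^bold>\<in> Om"
  by (rule fmp[of _ "x \<^bold>\<in> Om \<^bold>\<and> y \<^bold>\<in> Om \<^bold>\<and> is_inter2 z x y"])
    (use assms in \<open>simp_all add: set_of_propositions_def and_iff all_iff\<close>)

lemma props_union:
  assumes "p \<tturnstile> set_of_propositions Om" "p \<tturnstile> U \<^bold>\<subseteq> Om" "p \<tturnstile> enumerable U" "p \<tturnstile> is_union u U"
  shows "p \<tturnstile> u \<^bold>\<in> Om"
  by (rule fmp[of _ "U \<^bold>\<subseteq> Om \<^bold>\<and> enumerable U \<^bold>\<and> is_union u U"])
    (use assms in \<open>simp_all add: set_of_propositions_def and_iff all_iff\<close>)

lemma props_member:
  assumes "p \<tturnstile> set_of_propositions Om" "p \<tturnstile> x \<^bold>\<in> Om" "p \<tturnstile> y \<^bold>\<in> x"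
  shows "p \<tturnstile> is_empty y"
proof -
  have "p \<tturnstile> is_proposition x"
    by (rule fmp[of _ "x \<^bold>\<in> Om"]) (use assms(1,2) in \<open>simp_all add: set_of_propositions_def and_iff all_iff\<close>)
  then show ?thesis
    using assms(3) by (simp add: is_proposition_def all_iff imp_iff)
qed

text \<open>An order must be a set of pairs, so inclusion is separated from the product. The
  defining formula repeats the bounds \<open>x \<in> A\<close> and \<open>y \<in> A\<close> in order
  to be bounded.\<close>

lemma inclusion_order_ex:
  "p \<tturnstile> (\<^bold>\<exists>Q. \<^bold>\<forall>x y. \<langle>x,y\<rangle> \<^bold>\<in> Q \<^bold>\<longleftrightarrow> (x \<^bold>\<in> A \<^bold>\<and> y \<^bold>\<in> A \<^bold>\<and> x \<^bold>\<subseteq> y))"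
proof (rule fexE[OF product_ex[of p A A]])
  fix q c assume q: "q \<le> p" and c: "q \<tturnstile> is_product c A A"
  let ?F = "\<lambda>w. \<^bold>\<exists>x. x \<^bold>\<in> A \<^bold>\<and> (\<^bold>\<exists>y. y \<^bold>\<in> A \<^bold>\<and> is_pair w x y \<^bold>\<and> x \<^bold>\<subseteq> y)"
  have "separable ?F"
    unfolding separable_def
    by (rule HOL.exI[of _ "Exists 1 (And (Mem 1 3) (Exists 2 (And (Mem 2 3) (And (pair_form 0 1 2) (sub_form 1 2)))))"],
        rule HOL.exI[of _ "\<lambda>_. A"]) (simp add: bounded_intros eval_forms fm_value)
  from separation[OF this, of q c]
  show "q \<tturnstile> (\<^bold>\<exists>Q. \<^bold>\<forall>x y. \<langle>x,y\<rangle> \<^bold>\<in> Q \<^bold>\<longleftrightarrow> (x \<^bold>\<in> A \<^bold>\<and> y \<^bold>\<in> A \<^bold>\<and> x \<^bold>\<subseteq> y))"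
  proof (rule fexE)
    fix r Q assume r: "r \<le> q" and Q: "r \<tturnstile> (\<^bold>\<forall>w. w \<^bold>\<in> Q \<^bold>\<longleftrightarrow> w \<^bold>\<in> c \<^bold>\<and> ?F w)"
    have memQ: "s \<tturnstile> w \<^bold>\<in> Q \<longleftrightarrow> s \<tturnstile> w \<^bold>\<in> c \<and> s \<tturnstile> ?F w" if "s \<le> r" for s w
      using Q that by (simp add: all_iff iff_iff and_iff)
    have "s \<tturnstile> (x \<^bold>\<in> A \<^bold>\<and> y \<^bold>\<in> A \<^bold>\<and> x \<^bold>\<subseteq> y)" if s: "s \<le> r" and xy: "s \<tturnstile> \<langle>x,y\<rangle> \<^bold>\<in> Q" for s x y
      using xy
    proof (rule pair_inE)
      fix t w assume t: "t \<le> s" and w: "t \<tturnstile> is_pair w x y" "t \<tturnstile> w \<^bold>\<in> Q"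
      have "t \<tturnstile> ?F w" using memQ[of t w] t s w(2) by simp
      then show "t \<tturnstile> (x \<^bold>\<in> A \<^bold>\<and> y \<^bold>\<in> A \<^bold>\<and> x \<^bold>\<subseteq> y)"
      proof (elim bexE)
        fix u x' v y' assume u: "u \<le> t" "u \<tturnstile> x' \<^bold>\<in> A" and v: "v \<le> u" "v \<tturnstile> y' \<^bold>\<in> A"
          and xy': "v \<tturnstile> (is_pair w x' y' \<^bold>\<and> x' \<^bold>\<subseteq> y')"
        have "v \<le> t" using u v by simp
        then have w: "v \<tturnstile> is_pair w x y" using w by (blast intro: fmono)
        have pw: "v \<tturnstile> is_pair w x' y'" and sub: "v \<tturnstile> x' \<^bold>\<subseteq> y'" using xy' by (auto simp: and_iff)
        have e: "v \<tturnstile> x' \<^bold>= x" "v \<tturnstile> y' \<^bold>= y"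
          using pair_inj1[OF pw w] pair_inj2[OF pw w] by auto
        have "v \<tturnstile> x \<^bold>\<subseteq> y" using sub e by (simp add: subset_iff eq_iff)
        then show "v \<tturnstile> (x \<^bold>\<in> A \<^bold>\<and> y \<^bold>\<in> A \<^bold>\<and> x \<^bold>\<subseteq> y)"
          using eq_mem_left[OF e(1) fmono[OF v(1) u(2)]] eq_mem_left[OF e(2) v(2)] by (simp add: and_iff)
      qed
    qed
    moreover have "s \<tturnstile> \<langle>x,y\<rangle> \<^bold>\<in> Q" if s: "s \<le> r" and xy: "s \<tturnstile> (x \<^bold>\<in> A \<^bold>\<and> y \<^bold>\<in> A \<^bold>\<and> x \<^bold>\<subseteq> y)" for s x y
    proof (rule fexE[OF pair_ex[of s x y]])
      fix t w assume t: "t \<le> s" and w: "t \<tturnstile> is_pair w x y"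
      have xy: "t \<tturnstile> x \<^bold>\<in> A" "t \<tturnstile> y \<^bold>\<in> A" "t \<tturnstile> x \<^bold>\<subseteq> y" using fmono[OF t xy] by (auto simp: and_iff)
      have "t \<tturnstile> ?F w"
        by (intro bexI[of _ _ x] bexI[of _ _ y]) (use xy w in \<open>auto simp: and_iff\<close>)
      moreover have "t \<tturnstile> (\<^bold>\<exists>x. x \<^bold>\<in> A \<^bold>\<and> (\<^bold>\<exists>y. y \<^bold>\<in> A \<^bold>\<and> is_pair w x y))"
        by (intro bexI[of _ _ x] bexI[of _ _ y]) (use xy w in auto)
      then have "t \<tturnstile> w \<^bold>\<in> c" using c t s r by (simp add: is_product_def all_iff iff_iff)
      ultimately have "t \<tturnstile> w \<^bold>\<in> Q" using memQ[of t w] t s by simp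
      with w show "t \<tturnstile> \<langle>x,y\<rangle> \<^bold>\<in> Q" by (rule pair_inI)
    qed
    ultimately have "r \<tturnstile> (\<^bold>\<forall>x y. \<langle>x,y\<rangle> \<^bold>\<in> Q \<^bold>\<longleftrightarrow> (x \<^bold>\<in> A \<^bold>\<and> y \<^bold>\<in> A \<^bold>\<and> x \<^bold>\<subseteq> y))"
      unfolding all_iff iff_iff by blast
    then show "r \<tturnstile> (\<^bold>\<exists>Q. \<^bold>\<forall>x y. \<langle>x,y\<rangle> \<^bold>\<in> Q \<^bold>\<longleftrightarrow> (x \<^bold>\<in> A \<^bold>\<and> y \<^bold>\<in> A \<^bold>\<and> x \<^bold>\<subseteq> y))"
      by (rule fexI)
  qed
qed

lemma props_omega_cpo:
  assumes Om: "p \<tturnstile> set_of_propositions Om"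
    and Q: "p \<tturnstile> (\<^bold>\<forall>x y. \<langle>x,y\<rangle> \<^bold>\<in> Q \<^bold>\<longleftrightarrow> (x \<^bold>\<in> Om \<^bold>\<and> y \<^bold>\<in> Om \<^bold>\<and> x \<^bold>\<subseteq> y))"
  shows "p \<tturnstile> omega_cpo Om Q"
proof -
  have Q: "q \<tturnstile> \<langle>x,y\<rangle> \<^bold>\<in> Q \<longleftrightarrow> q \<tturnstile> x \<^bold>\<in> Om \<and> q \<tturnstile> y \<^bold>\<in> Om \<and> q \<tturnstile> x \<^bold>\<subseteq> y" if "q \<le> p" for q x y
    using Q that by (simp add: all_iff iff_iff and_iff)
  show ?thesis
  proof (rule omega_cpoI)
    show "p \<tturnstile> partial_order Om Q"
      by (rule partial_orderI) (auto simp: Q subset_iff eq_iff)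
    fix q U assume q: "q \<le> p" and "q \<tturnstile> enumerable_directed_subset U Om Q"
    then have U: "q \<tturnstile> U \<^bold>\<subseteq> Om" "q \<tturnstile> enumerable U" by (auto simp: eds_iff)
    show "q \<tturnstile> (\<^bold>\<exists>j. is_join j U Om Q)"
    proof (rule fexE[OF union_ex[of q U]])
      fix r j assume r: "r \<le> q" and j: "r \<tturnstile> is_union j U"
      have memj: "s \<tturnstile> x \<^bold>\<in> j \<longleftrightarrow> s \<tturnstile> (\<^bold>\<exists>u. u \<^bold>\<in> U \<^bold>\<and> x \<^bold>\<in> u)" if "s \<le> r" for s x
        using j that by (simp add: is_union_def all_iff iff_iff)
      have rp: "r \<le> p" using r q by simp
      note U = U[THEN fmono[OF r]]
      have jOm: "r \<tturnstile> j \<^bold>\<in> Om"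
        using fmono[OF rp Om] U j by (rule props_union)
      have "r \<tturnstile> is_join j U Om Q"
      proof (rule joinI[OF jOm])
        fix s u assume s: "s \<le> r" and u: "s \<tturnstile> u \<^bold>\<in> U"
        have "s \<tturnstile> u \<^bold>\<subseteq> j"
          unfolding subset_iff
        proof (intro allI HOL.impI)
          fix t x assume t: "t \<le> s" and x: "t \<tturnstile> x \<^bold>\<in> u"
          show "t \<tturnstile> x \<^bold>\<in> j"
            using memj[OF order_trans[OF t s]] bexI[of t "\<lambda>u. u \<^bold>\<in> U" u "\<lambda>u. x \<^bold>\<in> u"] fmono[OF t u] x by blast
        qed
        then show "s \<tturnstile> \<langle>u,j\<rangle> \<^bold>\<in> Q"
          using Q[OF order_trans[OF s rp]] subsetD[OF fmono[OF s U(1)] u] fmono[OF s jOm] by blast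
      next
        fix s c assume s: "s \<le> r" and c: "s \<tturnstile> c \<^bold>\<in> Om" and ub: "\<And>t u. t \<le> s \<Longrightarrow> t \<tturnstile> u \<^bold>\<in> U \<Longrightarrow> t \<tturnstile> \<langle>u,c\<rangle> \<^bold>\<in> Q"
        have "s \<tturnstile> j \<^bold>\<subseteq> c"
          unfolding subset_iff
        proof (intro allI HOL.impI)
          fix t x assume t: "t \<le> s" and "t \<tturnstile> x \<^bold>\<in> j"
          then have "t \<tturnstile> (\<^bold>\<exists>u. u \<^bold>\<in> U \<^bold>\<and> x \<^bold>\<in> u)" using memj[OF order_trans[OF t s]] by blast
          then show "t \<tturnstile> x \<^bold>\<in> c"
          proof (rule bexE)
            fix v u assume v: "v \<le> t" and u: "v \<tturnstile> u \<^bold>\<in> U" "v \<tturnstile> x \<^bold>\<in> u"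
            have "v \<tturnstile> u \<^bold>\<subseteq> c" using ub[of v u] u(1) Q[of v u c] v t s rp by simp
            then show "v \<tturnstile> x \<^bold>\<in> c" using u(2) by (rule subsetD)
          qed
        qed
        then show "s \<tturnstile> \<langle>j,c\<rangle> \<^bold>\<in> Q"
          using Q[OF order_trans[OF s rp]] c fmono[OF s jOm] by blast
      qed
      then show "r \<tturnstile> (\<^bold>\<exists>j. is_join j U Om Q)" by (rule fexI)
    qed
  qed
qed

end

section \<open>The Sierpinski space\<close>

locale sierpinski_setting = model M for M :: "('u, 'h::frame) struct" +
  fixes B L K b t \<eta> S R bt tt Om :: 'u
begin

text \<open>The witnesses hidden by \<open>sierpinski\<close>, together with the value
  \<open>bt\<close> of \<open>\<eta>\<close> at \<open>b\<close>. This is a formula and not a list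
  of locale assumptions, because it is forced only at some stage and has to be carried to smaller
  ones.\<close>

definition generated :: "('u, 'h) fm"
  where "generated = (two_chain B L b t \<^bold>\<and> is_empty K \<^bold>\<and> free_omega_cpo B L K S R \<eta> \<^bold>\<and>
    \<langle>b,bt\<rangle> \<^bold>\<in> \<eta> \<^bold>\<and> \<langle>t,tt\<rangle> \<^bold>\<in> \<eta>)"

context
  fixes p
  assumes gen: "p \<tturnstile> generated"
begin

lemma b_empty: "p \<tturnstile> is_empty b"
  and t_singleton: "p \<tturnstile> is_upair t b b"
  and B_two: "p \<tturnstile> is_upair B b t"
  and K_empty: "p \<tturnstile> is_empty K"
  and free: "p \<tturnstile> free_omega_cpo B L K S R \<eta>"
  and eta_b: "p \<tturnstile> \<langle>b,bt\<rangle> \<^bold>\<in> \<eta>"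
  and eta_t: "p \<tturnstile> \<langle>t,tt\<rangle> \<^bold>\<in> \<eta>"
  using gen by (auto simp: generated_def two_chain_def and_iff)

lemma L_iff: "p \<tturnstile> \<langle>x,y\<rangle> \<^bold>\<in> L \<longleftrightarrow>
    p \<tturnstile> ((x \<^bold>= b \<^bold>\<and> y \<^bold>= b) \<^bold>\<or> (x \<^bold>= b \<^bold>\<and> y \<^bold>= t) \<^bold>\<or> (x \<^bold>= t \<^bold>\<and> y \<^bold>= t))"
  using gen by (simp add: generated_def two_chain_def and_iff all_iff iff_iff)

lemma S_cpo: "p \<tturnstile> omega_cpo S R"
  and eta_monotone: "p \<tturnstile> monotone_fun \<eta> B L S R"
  using free by (auto simp: free_omega_cpo_def morphism_to_cpo_def and_iff)

lemma S_order: "p \<tturnstile> partial_order S R"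
  using S_cpo by (rule omega_cpo_order)

lemma bt_in_S: "p \<tturnstile> bt \<^bold>\<in> S"
  and tt_in_S: "p \<tturnstile> tt \<^bold>\<in> S"
  using fun_cod[OF monotone_fun[OF eta_monotone]] eta_b eta_t by auto

lemma B_cases: "p \<tturnstile> x \<^bold>\<in> B \<Longrightarrow> p \<tturnstile> (x \<^bold>= b \<^bold>\<or> x \<^bold>= t)"
  using B_two by (rule upair_cases)

lemma eta_value: "p \<tturnstile> \<langle>x,y\<rangle> \<^bold>\<in> \<eta> \<Longrightarrow> p \<tturnstile> \<langle>x',y'\<rangle> \<^bold>\<in> \<eta> \<Longrightarrow> p \<tturnstile> x \<^bold>= x' \<Longrightarrow> p \<tturnstile> y' \<^bold>= y"
  using fun_unique[OF monotone_fun[OF eta_monotone]] pair_in_cong eq_refl by blast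

end

text \<open>\<open>B\<close> is an unordered pair, so membership in it is a disjunction, which the
  values of \<open>\<eta>\<close> inherit.\<close>

lemma generated_values:
  assumes gen: "p \<tturnstile> generated" and xy: "p \<tturnstile> \<langle>x,y\<rangle> \<^bold>\<in> \<eta>"
  shows "p \<tturnstile> (y \<^bold>= bt \<^bold>\<or> y \<^bold>= tt)"
proof -
  have "p \<tturnstile> x \<^bold>\<in> B" using monotone_fun[OF eta_monotone[OF gen]] xy by (rule fun_dom)
  from B_cases[OF gen this] show ?thesis
  proof (rule or_mono)
    show "p \<tturnstile> (x \<^bold>= b \<^bold>\<longrightarrow> y \<^bold>= bt)"
      by (rule fimpI) (meson eq_sym eta_b eta_value fmono gen xy)
    show "p \<tturnstile> (x \<^bold>= t \<^bold>\<longrightarrow> y \<^bold>= tt)"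
      by (rule fimpI) (meson eq_sym eta_t eta_value fmono gen xy)
  qed
qed

text \<open>The elements of \<open>S\<close> that satisfy \<open>F\<close> form a set
  \<open>A\<close> because \<open>F\<close> is separable. It contains both generators and is closed
  under joins, so it is all of \<open>S\<close> by minimality. The induction hypothesis covers all
  stages below \<open>q\<close> because the inclusion of \<open>U\<close> in \<open>A\<close>
  does.\<close>

lemma S_induct:
  assumes gen: "p \<tturnstile> generated" and F: "separable F" and s: "p \<tturnstile> s \<^bold>\<in> S"
    and bt: "p \<tturnstile> F bt" and tt: "p \<tturnstile> F tt"
    and step: "\<And>q U j. q \<le> p \<Longrightarrow> q \<tturnstile> enumerable_directed_subset U S R \<Longrightarrow> q \<tturnstile> is_join j U S R \<Longrightarrow>
      (\<And>r u. r \<le> q \<Longrightarrow> r \<tturnstile> u \<^bold>\<in> U \<Longrightarrow> r \<tturnstile> F u) \<Longrightarrow> q \<tturnstile> F j"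
  shows "p \<tturnstile> F s"
  using separation[OF F, of p S]
proof (rule fexE)
  fix q A assume q: "q \<le> p" and A: "q \<tturnstile> (\<^bold>\<forall>x. x \<^bold>\<in> A \<^bold>\<longleftrightarrow> x \<^bold>\<in> S \<^bold>\<and> F x)"
  have A: "r \<tturnstile> x \<^bold>\<in> A \<longleftrightarrow> r \<tturnstile> x \<^bold>\<in> S \<and> r \<tturnstile> F x" if "r \<le> q" for r x
    using A that by (simp add: all_iff iff_iff and_iff)
  note gen = fmono[OF q gen]
  have "q \<tturnstile> bt \<^bold>\<in> A" "q \<tturnstile> tt \<^bold>\<in> A"
    using A bt_in_S[OF gen] tt_in_S[OF gen] bt tt q by (auto intro: fmono)
  then have "r \<tturnstile> y \<^bold>\<in> A" if "r \<le> q" "r \<tturnstile> \<langle>x,y\<rangle> \<^bold>\<in> \<eta>" for r x y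
    using generated_values[OF fmono[OF that(1) gen] that(2)]
    by (elim forE) (meson eq_mem_left eq_sym fmono that(1))+
  then have "q \<tturnstile> (\<^bold>\<forall>x y. \<langle>x,y\<rangle> \<^bold>\<in> \<eta> \<^bold>\<longrightarrow> y \<^bold>\<in> A)"
    by (simp add: all_iff imp_iff)
  moreover have AS: "q \<tturnstile> A \<^bold>\<subseteq> S"
    by (simp add: subset_iff A)
  moreover have "q \<tturnstile> join_closed A S R"
    unfolding join_closed_def all_iff
  proof (intro allI fimpI)
    fix U j r assume r: "r \<le> q" and "r \<tturnstile> (enumerable_directed_subset U S R \<^bold>\<and> U \<^bold>\<subseteq> A \<^bold>\<and> is_join j U S R)"
    then have U: "r \<tturnstile> enumerable_directed_subset U S R" "r \<tturnstile> U \<^bold>\<subseteq> A" "r \<tturnstile> is_join j U S R"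
      by (auto simp: and_iff)
    have "r \<tturnstile> F j"
      using order_trans[OF r q] U(1,3)
    proof (rule step)
      fix v u assume v: "v \<le> r" and "v \<tturnstile> u \<^bold>\<in> U"
      then have "v \<tturnstile> u \<^bold>\<in> A" using subsetD[OF fmono[OF v U(2)]] by blast
      then show "v \<tturnstile> F u" using A[of v u] v r by simp
    qed
    then show "r \<tturnstile> j \<^bold>\<in> A" using A[OF r] join_mem[OF U(3)] by blast
  qed
  ultimately have "q \<tturnstile> S \<^bold>\<subseteq> A"
    using free_no_proper_sub_cpo[OF free[OF gen] K_empty[OF gen]] by blast
  then have "q \<tturnstile> s \<^bold>\<in> A" using fmono[OF q s] by (rule subsetD)
  then show "q \<tturnstile> F s" using A[of q s] by simp
qed

text \<open>The last clause says that \<open>g\<close> takes joins to unions; only this half of continuity is used.\<close>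

definition valuation :: "'u \<Rightarrow> ('u, 'h) fm"
  where "valuation g = (is_fun g S Om \<^bold>\<and> \<langle>bt,b\<rangle> \<^bold>\<in> g \<^bold>\<and> \<langle>tt,t\<rangle> \<^bold>\<in> g \<^bold>\<and>
    (\<^bold>\<forall>U j y x. enumerable_directed_subset U S R \<^bold>\<and> is_join j U S R \<^bold>\<and> \<langle>j,y\<rangle> \<^bold>\<in> g \<^bold>\<and> x \<^bold>\<in> y \<^bold>\<longrightarrow>
       (\<^bold>\<exists>u. u \<^bold>\<in> U \<^bold>\<and> (\<^bold>\<exists>z. \<langle>u,z\<rangle> \<^bold>\<in> g \<^bold>\<and> x \<^bold>\<in> z))))"

text \<open>Continuity describes \<open>y\<close> only through the order, as a join of the image
  \<open>V\<close>. The union \<open>c\<close> of \<open>V\<close> belongs to \<open>Om\<close> and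
  bounds \<open>V\<close>, so \<open>y \<subseteq> c\<close>, and a member of a union comes from a
  member of \<open>V\<close>.\<close>

lemma continuous_valuation:
  assumes Om: "p \<tturnstile> set_of_propositions Om"
    and Q: "p \<tturnstile> (\<^bold>\<forall>x y. \<langle>x,y\<rangle> \<^bold>\<in> Q \<^bold>\<longleftrightarrow> (x \<^bold>\<in> Om \<^bold>\<and> y \<^bold>\<in> Om \<^bold>\<and> x \<^bold>\<subseteq> y))"
    and g: "p \<tturnstile> omega_continuous g S R Om Q"
    and U: "p \<tturnstile> enumerable_directed_subset U S R" and j: "p \<tturnstile> is_join j U S R"
    and y: "p \<tturnstile> \<langle>j,y\<rangle> \<^bold>\<in> g" and x: "p \<tturnstile> x \<^bold>\<in> y"
  shows "p \<tturnstile> (\<^bold>\<exists>u. u \<^bold>\<in> U \<^bold>\<and> (\<^bold>\<exists>z. \<langle>u,z\<rangle> \<^bold>\<in> g \<^bold>\<and> x \<^bold>\<in> z))"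
proof (rule fexE[OF image_ex[OF monotone_fun[OF continuous_monotone[OF g]], of U]])
  fix q V assume q: "q \<le> p" and V: "q \<tturnstile> is_image V g U"
  note g = fmono[OF q g] and U = fmono[OF q U] and j = fmono[OF q j] and y = fmono[OF q y] and x = fmono[OF q x]
  have Q: "r \<tturnstile> \<langle>x,y\<rangle> \<^bold>\<in> Q \<longleftrightarrow> r \<tturnstile> x \<^bold>\<in> Om \<and> r \<tturnstile> y \<^bold>\<in> Om \<and> r \<tturnstile> x \<^bold>\<subseteq> y" if "r \<le> q" for r x y
    using fmono[OF q Q] that by (simp add: all_iff iff_iff and_iff)
  have yV: "q \<tturnstile> is_join y V Om Q"
    using g U j V y by (rule continuous_join)
  have "q \<tturnstile> enumerable_directed_subset V Om Q"
    using continuous_monotone[OF g] U V by (rule eds_image)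
  then have V': "q \<tturnstile> V \<^bold>\<subseteq> Om" "q \<tturnstile> enumerable V" by (auto simp: eds_iff)
  show "q \<tturnstile> (\<^bold>\<exists>u. u \<^bold>\<in> U \<^bold>\<and> (\<^bold>\<exists>z. \<langle>u,z\<rangle> \<^bold>\<in> g \<^bold>\<and> x \<^bold>\<in> z))"
  proof (rule fexE[OF union_ex[of q V]])
    fix r c assume r: "r \<le> q" and c: "r \<tturnstile> is_union c V"
    have memc: "s \<tturnstile> x \<^bold>\<in> c \<longleftrightarrow> s \<tturnstile> (\<^bold>\<exists>v. v \<^bold>\<in> V \<^bold>\<and> x \<^bold>\<in> v)" if "s \<le> r" for s x
      using c that by (simp add: is_union_def all_iff iff_iff)
    have cOm: "r \<tturnstile> c \<^bold>\<in> Om"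
      using fmono[OF order_trans[OF r q] Om] V'[THEN fmono[OF r]] c by (rule props_union)
    have "r \<tturnstile> \<langle>y,c\<rangle> \<^bold>\<in> Q"
      using fmono[OF r yV] cOm
    proof (rule join_least)
      fix s v assume s: "s \<le> r" and v: "s \<tturnstile> v \<^bold>\<in> V"
      have "s \<tturnstile> v \<^bold>\<subseteq> c"
        unfolding subset_iff
      proof (intro allI HOL.impI)
        fix w x assume w: "w \<le> s" and x: "w \<tturnstile> x \<^bold>\<in> v"
        show "w \<tturnstile> x \<^bold>\<in> c"
          using memc[OF order_trans[OF w s]] bexI[of w "\<lambda>v. v \<^bold>\<in> V" v "\<lambda>v. x \<^bold>\<in> v"] fmono[OF w v] x by blast
      qed
      then show "s \<tturnstile> \<langle>v,c\<rangle> \<^bold>\<in> Q"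
        using Q[OF order_trans[OF s r]] fmono[OF s cOm] subsetD[OF fmono[OF order_trans[OF s r] V'(1)] v] by blast
    qed
    then have "r \<tturnstile> y \<^bold>\<subseteq> c" using Q[OF r] by blast
    then have "r \<tturnstile> x \<^bold>\<in> c" using fmono[OF r x] by (rule subsetD)
    then have "r \<tturnstile> (\<^bold>\<exists>v. v \<^bold>\<in> V \<^bold>\<and> x \<^bold>\<in> v)" using memc[of r x] by simp
    then show "r \<tturnstile> (\<^bold>\<exists>u. u \<^bold>\<in> U \<^bold>\<and> (\<^bold>\<exists>z. \<langle>u,z\<rangle> \<^bold>\<in> g \<^bold>\<and> x \<^bold>\<in> z))"
    proof (rule bexE)
      fix s v assume s: "s \<le> r" and v: "s \<tturnstile> v \<^bold>\<in> V" "s \<tturnstile> x \<^bold>\<in> v"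
      show "s \<tturnstile> (\<^bold>\<exists>u. u \<^bold>\<in> U \<^bold>\<and> (\<^bold>\<exists>z. \<langle>u,z\<rangle> \<^bold>\<in> g \<^bold>\<and> x \<^bold>\<in> z))"
        using image_memD[OF fmono[OF order_trans[OF s r] V] v(1)]
      proof (rule bexE)
        fix w u assume w: "w \<le> s" and u: "w \<tturnstile> u \<^bold>\<in> U" "w \<tturnstile> \<langle>u,v\<rangle> \<^bold>\<in> g"
        show "w \<tturnstile> (\<^bold>\<exists>u. u \<^bold>\<in> U \<^bold>\<and> (\<^bold>\<exists>z. \<langle>u,z\<rangle> \<^bold>\<in> g \<^bold>\<and> x \<^bold>\<in> z))"
          using u(1) by (rule bexI) (rule bexI, rule u(2), rule fmono[OF w v(2)])
      qed
    qed
  qed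
qed

lemma b_in_t: "p \<tturnstile> generated \<Longrightarrow> p \<tturnstile> b \<^bold>\<in> t"
  by (rule upair_mem1[OF t_singleton])

lemma b_in_Om: "p \<tturnstile> generated \<Longrightarrow> p \<tturnstile> set_of_propositions Om \<Longrightarrow> p \<tturnstile> b \<^bold>\<in> Om"
  by (blast intro: props_empty b_empty)

lemma mem_t: "p \<tturnstile> generated \<Longrightarrow> p \<tturnstile> x \<^bold>\<in> t \<longleftrightarrow> p \<tturnstile> is_empty x"
proof
  assume gen: "p \<tturnstile> generated"
  {
    assume "p \<tturnstile> x \<^bold>\<in> t"
    then have "p \<tturnstile> b \<^bold>= x"
      using t_singleton[OF gen] by (blast intro: singleton_eq eq_sym)
    with b_empty[OF gen] show "p \<tturnstile> is_empty x" by (rule empty_cong)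
  next
    assume "p \<tturnstile> is_empty x"
    with b_empty[OF gen] have "p \<tturnstile> b \<^bold>= x" by (rule empty_unique)
    then show "p \<tturnstile> x \<^bold>\<in> t" using b_in_t[OF gen] by (rule eq_mem_left)
  }
qed

lemma t_in_Om:
  assumes "p \<tturnstile> generated" "p \<tturnstile> set_of_propositions Om"
  shows "p \<tturnstile> t \<^bold>\<in> Om"
  using assms(2)
proof (rule props_true)
  show "p \<tturnstile> is_proposition t"
    using mem_t[OF fmono[OF _ assms(1)]] by (simp add: is_proposition_def all_iff imp_iff)
  show "p \<tturnstile> proposition_true t"
    unfolding proposition_true_def using b_in_t[OF assms(1)] by (rule fexI)
qed

text \<open>The generators \<open>b = \<emptyset>\<close> and \<open>t = {\<emptyset>}\<close> are
  themselves the propositions false and true, so the graph of the identity on \<open>B\<close>, read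
  as a map into \<open>Om\<close>, is the morphism to extend.\<close>

lemma valuation_ex:
  assumes gen: "p \<tturnstile> generated" and Om: "p \<tturnstile> set_of_propositions Om"
  shows "p \<tturnstile> (\<^bold>\<exists>g. valuation g)"
proof (rule fexE[OF inclusion_order_ex[of p Om]])
  fix q Q assume q: "q \<le> p" and Q: "q \<tturnstile> (\<^bold>\<forall>x y. \<langle>x,y\<rangle> \<^bold>\<in> Q \<^bold>\<longleftrightarrow> (x \<^bold>\<in> Om \<^bold>\<and> y \<^bold>\<in> Om \<^bold>\<and> x \<^bold>\<subseteq> y))"
  have Q': "r \<tturnstile> \<langle>x,y\<rangle> \<^bold>\<in> Q \<longleftrightarrow> r \<tturnstile> x \<^bold>\<in> Om \<and> r \<tturnstile> y \<^bold>\<in> Om \<and> r \<tturnstile> x \<^bold>\<subseteq> y" if "r \<le> q" for r x y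
    using Q that by (simp add: all_iff iff_iff and_iff)
  note gen = fmono[OF q gen] and Om = fmono[OF q Om]
  show "q \<tturnstile> (\<^bold>\<exists>g. valuation g)"
  proof (rule bexE[OF identity_ex[of q B]])
    fix r i assume r: "r \<le> q" and i: "r \<tturnstile> is_fun i B B" and ii: "r \<tturnstile> (\<^bold>\<forall>x y. \<langle>x,y\<rangle> \<^bold>\<in> i \<^bold>\<longleftrightarrow> x \<^bold>\<in> B \<^bold>\<and> x \<^bold>= y)"
    note gen = fmono[OF r gen] and Om = fmono[OF r Om] and Q = fmono[OF r Q]
    have iD: "s \<tturnstile> x \<^bold>= y" if "s \<le> r" "s \<tturnstile> \<langle>x,y\<rangle> \<^bold>\<in> i" for s x y
      using ii that by (simp add: all_iff iff_iff and_iff)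
    have iI: "r \<tturnstile> \<langle>x,x\<rangle> \<^bold>\<in> i" if "r \<tturnstile> x \<^bold>\<in> B" for x
      using ii that by (simp add: all_iff iff_iff and_iff eq_refl)
    have BOm: "s \<tturnstile> x \<^bold>\<in> Om" if s: "s \<le> r" and x: "s \<tturnstile> x \<^bold>\<in> B" for s x
      using B_cases[OF fmono[OF s gen] x]
      by (rule forE) (meson b_in_Om t_in_Om gen Om s fmono eq_sym eq_mem_left)+
    have iOm: "r \<tturnstile> is_fun i B Om"
      using i by (rule fun_change_cod) (meson BOm fmono fun_cod i)
    have "r \<tturnstile> monotone_fun i B L Om Q"
      using iOm
    proof (rule monotoneI)
      fix s x y x' y' assume s: "s \<le> r" and B: "s \<tturnstile> x \<^bold>\<in> B" "s \<tturnstile> y \<^bold>\<in> B" and L: "s \<tturnstile> \<langle>x,y\<rangle> \<^bold>\<in> L"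
        and i': "s \<tturnstile> \<langle>x,x'\<rangle> \<^bold>\<in> i" "s \<tturnstile> \<langle>y,y'\<rangle> \<^bold>\<in> i"
      note gen = fmono[OF s gen]
      \<comment> \<open>The empty set is included in every set, which settles the two cases of the
        order of \<open>B\<close> with \<open>x = b\<close>.\<close>
      have empty: "w \<tturnstile> x \<^bold>\<subseteq> y" if w: "w \<le> s" and "w \<tturnstile> x \<^bold>= b" for w
        using empty_cong[OF b_empty[OF fmono[OF w gen]] eq_sym[OF that(2)]]
        unfolding subset_iff by (blast intro: empty_elim fmono)
      have "s \<tturnstile> x \<^bold>\<subseteq> y"
        using L unfolding L_iff[OF gen]
      proof (elim forE)
        fix w assume "w \<le> s" "w \<tturnstile> (x \<^bold>= b \<^bold>\<and> y \<^bold>= b)"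
        then show "w \<tturnstile> x \<^bold>\<subseteq> y" using empty by (simp add: and_iff)
      next
        fix v w assume "v \<le> s" "w \<le> v" "w \<tturnstile> (x \<^bold>= b \<^bold>\<and> y \<^bold>= t)"
        then show "w \<tturnstile> x \<^bold>\<subseteq> y" using empty by (simp add: and_iff)
      next
        fix v w assume "v \<le> s" "w \<le> v" "w \<tturnstile> (x \<^bold>= t \<^bold>\<and> y \<^bold>= t)"
        then show "w \<tturnstile> x \<^bold>\<subseteq> y" by (simp add: and_iff subset_iff eq_iff)
      qed
      with B have "s \<tturnstile> \<langle>x,y\<rangle> \<^bold>\<in> Q" using Q'[OF order_trans[OF s r]] BOm[OF s] by blast
      with iD[OF s i'(1)] iD[OF s i'(2)] show "s \<tturnstile> \<langle>x',y'\<rangle> \<^bold>\<in> Q" by (rule pair_in_cong)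
    qed
    then have mor: "r \<tturnstile> morphism_to_cpo i B L K Om Q" by (rule morphism_uncovered[OF K_empty[OF gen]])
    show "r \<tturnstile> (\<^bold>\<exists>g. valuation g)"
      using ex1_ex[OF free_universal[OF free[OF gen] props_omega_cpo[OF Om Q] mor]]
    proof (rule bexE)
      fix s g assume s: "s \<le> r" and g: "s \<tturnstile> omega_continuous g S R Om Q" and fac: "s \<tturnstile> factors i g \<eta>"
      note gen = fmono[OF s gen] and Om = fmono[OF s Om] and Q = fmono[OF s Q]
      \<comment> \<open>The factorisation of \<open>i\<close> through \<open>\<eta>\<close>, read at
        a generator \<open>x\<close>: \<open>g\<close> sends the value of \<open>\<eta>\<close> at
        \<open>x\<close> back to \<open>x\<close>.\<close>
      have val: "s \<tturnstile> \<langle>y,x\<rangle> \<^bold>\<in> g" if x: "r \<tturnstile> x \<^bold>\<in> B" and y: "s \<tturnstile> \<langle>x,y\<rangle> \<^bold>\<in> \<eta>" for x y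
      proof -
        have "s \<tturnstile> (\<^bold>\<exists>y. \<langle>x,y\<rangle> \<^bold>\<in> \<eta> \<^bold>\<and> \<langle>y,x\<rangle> \<^bold>\<in> g)"
          using fac fmono[OF s iI[OF x]] by (simp add: factors_iff)
        then show ?thesis
        proof (rule bexE)
          fix w y' assume w: "w \<le> s" and y': "w \<tturnstile> \<langle>x,y'\<rangle> \<^bold>\<in> \<eta>" "w \<tturnstile> \<langle>y',x\<rangle> \<^bold>\<in> g"
          have "w \<tturnstile> y' \<^bold>= y"
            using eta_value[OF fmono[OF w gen] fmono[OF w y] y'(1) eq_refl] .
          then show "w \<tturnstile> \<langle>y,x\<rangle> \<^bold>\<in> g" using eq_refl y'(2) by (rule pair_in_cong)
        qed
      qed
      have "r \<tturnstile> b \<^bold>\<in> B" "r \<tturnstile> t \<^bold>\<in> B"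
        using B_two[OF \<open>r \<tturnstile> generated\<close>] by (auto intro: upair_mem1 upair_mem2)
      then have "s \<tturnstile> \<langle>bt,b\<rangle> \<^bold>\<in> g" "s \<tturnstile> \<langle>tt,t\<rangle> \<^bold>\<in> g"
        using val eta_b[OF gen] eta_t[OF gen] by auto
      moreover have "s \<tturnstile> (\<^bold>\<forall>U j y x. enumerable_directed_subset U S R \<^bold>\<and> is_join j U S R \<^bold>\<and> \<langle>j,y\<rangle> \<^bold>\<in> g \<^bold>\<and> x \<^bold>\<in> y \<^bold>\<longrightarrow>
          (\<^bold>\<exists>u. u \<^bold>\<in> U \<^bold>\<and> (\<^bold>\<exists>z. \<langle>u,z\<rangle> \<^bold>\<in> g \<^bold>\<and> x \<^bold>\<in> z)))"
        unfolding all_iff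
      proof (intro allI fimpI)
        fix U j y x v
        assume v: "v \<le> s" and *: "v \<tturnstile> (enumerable_directed_subset U S R \<^bold>\<and> is_join j U S R \<^bold>\<and> \<langle>j,y\<rangle> \<^bold>\<in> g \<^bold>\<and> x \<^bold>\<in> y)"
        show "v \<tturnstile> (\<^bold>\<exists>u. u \<^bold>\<in> U \<^bold>\<and> (\<^bold>\<exists>z. \<langle>u,z\<rangle> \<^bold>\<in> g \<^bold>\<and> x \<^bold>\<in> z))"
          using * unfolding and_iff
          by (elim conjE) (rule continuous_valuation[OF fmono[OF v Om] fmono[OF v Q] fmono[OF v g]])
      qed
      ultimately have "s \<tturnstile> valuation g"
        using monotone_fun[OF continuous_monotone[OF g]] by (simp add: valuation_def and_iff)
      then show "s \<tturnstile> (\<^bold>\<exists>g. valuation g)" by (rule fexI)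
    qed
  qed
qed

section \<open>The order of the Sierpinski space and its top element\<close>

definition setting :: "'u \<Rightarrow> ('u, 'h) fm"
  where "setting g = (generated \<^bold>\<and> set_of_propositions Om \<^bold>\<and> valuation g)"

lemma settingD:
  assumes "p \<tturnstile> setting g"
  shows "p \<tturnstile> generated" "p \<tturnstile> set_of_propositions Om" "p \<tturnstile> is_fun g S Om" "p \<tturnstile> \<langle>bt,b\<rangle> \<^bold>\<in> g" "p \<tturnstile> \<langle>tt,t\<rangle> \<^bold>\<in> g"
  using assms by (auto simp: setting_def valuation_def and_iff)

lemma valuation_join:
  assumes "p \<tturnstile> setting g" "p \<tturnstile> enumerable_directed_subset U S R" "p \<tturnstile> is_join j U S R" "p \<tturnstile> \<langle>j,y\<rangle> \<^bold>\<in> g" "p \<tturnstile> x \<^bold>\<in> y"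
  shows "p \<tturnstile> (\<^bold>\<exists>u. u \<^bold>\<in> U \<^bold>\<and> (\<^bold>\<exists>z. \<langle>u,z\<rangle> \<^bold>\<in> g \<^bold>\<and> x \<^bold>\<in> z))"
  by (rule fmp[of _ "enumerable_directed_subset U S R \<^bold>\<and> is_join j U S R \<^bold>\<and> \<langle>j,y\<rangle> \<^bold>\<in> g \<^bold>\<and> x \<^bold>\<in> y"])
    (use assms in \<open>simp_all add: setting_def valuation_def and_iff all_iff\<close>)

lemma chain_bt_tt: "p \<tturnstile> generated \<Longrightarrow> p \<tturnstile> \<langle>bt,tt\<rangle> \<^bold>\<in> R"
  using monotoneD[OF eta_monotone _ eta_b eta_t] L_iff[of p b t] forI1 forI2 eq_refl
  by (simp add: and_iff)

lemma tt_greatest: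
  assumes gen: "p \<tturnstile> generated" and s: "p \<tturnstile> s \<^bold>\<in> S"
  shows "p \<tturnstile> \<langle>s,tt\<rangle> \<^bold>\<in> R"
  using gen _ s
proof (rule S_induct[where F = "\<lambda>s. \<langle>s,tt\<rangle> \<^bold>\<in> R"])
  show "separable (\<lambda>s. \<langle>s,tt\<rangle> \<^bold>\<in> R)"
    unfolding separable_def
    by (rule HOL.exI[of _ "pair_in_form 0 1 2"], rule HOL.exI[of _ "(\<lambda>_. R)(1 := tt)"])
      (simp add: bounded_intros eval_forms)
  show "p \<tturnstile> \<langle>bt,tt\<rangle> \<^bold>\<in> R" using gen by (rule chain_bt_tt)
  show "p \<tturnstile> \<langle>tt,tt\<rangle> \<^bold>\<in> R" using S_order[OF gen] tt_in_S[OF gen] by (rule partial_order_refl)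
  fix q U j assume q: "q \<le> p" and j: "q \<tturnstile> is_join j U S R"
    and IH: "\<And>r u. r \<le> q \<Longrightarrow> r \<tturnstile> u \<^bold>\<in> U \<Longrightarrow> r \<tturnstile> \<langle>u,tt\<rangle> \<^bold>\<in> R"
  show "q \<tturnstile> \<langle>j,tt\<rangle> \<^bold>\<in> R"
    using j tt_in_S[OF fmono[OF q gen]] IH by (rule join_least)
qed

lemma bt_least:
  assumes gen: "p \<tturnstile> generated" and s: "p \<tturnstile> s \<^bold>\<in> S"
  shows "p \<tturnstile> \<langle>bt,s\<rangle> \<^bold>\<in> R"
  using gen _ s
proof (rule S_induct[where F = "\<lambda>s. \<langle>bt,s\<rangle> \<^bold>\<in> R"])
  show "separable (\<lambda>s. \<langle>bt,s\<rangle> \<^bold>\<in> R)"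
    unfolding separable_def
    by (rule HOL.exI[of _ "pair_in_form 1 0 2"], rule HOL.exI[of _ "(\<lambda>_. R)(1 := bt)"])
      (simp add: bounded_intros eval_forms)
  show "p \<tturnstile> \<langle>bt,tt\<rangle> \<^bold>\<in> R" using gen by (rule chain_bt_tt)
  show "p \<tturnstile> \<langle>bt,bt\<rangle> \<^bold>\<in> R" using S_order[OF gen] bt_in_S[OF gen] by (rule partial_order_refl)
  fix q U j assume q: "q \<le> p" and U: "q \<tturnstile> enumerable_directed_subset U S R" and j: "q \<tturnstile> is_join j U S R"
    and IH: "\<And>r u. r \<le> q \<Longrightarrow> r \<tturnstile> u \<^bold>\<in> U \<Longrightarrow> r \<tturnstile> \<langle>bt,u\<rangle> \<^bold>\<in> R"
  have "q \<tturnstile> directed U R" and US: "q \<tturnstile> U \<^bold>\<subseteq> S" using U by (auto simp: eds_iff)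
  \<comment> \<open>A directed set is inhabited, and \<open>bt \<le> j\<close> passes through one of
    its members.\<close>
  from directed_nonempty[OF this(1)] show "q \<tturnstile> \<langle>bt,j\<rangle> \<^bold>\<in> R"
  proof (rule fexE)
    fix r u assume r: "r \<le> q" and u: "r \<tturnstile> u \<^bold>\<in> U"
    note gen = fmono[OF order_trans[OF r q] gen] and j = fmono[OF r j]
    show "r \<tturnstile> \<langle>bt,j\<rangle> \<^bold>\<in> R"
      using S_order[OF gen] bt_in_S[OF gen] subsetD[OF fmono[OF r US] u] join_mem[OF j] IH[OF r u] join_upper[OF j u]
      by (rule partial_order_trans)
  qed
qed

text \<open>Being equal to \<open>tt\<close> passes upwards because \<open>tt\<close> is greatest;
  this is monotonicity of \<open>s \<mapsto> (s = \<top>)\<close>.\<close>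

lemma above_tt:
  assumes gen: "p \<tturnstile> generated" and "p \<tturnstile> s \<^bold>\<in> S" "p \<tturnstile> \<langle>u,s\<rangle> \<^bold>\<in> R" "p \<tturnstile> u \<^bold>= tt"
  shows "p \<tturnstile> s \<^bold>= tt"
  using S_order[OF gen] assms(2) tt_in_S[OF gen] tt_greatest[OF gen assms(2)]
    pair_in_cong[OF assms(4) eq_refl assms(3)] by (rule partial_order_antisym)

text \<open>This identifies \<open>g\<close> with \<open>s \<mapsto> (s = \<top>)\<close>; the other
  direction is the value \<open>t\<close> of \<open>g\<close> at \<open>tt\<close>. In the
  induction, the value at \<open>bt\<close> is empty, and a member of the value at \<open>j\<close>
  is a member of the value at some \<open>u\<close> in \<open>U\<close>, so that
  \<open>u = \<top>\<close> and hence \<open>j = \<top>\<close>.\<close>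

lemma valuation_true:
  assumes st: "p \<tturnstile> setting g" and sy: "p \<tturnstile> \<langle>s,y\<rangle> \<^bold>\<in> g" and x: "p \<tturnstile> x \<^bold>\<in> y"
  shows "p \<tturnstile> s \<^bold>= tt"
proof -
  \<comment> \<open>The bound \<open>y \<in> Om\<close> makes \<open>?F\<close> separable and costs
    nothing, since \<open>g\<close> takes its values in \<open>Om\<close>.\<close>
  let ?F = "\<lambda>s. \<^bold>\<forall>y. y \<^bold>\<in> Om \<^bold>\<longrightarrow> \<langle>s,y\<rangle> \<^bold>\<in> g \<^bold>\<longrightarrow> (\<^bold>\<forall>x. x \<^bold>\<in> y \<^bold>\<longrightarrow> s \<^bold>= tt)"
  have FI: "q \<tturnstile> ?F s" if "\<And>r y x. r \<le> q \<Longrightarrow> r \<tturnstile> \<langle>s,y\<rangle> \<^bold>\<in> g \<Longrightarrow> r \<tturnstile> x \<^bold>\<in> y \<Longrightarrow> r \<tturnstile> s \<^bold>= tt" for q s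
    unfolding all_iff by (intro allI fimpI, unfold all_iff, intro allI fimpI) (meson that fmono order_trans)
  have FD: "q \<tturnstile> s \<^bold>= tt" if "q \<tturnstile> ?F s" "q \<tturnstile> y \<^bold>\<in> Om" "q \<tturnstile> \<langle>s,y\<rangle> \<^bold>\<in> g" "q \<tturnstile> x \<^bold>\<in> y" for q s y x
    using that unfolding all_iff imp_iff by (meson order_refl)
  have gen: "p \<tturnstile> generated" and g: "p \<tturnstile> is_fun g S Om"
    using settingD[OF st] by auto
  have "p \<tturnstile> ?F s"
    using gen _ fun_dom[OF g sy]
  proof (rule S_induct[where F = ?F])
    show "separable ?F"
      unfolding separable_def
      by (rule HOL.exI[of _ "Forall 1 (Imp (Mem 1 2) (Imp (pair_in_form 0 1 3) (Forall 4 (Imp (Mem 4 1) (eq_form 0 5)))))"],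
          rule HOL.exI[of _ "(\<lambda>_. Om)(3 := g, 5 := tt)"])
        (simp add: fm_value eval_forms, intro bounded_intros; simp)
    show "p \<tturnstile> ?F bt"
    proof (rule FI)
      fix r y x assume r: "r \<le> p" and y: "r \<tturnstile> \<langle>bt,y\<rangle> \<^bold>\<in> g" and x: "r \<tturnstile> x \<^bold>\<in> y"
      note st = settingD[OF fmono[OF r st]]
      have "r \<tturnstile> y \<^bold>= b" using st(3) y st(4) by (rule fun_unique)
      then have "r \<tturnstile> x \<^bold>\<in> b" using x by (rule eq_mem_right)
      with b_empty[OF st(1)] show "r \<tturnstile> bt \<^bold>= tt" by (rule empty_elim)
    qed
    show "p \<tturnstile> ?F tt"
      by (rule FI) (rule eq_refl)
    fix q U j assume q: "q \<le> p" and U: "q \<tturnstile> enumerable_directed_subset U S R" and j: "q \<tturnstile> is_join j U S R"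
      and IH: "\<And>r u. r \<le> q \<Longrightarrow> r \<tturnstile> u \<^bold>\<in> U \<Longrightarrow> r \<tturnstile> ?F u"
    show "q \<tturnstile> ?F j"
    proof (rule FI)
      fix r y x assume r: "r \<le> q" and y: "r \<tturnstile> \<langle>j,y\<rangle> \<^bold>\<in> g" and x: "r \<tturnstile> x \<^bold>\<in> y"
      note st = fmono[OF order_trans[OF r q] st] and j = fmono[OF r j]
      show "r \<tturnstile> j \<^bold>= tt"
        using valuation_join[OF st fmono[OF r U] j y x]
      proof (elim bexE)
        fix v u w z assume v: "v \<le> r" "v \<tturnstile> u \<^bold>\<in> U" and w: "w \<le> v" "w \<tturnstile> \<langle>u,z\<rangle> \<^bold>\<in> g" "w \<tturnstile> x \<^bold>\<in> z"
        have wr: "w \<le> r" and wq: "w \<le> q" using v w r by auto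
        note st = settingD[OF fmono[OF wr st]] and j = fmono[OF wr j] and u = fmono[OF w(1) v(2)]
        have "w \<tturnstile> u \<^bold>= tt"
          using IH[OF wq u] fun_cod[OF st(3) w(2)] w(2,3) by (rule FD)
        with st(1) join_mem[OF j] join_upper[OF j u] show "w \<tturnstile> j \<^bold>= tt" by (rule above_tt)
      qed
    qed
  qed
  then show ?thesis using fun_cod[OF g sy] sy x by (rule FD)
qed

text \<open>If \<open>j = \<top>\<close>, the value of \<open>g\<close> at \<open>j\<close> is
  \<open>{\<emptyset>}\<close>. Its member \<open>\<emptyset>\<close> lies in the value at some
  \<open>u\<close> in \<open>U\<close>, and \<open>valuation_true\<close> turns this into
  \<open>u = \<top>\<close>.\<close>

lemma tt_compact:
  assumes st: "p \<tturnstile> setting g" and U: "p \<tturnstile> enumerable_directed_subset U S R" and j: "p \<tturnstile> is_join j U S R"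
    and tt: "p \<tturnstile> j \<^bold>= tt"
  shows "p \<tturnstile> (\<^bold>\<exists>u. u \<^bold>\<in> U \<^bold>\<and> u \<^bold>= tt)"
proof -
  have "p \<tturnstile> \<langle>j,t\<rangle> \<^bold>\<in> g" using eq_sym[OF tt] eq_refl settingD(5)[OF st] by (rule pair_in_cong)
  from valuation_join[OF st U j this b_in_t[OF settingD(1)[OF st]]] show ?thesis
  proof (elim bexE)
    fix v u w z assume v: "v \<le> p" "v \<tturnstile> u \<^bold>\<in> U" and w: "w \<le> v" "w \<tturnstile> \<langle>u,z\<rangle> \<^bold>\<in> g" "w \<tturnstile> b \<^bold>\<in> z"
    have "w \<le> p" using v w by simp
    from valuation_true[OF fmono[OF this st] w(2,3)] fmono[OF w(1) v(2)]
    show "w \<tturnstile> (\<^bold>\<exists>u. u \<^bold>\<in> U \<^bold>\<and> u \<^bold>= tt)" by (intro bexI)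
  qed
qed

text \<open>\<open>g\<close> separates the two, having the values \<open>\<emptyset>\<close> and
  \<open>{\<emptyset>}\<close> there.\<close>

lemma bt_neq_tt:
  assumes st: "p \<tturnstile> setting g" and "p \<tturnstile> bt \<^bold>= tt"
  shows "p \<tturnstile> A"
proof -
  note st = settingD[OF st]
  have "p \<tturnstile> \<langle>tt,b\<rangle> \<^bold>\<in> g" using assms(2) eq_refl st(4) by (rule pair_in_cong)
  with st(3,5) have "p \<tturnstile> t \<^bold>= b" by (blast intro: fun_unique)
  then have "p \<tturnstile> b \<^bold>\<in> b" using b_in_t[OF st(1)] by (rule eq_mem_right)
  with b_empty[OF st(1)] show ?thesis by (rule empty_elim)
qed

text \<open>Induction on \<open>s\<close> with \<open>s'\<close> fixed. At a join \<open>j\<close>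
  the hypothesis passes to each \<open>u\<close> in \<open>U\<close>, because
  \<open>u = \<top>\<close> makes \<open>j = \<top>\<close>; hence every \<open>u\<close> is below
  \<open>s'\<close>, and so is \<open>j\<close>.\<close>

lemma order_embedding:
  assumes gen: "p \<tturnstile> generated" and s: "p \<tturnstile> s \<^bold>\<in> S" and s': "p \<tturnstile> s' \<^bold>\<in> S"
    and imp: "p \<tturnstile> (s \<^bold>= tt \<^bold>\<longrightarrow> s' \<^bold>= tt)"
  shows "p \<tturnstile> \<langle>s,s'\<rangle> \<^bold>\<in> R"
proof -
  let ?F = "\<lambda>s. (s \<^bold>= tt \<^bold>\<longrightarrow> s' \<^bold>= tt) \<^bold>\<longrightarrow> \<langle>s,s'\<rangle> \<^bold>\<in> R"
  have "p \<tturnstile> ?F s"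
    using gen _ s
  proof (rule S_induct[where F = ?F])
    show "separable ?F"
      unfolding separable_def
      by (rule HOL.exI[of _ "Imp (Imp (eq_form 0 1) (eq_form 2 1)) (pair_in_form 0 2 3)"],
          rule HOL.exI[of _ "(\<lambda>_. R)(1 := tt, 2 := s')"])
        (simp add: bounded_intros fm_value eval_forms)
    show "p \<tturnstile> ?F bt"
      by (rule fimpI) (use bt_least[OF gen s'] in \<open>blast intro: fmono\<close>)
    show "p \<tturnstile> ?F tt"
    proof (rule fimpI)
      fix q assume q: "q \<le> p" and "q \<tturnstile> (tt \<^bold>= tt \<^bold>\<longrightarrow> s' \<^bold>= tt)"
      then have e: "q \<tturnstile> tt \<^bold>= s'" using fmp eq_refl eq_sym by blast
      show "q \<tturnstile> \<langle>tt,s'\<rangle> \<^bold>\<in> R"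
        using eq_refl e partial_order_refl[OF S_order tt_in_S, OF fmono[OF q gen] fmono[OF q gen]]
        by (rule pair_in_cong)
    qed
    fix q U j assume q: "q \<le> p" and U: "q \<tturnstile> enumerable_directed_subset U S R" and j: "q \<tturnstile> is_join j U S R"
      and IH: "\<And>r u. r \<le> q \<Longrightarrow> r \<tturnstile> u \<^bold>\<in> U \<Longrightarrow> r \<tturnstile> ?F u"
    show "q \<tturnstile> ?F j"
    proof (rule fimpI)
      fix r assume r: "r \<le> q" and imp: "r \<tturnstile> (j \<^bold>= tt \<^bold>\<longrightarrow> s' \<^bold>= tt)"
      note j = fmono[OF r j]
      have rp: "r \<le> p" using r q by simp
      show "r \<tturnstile> \<langle>j,s'\<rangle> \<^bold>\<in> R"
        using j fmono[OF rp s']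
      proof (rule join_least)
        fix v u assume v: "v \<le> r" and u: "v \<tturnstile> u \<^bold>\<in> U"
        have "v \<tturnstile> (u \<^bold>= tt \<^bold>\<longrightarrow> s' \<^bold>= tt)"
        proof (rule fimpI)
          fix w assume w: "w \<le> v" and tt: "w \<tturnstile> u \<^bold>= tt"
          have wr: "w \<le> r" and wp: "w \<le> p" using w v rp by auto
          have "w \<tturnstile> j \<^bold>= tt"
            using fmono[OF wp gen] join_mem[OF fmono[OF wr j]] join_upper[OF fmono[OF wr j] fmono[OF w u]] tt
            by (rule above_tt)
          with fmono[OF wr imp] show "w \<tturnstile> s' \<^bold>= tt" by (rule fmp)
        qed
        with IH[OF order_trans[OF v r] u] show "v \<tturnstile> \<langle>u,s'\<rangle> \<^bold>\<in> R" by (rule fmp)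
      qed
    qed
  qed
  then show ?thesis using imp by (rule fmp)
qed

text \<open>\<open>Om\<close> need not contain every proposition, so \<open>\<sigma>\<close> needs a
  reason to belong to it: it has the same members as the value of \<open>g\<close> at
  \<open>s\<close>.\<close>

lemma prop_of_in_Om:
  assumes st: "p \<tturnstile> setting g" and s: "p \<tturnstile> s \<^bold>\<in> S" and \<sigma>: "p \<tturnstile> is_prop_of \<sigma> s tt"
  shows "p \<tturnstile> \<sigma> \<^bold>\<in> Om"
  using fun_total[OF settingD(3)[OF st] s]
proof (rule fexE)
  fix q y assume q: "q \<le> p" and y: "q \<tturnstile> \<langle>s,y\<rangle> \<^bold>\<in> g"
  note st = fmono[OF q st]
  have mem: "r \<tturnstile> x \<^bold>\<in> \<sigma> \<longleftrightarrow> r \<tturnstile> is_empty x \<and> r \<tturnstile> s \<^bold>= tt" if "r \<le> q" for r x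
    using fmono[OF q \<sigma>] that by (simp add: is_prop_of_def all_iff iff_iff and_iff)
  have yOm: "q \<tturnstile> y \<^bold>\<in> Om" using settingD(3)[OF st] y by (rule fun_cod)
  have "q \<tturnstile> y \<^bold>= \<sigma>"
  proof (rule eqI)
    fix r x assume r: "r \<le> q" and x: "r \<tturnstile> x \<^bold>\<in> y"
    note st = fmono[OF r st]
    have "r \<tturnstile> is_empty x" using settingD(2)[OF st] fmono[OF r yOm] x by (rule props_member)
    moreover have "r \<tturnstile> s \<^bold>= tt" using st fmono[OF r y] x by (rule valuation_true)
    ultimately show "r \<tturnstile> x \<^bold>\<in> \<sigma>" using mem[OF r] by blast
  next
    fix r x assume r: "r \<le> q" and "r \<tturnstile> x \<^bold>\<in> \<sigma>"
    then have x: "r \<tturnstile> is_empty x" "r \<tturnstile> s \<^bold>= tt" using mem[OF r] by auto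
    note st = settingD[OF fmono[OF r st]]
    have "r \<tturnstile> \<langle>tt,y\<rangle> \<^bold>\<in> g" using x(2) eq_refl fmono[OF r y] by (rule pair_in_cong)
    with st(3,5) have "r \<tturnstile> t \<^bold>= y" by (blast intro: fun_unique)
    moreover have "r \<tturnstile> x \<^bold>\<in> t" using mem_t[OF st(1)] x(1) by blast
    ultimately show "r \<tturnstile> x \<^bold>\<in> y" by (rule eq_mem_right)
  qed
  then show "q \<tturnstile> \<sigma> \<^bold>\<in> Om" using yOm by (rule eq_mem_left)
qed

section \<open>Dominance\<close>

text \<open>Antisymmetry after \<open>order_embedding\<close> in both directions. It makes the
  element that represents a proposition unique, which is what stands in for choice.\<close>

lemma eq_of_iff_tt:
  assumes gen: "p \<tturnstile> generated" and s: "p \<tturnstile> s \<^bold>\<in> S" "p \<tturnstile> s' \<^bold>\<in> S"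
    and "p \<tturnstile> (s \<^bold>= tt \<^bold>\<longleftrightarrow> A)" "p \<tturnstile> (s' \<^bold>= tt \<^bold>\<longleftrightarrow> A)"
  shows "p \<tturnstile> s \<^bold>= s'"
proof -
  have "p \<tturnstile> (s \<^bold>= tt \<^bold>\<longrightarrow> s' \<^bold>= tt)" "p \<tturnstile> (s' \<^bold>= tt \<^bold>\<longrightarrow> s \<^bold>= tt)"
    using assms(4,5) by (auto simp: iff_iff imp_iff)
  then show ?thesis
    using partial_order_antisym[OF S_order[OF gen] s] order_embedding[OF gen s] order_embedding[OF gen s(2,1)]
    by blast
qed

text \<open>Membership of a proposition in the image of \<open>S\<close>, with a formula in place of
  a subset of \<open>{\<emptyset>}\<close>. The quantifier is bounded by \<open>S\<close>, so
  induction predicates may contain it.\<close>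

definition represented :: "('u, 'h) fm \<Rightarrow> ('u, 'h) fm"
  where "represented A = (\<^bold>\<exists>v. v \<^bold>\<in> S \<^bold>\<and> (v \<^bold>= tt \<^bold>\<longleftrightarrow> A))"

lemma represented_cong:
  assumes "p \<tturnstile> represented A" and "\<And>q. q \<le> p \<Longrightarrow> q \<tturnstile> A \<longleftrightarrow> q \<tturnstile> A'"
  shows "p \<tturnstile> represented A'"
  using assms(1) unfolding represented_def
proof (rule bexE)
  fix q v assume q: "q \<le> p" and v: "q \<tturnstile> v \<^bold>\<in> S" "q \<tturnstile> (v \<^bold>= tt \<^bold>\<longleftrightarrow> A)"
  have "q \<tturnstile> (v \<^bold>= tt \<^bold>\<longleftrightarrow> A')"
    using v(2) assms(2) q unfolding iff_iff by (meson order_trans)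
  with v(1) show "q \<tturnstile> (\<^bold>\<exists>v. v \<^bold>\<in> S \<^bold>\<and> (v \<^bold>= tt \<^bold>\<longleftrightarrow> A'))" by (rule bexI)
qed

text \<open>Conjoining \<open>A\<close> to the members of \<open>U\<close> gives a monotone map \<open>U \<rightarrow> S\<close>, because order and equality
  of \<open>S\<close> are determined by which elements are \<open>\<top>\<close>. Its image is therefore an enumerable
  directed set, and by compactness of \<open>\<top>\<close> its join represents \<open>j \<and> A\<close>.\<close>

lemma represented_join:
  assumes st: "p \<tturnstile> setting g" and U: "p \<tturnstile> enumerable_directed_subset U S R" and j: "p \<tturnstile> is_join j U S R"
    and rep: "\<And>q u. q \<le> p \<Longrightarrow> q \<tturnstile> u \<^bold>\<in> U \<Longrightarrow> q \<tturnstile> represented (u \<^bold>= tt \<^bold>\<and> proposition_true P)"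
  shows "p \<tturnstile> represented (j \<^bold>= tt \<^bold>\<and> proposition_true P)"
proof -
  define F :: "'u \<Rightarrow> 'u \<Rightarrow> ('u, 'h) fm"
    where "F u v = (v \<^bold>\<in> S \<^bold>\<and> (v \<^bold>= tt \<^bold>\<longleftrightarrow> u \<^bold>= tt \<^bold>\<and> proposition_true P))" for u v
  have FD: "q \<tturnstile> v \<^bold>= tt \<longleftrightarrow> q \<tturnstile> u \<^bold>= tt \<and> q \<tturnstile> proposition_true P" if "q \<tturnstile> F u v" for q u v
    using that unfolding F_def and_iff iff_iff by (meson order_refl)
  have US: "p \<tturnstile> U \<^bold>\<subseteq> S" using U by (simp add: eds_iff)
  have gen: "p \<tturnstile> generated" using st by (rule settingD)
  have "p \<tturnstile> (\<^bold>\<exists>h. is_fun h U S \<^bold>\<and> (\<^bold>\<forall>u v. \<langle>u,v\<rangle> \<^bold>\<in> h \<^bold>\<longleftrightarrow> u \<^bold>\<in> U \<^bold>\<and> F u v))"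
  proof (rule function_ex)
    show "definable F"
      unfolding definable_def
      by (rule HOL.exI[of _ "And (Mem 2 3) (iff_form (eq_form 2 4) (And (eq_form 0 4) (Exists 6 (Mem 6 5))))"],
          rule HOL.exI[of _ "(\<lambda>_. S)(4 := tt, 5 := P)"])
        (simp add: F_def proposition_true_def eval_forms fm_value)
    show "q \<tturnstile> (\<^bold>\<exists>v. v \<^bold>\<in> S \<^bold>\<and> F u v)" if "q \<le> p" "q \<tturnstile> u \<^bold>\<in> U" for q u
      using rep[OF that] unfolding represented_def
      by (rule bexE) (rule bexI, assumption, simp add: F_def and_iff)
    \<comment> \<open>Elements with the same proposition are equal, so unique choice picks the
      values \<open>u \<and> P\<close> for all \<open>u\<close> at once.\<close>
    show "q \<tturnstile> v' \<^bold>= v" if "q \<le> p" "q \<tturnstile> F u v" "q \<tturnstile> F u v'" for q u v v'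
      using that unfolding F_def and_iff by (meson eq_of_iff_tt fmono gen)
  qed
  then show ?thesis
  proof (rule bexE)
    fix q h assume q: "q \<le> p" and h: "q \<tturnstile> is_fun h U S"
      and hF: "q \<tturnstile> (\<^bold>\<forall>u v. \<langle>u,v\<rangle> \<^bold>\<in> h \<^bold>\<longleftrightarrow> u \<^bold>\<in> U \<^bold>\<and> F u v)"
    have hF: "r \<tturnstile> F u v" if "r \<le> q" "r \<tturnstile> \<langle>u,v\<rangle> \<^bold>\<in> h" for r u v
      using hF that by (simp add: all_iff iff_iff and_iff)
    note st = fmono[OF q st] and gen = fmono[OF q gen] and U = fmono[OF q U] and US = fmono[OF q US] and j = fmono[OF q j]
    have hm: "q \<tturnstile> monotone_fun h U R S R"
      using h
    proof (rule monotoneI)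
      fix r u u' v v' assume r: "r \<le> q" and u: "r \<tturnstile> u \<^bold>\<in> U" "r \<tturnstile> u' \<^bold>\<in> U" "r \<tturnstile> \<langle>u,u'\<rangle> \<^bold>\<in> R"
        and v: "r \<tturnstile> \<langle>u,v\<rangle> \<^bold>\<in> h" "r \<tturnstile> \<langle>u',v'\<rangle> \<^bold>\<in> h"
      note h = fmono[OF r h] and gen = fmono[OF r gen] and US = fmono[OF r US]
      have "r \<tturnstile> (v \<^bold>= tt \<^bold>\<longrightarrow> v' \<^bold>= tt)"
      proof (rule fimpI)
        fix w assume w: "w \<le> r" and vt: "w \<tturnstile> v \<^bold>= tt"
        have F: "w \<tturnstile> F u v" "w \<tturnstile> F u' v'" using hF[OF r] v fmono[OF w] by blast+
        have "w \<tturnstile> u \<^bold>= tt" and P: "w \<tturnstile> proposition_true P" using FD[OF F(1)] vt by auto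
        then have "w \<tturnstile> u' \<^bold>= tt"
          using above_tt[OF fmono[OF w gen] fmono[OF w subsetD[OF US u(2)]] fmono[OF w u(3)]] by blast
        with P show "w \<tturnstile> v' \<^bold>= tt" using FD[OF F(2)] by blast
      qed
      then show "r \<tturnstile> \<langle>v,v'\<rangle> \<^bold>\<in> R"
        using gen fun_cod[OF h v(1)] fun_cod[OF h v(2)] by (blast intro: order_embedding)
    qed
    \<comment> \<open>The domain of \<open>h\<close> is \<open>U\<close> itself, so
      \<open>eds_image\<close> is applied to \<open>U\<close> as an enumerable directed subset of
      \<open>U\<close>.\<close>
    have UU: "q \<tturnstile> enumerable_directed_subset U U R" using U by (simp add: eds_iff subset_iff)
    show "q \<tturnstile> represented (j \<^bold>= tt \<^bold>\<and> proposition_true P)"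
    proof (rule fexE[OF image_ex[OF h, of U]])
      fix r V assume r: "r \<le> q" and V: "r \<tturnstile> is_image V h U"
      have VS: "r \<tturnstile> enumerable_directed_subset V S R"
        using fmono[OF r hm] fmono[OF r UU] V by (rule eds_image)
      show "r \<tturnstile> represented (j \<^bold>= tt \<^bold>\<and> proposition_true P)"
        using omega_cpo_join[OF S_cpo[OF fmono[OF r gen]] VS]
      proof (rule fexE)
        fix s k assume s: "s \<le> r" and k: "s \<tturnstile> is_join k V S R"
        \<comment> \<open>By compactness \<open>k = \<top>\<close> yields a \<open>v\<close> in
          \<open>V\<close> with \<open>v = \<top>\<close>, and \<open>v\<close> is
          \<open>u \<and> P\<close> for some \<open>u\<close> below \<open>j\<close>.\<close>
        have to_conj: "w \<tturnstile> (j \<^bold>= tt \<^bold>\<and> proposition_true P)" if w: "w \<le> s" and kt: "w \<tturnstile> k \<^bold>= tt" for w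
        proof -
          have wr: "w \<le> r" and wq: "w \<le> q" using w s r by auto
          show ?thesis
            using tt_compact[OF fmono[OF wq st] fmono[OF wr VS] fmono[OF w k] kt]
          proof (rule bexE)
            fix x v assume x: "x \<le> w" and v: "x \<tturnstile> v \<^bold>\<in> V" "x \<tturnstile> v \<^bold>= tt"
            show "x \<tturnstile> (j \<^bold>= tt \<^bold>\<and> proposition_true P)"
              using image_memD[OF fmono[OF order_trans[OF x wr] V] v(1)]
            proof (rule bexE)
              fix y u assume y: "y \<le> x" and u: "y \<tturnstile> u \<^bold>\<in> U" "y \<tturnstile> \<langle>u,v\<rangle> \<^bold>\<in> h"
              have yq: "y \<le> q" using y x wq by simp
              have ut: "y \<tturnstile> u \<^bold>= tt" and P: "y \<tturnstile> proposition_true P"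
                using FD[OF hF[OF yq u(2)]] fmono[OF y v(2)] by auto
              have "y \<tturnstile> j \<^bold>= tt"
                using fmono[OF yq gen] join_mem[OF fmono[OF yq j]] join_upper[OF fmono[OF yq j] u(1)] ut
                by (rule above_tt)
              with P show "y \<tturnstile> (j \<^bold>= tt \<^bold>\<and> proposition_true P)" by (simp add: and_iff)
            qed
          qed
        qed
        \<comment> \<open>By compactness \<open>j = \<top>\<close> yields a \<open>u\<close> in
          \<open>U\<close> with \<open>u = \<top>\<close>; given \<open>P\<close>, the value of
          \<open>h\<close> at \<open>u\<close> is \<open>\<top>\<close> and lies below
          \<open>k\<close>.\<close>
        have from_conj: "w \<tturnstile> k \<^bold>= tt" if w: "w \<le> s" and jt: "w \<tturnstile> j \<^bold>= tt" and P: "w \<tturnstile> proposition_true P" for w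
        proof -
          have wr: "w \<le> r" and wq: "w \<le> q" using w s r by auto
          show ?thesis
            using tt_compact[OF fmono[OF wq st] fmono[OF wq U] fmono[OF wq j] jt]
          proof (rule bexE)
            fix x u assume x: "x \<le> w" and u: "x \<tturnstile> u \<^bold>\<in> U" "x \<tturnstile> u \<^bold>= tt"
            show "x \<tturnstile> k \<^bold>= tt"
              using fun_total[OF fmono[OF order_trans[OF x wq] h] u(1)]
            proof (rule fexE)
              fix y v assume y: "y \<le> x" and v: "y \<tturnstile> \<langle>u,v\<rangle> \<^bold>\<in> h"
              have yq: "y \<le> q" and yr: "y \<le> r" and ys: "y \<le> s" and yw: "y \<le> w" using y x wq wr w by auto
              have "y \<tturnstile> v \<^bold>= tt"
                using FD[OF hF[OF yq v]] fmono[OF y u(2)] fmono[OF yw P] by blast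
              moreover have "y \<tturnstile> v \<^bold>\<in> V"
                using fmono[OF yr V] fmono[OF y u(1)] v by (rule image_memI)
              ultimately show "y \<tturnstile> k \<^bold>= tt"
                using above_tt[OF fmono[OF yq gen] join_mem[OF fmono[OF ys k]] join_upper[OF fmono[OF ys k]]] by blast
            qed
          qed
        qed
        have "s \<tturnstile> (k \<^bold>= tt \<^bold>\<longleftrightarrow> j \<^bold>= tt \<^bold>\<and> proposition_true P)"
          using to_conj from_conj unfolding iff_iff and_iff by blast
        with join_mem[OF k] show "s \<tturnstile> represented (j \<^bold>= tt \<^bold>\<and> proposition_true P)"
          unfolding represented_def by (rule bexI)
      qed
    qed
  qed
qed

text \<open>The hypothesis mentions \<open>s\<close> and therefore stays inside the induction
  predicate. \<open>bt\<close> itself represents its conjunction, since \<open>bt = \<top>\<close>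
  is absurd; at \<open>tt\<close> the hypothesis supplies the element; at a join it passes to every
  \<open>u\<close> in \<open>U\<close>, because \<open>u = \<top>\<close> makes
  \<open>j = \<top>\<close>.\<close>

lemma represented_conj:
  assumes st: "p \<tturnstile> setting g" and s: "p \<tturnstile> s \<^bold>\<in> S"
    and rep: "p \<tturnstile> (s \<^bold>= tt \<^bold>\<longrightarrow> represented (proposition_true P))"
  shows "p \<tturnstile> represented (s \<^bold>= tt \<^bold>\<and> proposition_true P)"
proof -
  let ?F = "\<lambda>s. (s \<^bold>= tt \<^bold>\<longrightarrow> represented (proposition_true P)) \<^bold>\<longrightarrow> represented (s \<^bold>= tt \<^bold>\<and> proposition_true P)"
  have gen: "p \<tturnstile> generated" using st by (rule settingD)
  have "p \<tturnstile> ?F s"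
    using gen _ s
  proof (rule S_induct[where F = ?F])
    \<comment> \<open>Inhabitedness of \<open>P\<close>. The membership is doubled because a bounded
      existential quantifier must have the shape \<open>Exists i (And (Mem i j) A)\<close>.\<close>
    let ?P = "Exists 6 (And (Mem 6 3) (Mem 6 3))"
    let ?r = "\<lambda>A. Exists 4 (And (Mem 4 1) (iff_form (eq_form 4 2) A))"
    show "separable ?F"
      unfolding separable_def
      by (rule HOL.exI[of _ "Imp (Imp (eq_form 0 2) (?r ?P)) (?r (And (eq_form 0 2) ?P))"],
          rule HOL.exI[of _ "(\<lambda>_. S)(2 := tt, 3 := P)"])
        (simp add: bounded_intros represented_def proposition_true_def fm_value eval_forms)
    show "p \<tturnstile> ?F bt"
    proof (rule fimpI)
      fix q assume q: "q \<le> p"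
      have "q \<tturnstile> (bt \<^bold>= tt \<^bold>\<longleftrightarrow> bt \<^bold>= tt \<^bold>\<and> proposition_true P)"
        unfolding iff_iff and_iff by (meson bt_neq_tt fmono order_trans q st)
      with bt_in_S[OF fmono[OF q gen]] show "q \<tturnstile> represented (bt \<^bold>= tt \<^bold>\<and> proposition_true P)"
        unfolding represented_def by (rule bexI)
    qed
    show "p \<tturnstile> ?F tt"
    proof (rule fimpI)
      fix q assume "q \<tturnstile> (tt \<^bold>= tt \<^bold>\<longrightarrow> represented (proposition_true P))"
      then have "q \<tturnstile> represented (proposition_true P)" using eq_refl by (rule fmp)
      then show "q \<tturnstile> represented (tt \<^bold>= tt \<^bold>\<and> proposition_true P)"
        by (rule represented_cong) (simp add: and_iff eq_refl)
    qed
    fix q U j assume q: "q \<le> p" and U: "q \<tturnstile> enumerable_directed_subset U S R" and j: "q \<tturnstile> is_join j U S R"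
      and IH: "\<And>r u. r \<le> q \<Longrightarrow> r \<tturnstile> u \<^bold>\<in> U \<Longrightarrow> r \<tturnstile> ?F u"
    show "q \<tturnstile> ?F j"
    proof (rule fimpI)
      fix r assume r: "r \<le> q" and rep: "r \<tturnstile> (j \<^bold>= tt \<^bold>\<longrightarrow> represented (proposition_true P))"
      have rp: "r \<le> p" using r q by simp
      show "r \<tturnstile> represented (j \<^bold>= tt \<^bold>\<and> proposition_true P)"
        using fmono[OF rp st] fmono[OF r U] fmono[OF r j]
      proof (rule represented_join)
        fix v u assume v: "v \<le> r" and u: "v \<tturnstile> u \<^bold>\<in> U"
        have "v \<tturnstile> (u \<^bold>= tt \<^bold>\<longrightarrow> represented (proposition_true P))"
        proof (rule fimpI)
          fix w assume w: "w \<le> v" and tt: "w \<tturnstile> u \<^bold>= tt"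
          have wr: "w \<le> r" and wq: "w \<le> q" and wp: "w \<le> p" using w v r q by auto
          have "w \<tturnstile> j \<^bold>= tt"
            using fmono[OF wp gen] join_mem[OF fmono[OF wq j]] join_upper[OF fmono[OF wq j] fmono[OF w u]] tt
            by (rule above_tt)
          with fmono[OF wr rep] show "w \<tturnstile> represented (proposition_true P)" by (rule fmp)
        qed
        with IH[OF order_trans[OF v r] u] show "v \<tturnstile> represented (u \<^bold>= tt \<^bold>\<and> proposition_true P)"
          by (rule fmp)
      qed
    qed
  qed
  then show ?thesis using rep by (rule fmp)
qed

lemma is_prop_of_iff:
  "p \<tturnstile> is_prop_of x s tt \<longleftrightarrow> (\<forall>q\<le>p. \<forall>y. q \<tturnstile> y \<^bold>\<in> x \<longleftrightarrow> q \<tturnstile> is_empty y \<and> q \<tturnstile> s \<^bold>= tt)"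
  by (auto simp: is_prop_of_def all_iff iff_iff and_iff)

text \<open>A subset of \<open>{\<emptyset>}\<close> is determined by whether it is inhabited. This
  turns the hypothesis into one about \<open>represented\<close>, and turns the element that
  \<open>represented_conj\<close> supplies back into a statement about the set
  \<open>\<sigma> \<inter> P\<close>.\<close>

lemma dominance_at:
  assumes st: "p \<tturnstile> setting g" and P: "p \<tturnstile> P \<^bold>\<in> Om" and s: "p \<tturnstile> s \<^bold>\<in> S" and \<sigma>: "p \<tturnstile> is_prop_of \<sigma> s tt"
    and imp: "p \<tturnstile> (proposition_true \<sigma> \<^bold>\<longrightarrow> in_sierpinski P Om S tt)"
  shows "p \<tturnstile> (\<^bold>\<exists>q. is_inter2 q \<sigma> P \<^bold>\<and> in_sierpinski q Om S tt)"
proof -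
  have gen: "p \<tturnstile> generated" and Om: "p \<tturnstile> set_of_propositions Om" using settingD[OF st] by auto
  have "p \<tturnstile> (s \<^bold>= tt \<^bold>\<longrightarrow> represented (proposition_true P))"
  proof (rule fimpI)
    fix q assume q: "q \<le> p" and tt: "q \<tturnstile> s \<^bold>= tt"
    have b: "q \<tturnstile> is_empty b" using b_empty[OF fmono[OF q gen]] .
    \<comment> \<open>\<open>b\<close> is the empty set, hence the canonical member of
      \<open>\<sigma>\<close> once \<open>s = \<top>\<close>.\<close>
    then have "q \<tturnstile> b \<^bold>\<in> \<sigma>" using \<sigma> q tt by (simp add: is_prop_of_iff)
    then have "q \<tturnstile> proposition_true \<sigma>" unfolding proposition_true_def by (rule fexI)
    with fmono[OF q imp] have "q \<tturnstile> in_sierpinski P Om S tt" by (rule fmp)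
    then have "q \<tturnstile> (\<^bold>\<exists>v. v \<^bold>\<in> S \<^bold>\<and> is_prop_of P v tt)" by (simp add: in_sierpinski_def and_iff)
    then show "q \<tturnstile> represented (proposition_true P)"
    proof (rule bexE)
      fix r v assume r: "r \<le> q" and v: "r \<tturnstile> v \<^bold>\<in> S" "r \<tturnstile> is_prop_of P v tt"
      have mem: "w \<tturnstile> y \<^bold>\<in> P \<longleftrightarrow> w \<tturnstile> is_empty y \<and> w \<tturnstile> v \<^bold>= tt" if "w \<le> r" for w y
        using v(2) that by (simp add: is_prop_of_iff)
      have "w \<tturnstile> v \<^bold>= tt \<longleftrightarrow> w \<tturnstile> proposition_true P" if w: "w \<le> r" for w
      proof
        assume "w \<tturnstile> v \<^bold>= tt"
        then have "w \<tturnstile> b \<^bold>\<in> P" using mem[OF w] fmono[OF order_trans[OF w r] b] by blast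
        then show "w \<tturnstile> proposition_true P" unfolding proposition_true_def by (rule fexI)
      next
        assume "w \<tturnstile> proposition_true P"
        then show "w \<tturnstile> v \<^bold>= tt" unfolding proposition_true_def
        proof (rule fexE)
          fix x y assume "x \<le> w" "x \<tturnstile> y \<^bold>\<in> P"
          then show "x \<tturnstile> v \<^bold>= tt" using mem[of x y] w by simp
        qed
      qed
      then have "r \<tturnstile> (v \<^bold>= tt \<^bold>\<longleftrightarrow> proposition_true P)" by (simp add: iff_iff)
      with v(1) show "r \<tturnstile> represented (proposition_true P)" unfolding represented_def by (rule bexI)
    qed
  qed
  with st s have "p \<tturnstile> represented (s \<^bold>= tt \<^bold>\<and> proposition_true P)" by (rule represented_conj)
  then show ?thesis unfolding represented_def
  proof (rule bexE)
    fix q v assume q: "q \<le> p" and v: "q \<tturnstile> v \<^bold>\<in> S" "q \<tturnstile> (v \<^bold>= tt \<^bold>\<longleftrightarrow> s \<^bold>= tt \<^bold>\<and> proposition_true P)"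
    have "separable (\<lambda>x. x \<^bold>\<in> P)"
      unfolding separable_def by (rule HOL.exI[of _ "Mem 0 1"], rule HOL.exI[of _ "\<lambda>_. P"]) (simp add: bounded_intros)
    from separation[OF this, of q \<sigma>]
    show "q \<tturnstile> (\<^bold>\<exists>q. is_inter2 q \<sigma> P \<^bold>\<and> in_sierpinski q Om S tt)"
    proof (rule fexE)
      fix r c assume r: "r \<le> q" and c: "r \<tturnstile> (\<^bold>\<forall>x. x \<^bold>\<in> c \<^bold>\<longleftrightarrow> x \<^bold>\<in> \<sigma> \<^bold>\<and> x \<^bold>\<in> P)"
      have rp: "r \<le> p" using r q by simp
      have inter: "r \<tturnstile> is_inter2 c \<sigma> P" using c by (simp add: is_inter2_def)
      have "r \<tturnstile> c \<^bold>\<in> Om"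
        using fmono[OF rp Om] fmono[OF rp prop_of_in_Om[OF st s \<sigma>]] fmono[OF rp P] inter by (rule props_inter)
      moreover have "r \<tturnstile> is_prop_of c v tt"
        unfolding is_prop_of_iff
      proof (intro allI HOL.impI)
        fix w x assume w: "w \<le> r"
        have wq: "w \<le> q" and wp: "w \<le> p" using w r q by auto
        have memc: "w \<tturnstile> x \<^bold>\<in> c \<longleftrightarrow> w \<tturnstile> is_empty x \<and> w \<tturnstile> s \<^bold>= tt \<and> w \<tturnstile> x \<^bold>\<in> P"
          using c \<sigma> w wp by (simp add: is_prop_of_iff all_iff iff_iff and_iff)
        have vt: "w \<tturnstile> v \<^bold>= tt \<longleftrightarrow> w \<tturnstile> s \<^bold>= tt \<and> w \<tturnstile> proposition_true P"
          using v(2) wq by (simp add: iff_iff and_iff)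
        \<comment> \<open>All members of \<open>P\<close> are empty and so equal to
          \<open>x\<close>; thus \<open>P\<close> contains \<open>x\<close> as soon as it is
          inhabited.\<close>
        have "w \<tturnstile> x \<^bold>\<in> P \<longleftrightarrow> w \<tturnstile> proposition_true P" if x: "w \<tturnstile> is_empty x"
        proof
          assume "w \<tturnstile> x \<^bold>\<in> P"
          then show "w \<tturnstile> proposition_true P" unfolding proposition_true_def by (rule fexI)
        next
          assume "w \<tturnstile> proposition_true P"
          then show "w \<tturnstile> x \<^bold>\<in> P" unfolding proposition_true_def
          proof (rule fexE)
            fix z y assume z: "z \<le> w" and y: "z \<tturnstile> y \<^bold>\<in> P"
            have zp: "z \<le> p" using z wp by simp
            have "z \<tturnstile> is_empty y" using fmono[OF zp Om] fmono[OF zp P] y by (rule props_member)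
            then have "z \<tturnstile> y \<^bold>= x" using fmono[OF z x] by (rule empty_unique)
            then show "z \<tturnstile> x \<^bold>\<in> P" using y by (rule eq_mem_left)
          qed
        qed
        with memc vt show "w \<tturnstile> x \<^bold>\<in> c \<longleftrightarrow> w \<tturnstile> is_empty x \<and> w \<tturnstile> v \<^bold>= tt" by blast
      qed
      with fmono[OF r v(1)] have "r \<tturnstile> (\<^bold>\<exists>s. s \<^bold>\<in> S \<^bold>\<and> is_prop_of c s tt)" by (rule bexI)
      ultimately have "r \<tturnstile> in_sierpinski c Om S tt" by (simp add: in_sierpinski_def and_iff)
      with inter show "r \<tturnstile> (\<^bold>\<exists>q. is_inter2 q \<sigma> P \<^bold>\<and> in_sierpinski q Om S tt)" by (rule bexI)
    qed
  qed
qed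

text \<open>The map \<open>g\<close> does not occur in the conclusion, so its existence on a cover
  of \<open>p\<close> is enough.\<close>

lemma dominance_generated:
  assumes gen: "p \<tturnstile> generated" and Om: "p \<tturnstile> set_of_propositions Om"
  shows "p \<tturnstile> dominance Om S tt"
  using valuation_ex[OF assms]
proof (rule fexE)
  fix q g assume q: "q \<le> p" and "q \<tturnstile> valuation g"
  then have st: "q \<tturnstile> setting g"
    using fmono[OF q gen] fmono[OF q Om] by (simp add: setting_def and_iff)
  show "q \<tturnstile> dominance Om S tt"
    unfolding dominance_def all_iff
  proof (intro allI fimpI)
    fix P s \<sigma> r
    assume r: "r \<le> q" and "r \<tturnstile> (P \<^bold>\<in> Om \<^bold>\<and> s \<^bold>\<in> S \<^bold>\<and> is_prop_of \<sigma> s tt \<^bold>\<and>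
      (proposition_true \<sigma> \<^bold>\<longrightarrow> in_sierpinski P Om S tt))"
    then show "r \<tturnstile> (\<^bold>\<exists>q. is_inter2 q \<sigma> P \<^bold>\<and> in_sierpinski q Om S tt)"
      unfolding and_iff by (elim conjE) (rule dominance_at[OF fmono[OF r st]])
  qed
qed

end

section \<open>Dominance for an arbitrary Sierpinski space\<close>

context model
begin

lemma sierpinski_dominance:
  assumes Om: "p \<tturnstile> set_of_propositions Om" and "p \<tturnstile> sierpinski S R tt"
  shows "p \<tturnstile> dominance Om S tt"
  using assms(2) unfolding sierpinski_def
proof (elim fexE)
  fix q1 B q2 L q3 K q4 b q5 t q \<eta>
  assume le: "q1 \<le> p" "q2 \<le> q1" "q3 \<le> q2" "q4 \<le> q3" "q5 \<le> q4" "q \<le> q5"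
    and "q \<tturnstile> (two_chain B L b t \<^bold>\<and> is_empty K \<^bold>\<and> free_omega_cpo B L K S R \<eta> \<^bold>\<and> \<langle>t,tt\<rangle> \<^bold>\<in> \<eta>)"
  then have D: "q \<tturnstile> two_chain B L b t" "q \<tturnstile> is_empty K" "q \<tturnstile> free_omega_cpo B L K S R \<eta>" "q \<tturnstile> \<langle>t,tt\<rangle> \<^bold>\<in> \<eta>"
    by (auto simp: and_iff)
  have q: "q \<le> p" using le by simp
  have \<eta>: "q \<tturnstile> is_fun \<eta> B S"
    using D(3) by (auto simp: free_omega_cpo_def morphism_to_cpo_def and_iff intro: monotone_fun)
  have "q \<tturnstile> b \<^bold>\<in> B" using D(1) by (auto simp: two_chain_def and_iff intro: upair_mem1)
  \<comment> \<open>\<open>sierpinski\<close> names the image of \<open>t\<close> but not that of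
    \<open>b\<close>; the latter is obtained here, at a smaller stage, and only then can the locale
    be entered.\<close>
  from fun_total[OF \<eta> this] show "q \<tturnstile> dominance Om S tt"
  proof (rule fexE)
    fix r bt assume r: "r \<le> q" and bt: "r \<tturnstile> \<langle>b,bt\<rangle> \<^bold>\<in> \<eta>"
    interpret sierpinski_setting M B L K b t \<eta> S R bt tt Om ..
    have "r \<tturnstile> generated"
      using D[THEN fmono[OF r]] bt by (simp add: generated_def and_iff)
    then show "r \<tturnstile> dominance Om S tt"
      using fmono[OF order_trans[OF r q] Om] by (rule dominance_generated)
  qed
qed

end

theorem mainTheorem1:
  fixes M :: "('u, 'h::frame) struct"
  assumes "\<And>A. A \<in> constructive_set_theory \<Longrightarrow> M \<Turnstile> A"
  shows "M \<Turnstile> (\<^bold>\<forall>Om S R tt. set_of_propositions Om \<^bold>\<and> sierpinski S R tt \<^bold>\<longrightarrow> dominance Om S tt)"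
proof -
  interpret model M by unfold_locales (rule assms)
  have "top \<tturnstile> (\<^bold>\<forall>Om S R tt. set_of_propositions Om \<^bold>\<and> sierpinski S R tt \<^bold>\<longrightarrow> dominance Om S tt)"
    unfolding all_iff by (intro allI fimpI) (auto simp: and_iff intro: sierpinski_dominance)
  then show ?thesis
    by (simp add: forces_def holds_in_def top_unique)
qed

end
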